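(* Let $d\ge1$, let $\mathscr T$ be a T-mesh and let $[\mathscr T]_{\mathrm I}$ be its structurally isomorphic class. Then $\mathscr T$ is dimensionally stable for $\mathbf S_d$ if and only if for any two T-meshes $\mathscr T_1,\mathscr T_2\in[\mathscr T]_{\mathrm I}$ the ranks of the conformality matrices of their CNDCs are equal, i.e. $$\operatorname{rank}\bigl(M(\overline T^{(1)}_{\mathrm{CNDC}})\bigr)=\operatorname{rank}\bigl(M(\overline T^{(2)}_{\mathrm{CNDC}})\bigr),$$ where $\overline T^{(1)}_{\mathrm{CNDC}}$ and $\overline T^{(2)}_{\mathrm{CNDC}}$ are the unique CNDCs of $\mathscr T_1$ and $\mathscr T_2$, respectively.
   Context: **T-mesh.** A T-mesh $\mathscr{T}=(\mathcal T_0,\mathcal T_1,\mathcal T_2)$ of $\mathbb R^2$ consists of a finite set $\mathcal T_2$ of closed axis-aligned rectangles (cells), a finite set $\mathcal T_1$ of closed horizontal and vertical segments (edges) contained in $\bigcup_{f\in\mathcal T_2}\partial f$, and the finite set $\mathcal T_0=\bigcup_{l\in\mathcal T_1}\partial l$ of vertices ($\partial l$ = endpoints of $l$), such that: each $\partial f$, $f\in\mathcal T_2$, is a finite union of edges; for distinct cells $f,f'$, $f\cap f'=\partial f\cap\partial f'$ is a finite union of elements of $\mathcal T_0\cup\mathcal T_1$; for distinct edges $l,l'$, $l\cap l'=\partial l\cap\partial l'\subseteq\mathcal T_0$; each vertex is the intersection of a horizontal and a vertical edge. The domain is $\Omega=\bigcup_{f\in\mathcal T_2}f$; it is assumed simply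 connected with connected interior $\Omega^0$. Vertices in $\Omega^0$ are interior vertices, the others boundary vertices; edges not contained in $\partial\Omega$ are interior edges. **$l$-edges.** A segment of $\mathscr T$ is a connected union of collinear mesh edges; an $l$-edge is a maximal such segment. An $l$-edge made of interior edges is an interior $l$-edge; a maximal segment contained in $\partial\Omega$ is a boundary $l$-edge. An interior $l$-edge is a cross-cut if both endpoints are boundary vertices, a ray if exactly one is, and a T $l$-edge if both are interior vertices. $B(\mathscr T),C(\mathscr T),R(\mathscr T)$ denote the sets of boundary $l$-edges, cross-cuts and rays. The T-connected component $T(\mathscr T)$ is the edge–vertex configuration formed by all T $l$-edges and all vertices on them; it is assumed connected; $L(T(\mathscr T))$ is the set of T $l$-edges. It is also assumed that no T $l$-edge is vanishable, i.e. every T $l$-edge carries at least $d+2$ vertices. **Spline space and dimensional stability.** $\mathbf S_d(\mathscr T)$ is the space of functions $s$ on $\Omega$ whose restriction to each cell is a polynomial of bi-degree $(d,d)$ and which are continuous of order $d-1$ along the $x$-direction and of order $d-1$ along the $y$-direction. Let $L(\mathscr T)$ be the set of all $l$-edges (boundary ones included), $L_1(\mathscr T)$, $L_2(\mathscr T)$ the horizontal and vertical ones, and $\operatorname{cor}(l)$ the constant $y$-coordinate (horizontal $l$) or $x$-coordinate (vertical $l$). $\mathscr T_1,\mathscr T_2$ are structurally isomorphic if there is a bijection $\alpha:L(\mathscr T_1)\to L(\mathscr T_2)$ (a structurally isomorphic map) with: (i) $\alpha(B(\mathscr T_1))=B(\mathscr T_2)$, $\alpha(C(\mathscr T_1))=C(\mathscr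 T_2)$, $\alpha(R(\mathscr T_1))=R(\mathscr T_2)$, $\alpha(L(T(\mathscr T_1)))=L(T(\mathscr T_2))$; (ii) $l_i\cap l_j\neq\varnothing\iff\alpha(l_i)\cap\alpha(l_j)\ne\varnothing$; (iii) for $k=1,2$ and $l_i,l_j\in L_k(\mathscr T_1)$, $\operatorname{cor}(l_i)<\operatorname{cor}(l_j)\Rightarrow\operatorname{cor}(\alpha(l_i))<\operatorname{cor}(\alpha(l_j))$. This is an equivalence relation; $[\mathscr T]_{\mathrm I}$ is the class of $\mathscr T$. $\mathscr T$ is dimensionally stable for $\mathbf S_d$ if $\dim\mathbf S_d(\mathscr T_1)=\dim\mathbf S_d(\mathscr T_2)$ for all $\mathscr T_1,\mathscr T_2\in[\mathscr T]_{\mathrm I}$. **Conformality matrix.** For a component $S$ (a set of T $l$-edges with specified retained vertices), assign an unknown $\delta_v$ to each retained vertex $v$. For each $l$-edge $l$ of $S$ with retained vertices $v_1,\dots,v_r$ having coordinates $x_1,\dots,x_r$ along $l$ ($x$-coordinates if $l$ is horizontal, $y$-coordinates if vertical), impose the $d+1$ linear equations $\sum_{i=1}^r x_i^k\delta_{v_i}=0$, $k=0,\dots,d$ (equivalently $\sum_i\delta_{v_i}(x-x_i)^d=0$). $M(S)$ is the coefficient matrix of all these equations (rank $0$ if $S$ is empty). **CNDC.** A bipartition $\{\overline T_1,\overline T_2\}$ of $T(\mathscr T)$ (an ordered pair) is given by splitting the T $l$-edges into disjoint subsets $\mathcal L_1,\mathcal L_2$ (either may be empty): $\overline T_1$ consists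 of the $l$-edges of $\mathcal L_1$ with all their vertices; $\overline T_2$ of the $l$-edges of $\mathcal L_2$ with their vertices except those shared with $l$-edges of $\mathcal L_1$. For a component $S$ with $s$ $l$-edges and an ordering $l_1\succ\dots\succ l_s$, let $\overline l_i$ be $l_i$ with its retained vertices in $S$, those shared with $l_1,\dots,l_{i-1}$ removed; $\{\overline l_1,\dots,\overline l_s\}$ is an $s$-partition of $S$, and $n(\overline l_i)$ is the number of vertices left on $\overline l_i$. A nonempty $S$ is diagonalizable if some $s$-partition has all $n(\overline l_i)\ge d+1$, otherwise non-diagonalizable; an empty component is admitted in either role. A bipartition is regular if $\overline T_1$ is non-diagonalizable and $\overline T_2$ diagonalizable; a regular partition $\{\overline T_1,\overline T_2\}$ is complete if no other regular partition $\{\overline T_1',\overline T_2'\}$ has $\overline T_1'\subseteq\overline T_1$ (inclusion of $l$-edges and retained vertices). The complete partition exists and is unique; its first component is the CNDC of $\mathscr T$. *)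

theory Defs
  imports "HOL-Analysis.Analysis" "HOL-Library.Function_Algebras"
begin

type_synonym point = "real \<times> real"

section \<open>Dimension and rank in spaces of real functions\<close>

global_interpretation fun_space: vector_space "\<lambda>(c::real) (f::'a \<Rightarrow> real) x. c * f x"
  by unfold_locales (simp_all add: fun_eq_iff algebra_simps)

text \<open>
  A matrix with rows indexed by \<^term>\<open>R\<close> and arbitrary column indices is a function
  \<^term>\<open>A :: 'r \<Rightarrow> 'c \<Rightarrow> real\<close>; its entries are zero in all columns that are not
  present.  As in the library, the rank is the dimension of the span of the rows.
\<close>

definition matrix_rank :: "'r set \<Rightarrow> ('r \<Rightarrow> 'c \<Rightarrow> real) \<Rightarrow> nat" where
  "matrix_rank R A = fun_space.dim (A ` R)"

section \<open>T-meshes\<close>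

definition rectangle :: "point set \<Rightarrow> bool" where
  "rectangle f \<longleftrightarrow> (\<exists>a b c e. a < b \<and> c < e \<and> f = {a..b} \<times> {c..e})"

definition horizontal :: "point set \<Rightarrow> bool" where
  "horizontal l \<longleftrightarrow> (\<exists>a b y. a < b \<and> l = closed_segment (a, y) (b, y))"

definition vertical :: "point set \<Rightarrow> bool" where
  "vertical l \<longleftrightarrow> (\<exists>a b x. a < b \<and> l = closed_segment (x, a) (x, b))"

definition endpoints :: "point set \<Rightarrow> point set" where
  "endpoints l = {p. \<exists>q. l = closed_segment p q}"

record tmesh =
  cells :: "point set set"
  edges :: "point set set"

definition vertices :: "tmesh \<Rightarrow> point set" where
  "vertices T = (\<Union>l\<in>edges T. endpoints l)"

definition dom_of :: "tmesh \<Rightarrow> point set" where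
  "dom_of T = \<Union> (cells T)"

definition mesh :: "tmesh \<Rightarrow> bool" where
  "mesh T \<longleftrightarrow>
     finite (cells T) \<and> (\<forall>f\<in>cells T. rectangle f) \<and>
     finite (edges T) \<and> (\<forall>l\<in>edges T. horizontal l \<or> vertical l) \<and>
     (\<forall>l\<in>edges T. l \<subseteq> (\<Union>f\<in>cells T. frontier f)) \<and>
     (\<forall>f\<in>cells T. \<exists>E\<subseteq>edges T. frontier f = \<Union> E) \<and>
     (\<forall>f\<in>cells T. \<forall>f'\<in>cells T. f \<noteq> f' \<longrightarrow>
        f \<inter> f' = frontier f \<inter> frontier f' \<and>
        (\<exists>V\<subseteq>vertices T. \<exists>E\<subseteq>edges T. f \<inter> f' = V \<union> \<Union> E)) \<and>
     (\<forall>l\<in>edges T. \<forall>l'\<in>edges T. l \<noteq> l' \<longrightarrow>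
        l \<inter> l' = endpoints l \<inter> endpoints l' \<and> l \<inter> l' \<subseteq> vertices T) \<and>
     (\<forall>v\<in>vertices T. \<exists>h\<in>edges T. \<exists>w\<in>edges T.
        horizontal h \<and> vertical w \<and> h \<inter> w = {v}) \<and>
     simply_connected (dom_of T) \<and> connected (interior (dom_of T))"

definition interior_vertices :: "tmesh \<Rightarrow> point set" where
  "interior_vertices T = vertices T \<inter> interior (dom_of T)"

definition boundary_vertices :: "tmesh \<Rightarrow> point set" where
  "boundary_vertices T = vertices T - interior (dom_of T)"

definition boundary_edges :: "tmesh \<Rightarrow> point set set" where
  "boundary_edges T = {e \<in> edges T. e \<subseteq> frontier (dom_of T)}"

definition interior_edges :: "tmesh \<Rightarrow> point set set" where
  "interior_edges T = {e \<in> edges T. \<not> e \<subseteq> frontier (dom_of T)}"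

section \<open>l-edges\<close>

definition segment_of :: "point set set \<Rightarrow> point set \<Rightarrow> bool" where
  "segment_of E s \<longleftrightarrow>
     (\<exists>E'\<subseteq>E. E' \<noteq> {} \<and> s = \<Union> E' \<and> connected s \<and> collinear s)"

definition max_segments :: "point set set \<Rightarrow> point set set" where
  "max_segments E =
     {s. segment_of E s \<and> (\<forall>s'. segment_of E s' \<and> s \<subseteq> s' \<longrightarrow> s' = s)}"

text \<open>
  At a reentrant corner of the domain an interior edge may prolong a boundary edge.
  Maximality is therefore taken among segments made of interior edges and among segments
  contained in the boundary, separately, so that every edge belongs to exactly one
  l-edge, which is either interior or boundary.
\<close>

definition interior_l_edges :: "tmesh \<Rightarrow> point set set" where
  "interior_l_edges T = max_segments (interior_edges T)"

definition boundary_l_edges :: "tmesh \<Rightarrow> point set set" where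
  "boundary_l_edges T = max_segments (boundary_edges T)"

definition l_edges :: "tmesh \<Rightarrow> point set set" where
  "l_edges T = boundary_l_edges T \<union> interior_l_edges T"

definition cross_cuts :: "tmesh \<Rightarrow> point set set" where
  "cross_cuts T = {l \<in> interior_l_edges T. endpoints l \<subseteq> boundary_vertices T}"

definition rays :: "tmesh \<Rightarrow> point set set" where
  "rays T = {l \<in> interior_l_edges T. card (endpoints l \<inter> boundary_vertices T) = 1}"

definition T_l_edges :: "tmesh \<Rightarrow> point set set" where
  "T_l_edges T = {l \<in> interior_l_edges T. endpoints l \<subseteq> interior_vertices T}"

text \<open>
  The standing assumptions depend on the degree \<^term>\<open>d\<close> through the requirement that no
  T l-edge is vanishable.
\<close>

definition T_mesh :: "nat \<Rightarrow> tmesh \<Rightarrow> bool" where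
  "T_mesh d T \<longleftrightarrow>
     mesh T \<and> connected (\<Union> (T_l_edges T)) \<and>
     (\<forall>l\<in>T_l_edges T. card (vertices T \<inter> l) \<ge> d + 2)"

section \<open>The spline space\<close>

definition bidegree_poly_on :: "nat \<Rightarrow> point set \<Rightarrow> (point \<Rightarrow> real) \<Rightarrow> bool" where
  "bidegree_poly_on d f s \<longleftrightarrow>
     (\<exists>c :: nat \<Rightarrow> nat \<Rightarrow> real. \<forall>(x, y)\<in>f. s (x, y) = (\<Sum>i\<le>d. \<Sum>j\<le>d. c i j * x ^ i * y ^ j))"

text \<open>
  \<^term>\<open>g i\<close> is the partial derivative of order \<^term>\<open>i\<close> of \<^term>\<open>s\<close> in the direction
  \<^term>\<open>u\<close>; at boundary points the derivatives are taken within the domain.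
\<close>

definition continuous_along :: "point \<Rightarrow> nat \<Rightarrow> point set \<Rightarrow> (point \<Rightarrow> real) \<Rightarrow> bool" where
  "continuous_along u k D s \<longleftrightarrow>
     (\<exists>g :: nat \<Rightarrow> point \<Rightarrow> real.
        (\<forall>p\<in>D. g 0 p = s p) \<and>
        (\<forall>i\<le>k. continuous_on D (g i)) \<and>
        (\<forall>i<k. \<forall>p\<in>D.
           ((\<lambda>t. g i (p + t *\<^sub>R u)) has_real_derivative g (Suc i) p)
             (at 0 within {t. p + t *\<^sub>R u \<in> D})))"

text \<open>Functions on the domain are represented by their extension by zero.\<close>

definition spline_space :: "nat \<Rightarrow> tmesh \<Rightarrow> (point \<Rightarrow> real) set" where
  "spline_space d T =
     {s. (\<forall>p. p \<notin> dom_of T \<longrightarrow> s p = 0) \<and>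
         (\<forall>f\<in>cells T. bidegree_poly_on d f s) \<and>
         continuous_along (1, 0) (d - 1) (dom_of T) s \<and>
         continuous_along (0, 1) (d - 1) (dom_of T) s}"

section \<open>Structural isomorphism and dimensional stability\<close>

definition cor :: "point set \<Rightarrow> real" where
  "cor l = (if horizontal l then the_elem (snd ` l) else the_elem (fst ` l))"

definition structurally_isomorphic_map ::
    "tmesh \<Rightarrow> tmesh \<Rightarrow> (point set \<Rightarrow> point set) \<Rightarrow> bool" where
  "structurally_isomorphic_map T1 T2 \<alpha> \<longleftrightarrow>
     bij_betw \<alpha> (l_edges T1) (l_edges T2) \<and>
     \<alpha> ` boundary_l_edges T1 = boundary_l_edges T2 \<and>
     \<alpha> ` cross_cuts T1 = cross_cuts T2 \<and>
     \<alpha> ` rays T1 = rays T2 \<and>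
     \<alpha> ` T_l_edges T1 = T_l_edges T2 \<and>
     (\<forall>l\<in>l_edges T1. \<forall>l'\<in>l_edges T1. l \<inter> l' \<noteq> {} \<longleftrightarrow> \<alpha> l \<inter> \<alpha> l' \<noteq> {}) \<and>
     (\<forall>l\<in>l_edges T1. \<forall>l'\<in>l_edges T1.
        (horizontal l \<and> horizontal l' \<or> vertical l \<and> vertical l') \<and> cor l < cor l' \<longrightarrow>
        cor (\<alpha> l) < cor (\<alpha> l'))"

definition iso_class :: "nat \<Rightarrow> tmesh \<Rightarrow> tmesh set" where
  "iso_class d T = {T'. T_mesh d T' \<and> (\<exists>\<alpha>. structurally_isomorphic_map T T' \<alpha>)}"

definition dimensionally_stable :: "nat \<Rightarrow> tmesh \<Rightarrow> bool" where
  "dimensionally_stable d T \<longleftrightarrow>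
     (\<forall>T1\<in>iso_class d T. \<forall>T2\<in>iso_class d T.
        fun_space.dim (spline_space d T1) = fun_space.dim (spline_space d T2))"

section \<open>Components and the conformality matrix\<close>

text \<open>
  The vertices retained on an l-edge \<^term>\<open>l\<close> of a component \<^term>\<open>S\<close> are those in
  \<^term>\<open>comp_vertices S \<inter> l\<close>.
\<close>

record component =
  comp_edges :: "point set set"
  comp_vertices :: "point set"

definition component_le :: "component \<Rightarrow> component \<Rightarrow> bool" where
  "component_le S S' \<longleftrightarrow> comp_edges S \<subseteq> comp_edges S' \<and> comp_vertices S \<subseteq> comp_vertices S'"

definition coord_along :: "point set \<Rightarrow> point \<Rightarrow> real" where
  "coord_along l v = (if horizontal l then fst v else snd v)"

text \<open>The row index \<^term>\<open>(l, k)\<close> stands for the equation of order \<^term>\<open>k\<close> of the l-edge \<^term>\<open>l\<close>.\<close>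

definition conformality_rows :: "nat \<Rightarrow> component \<Rightarrow> (point set \<times> nat) set" where
  "conformality_rows d S = comp_edges S \<times> {..d}"

definition conformality_matrix :: "component \<Rightarrow> point set \<times> nat \<Rightarrow> point \<Rightarrow> real" where
  "conformality_matrix S = (\<lambda>(l, k) v. if v \<in> comp_vertices S \<inter> l then coord_along l v ^ k else 0)"

definition conformality_rank :: "nat \<Rightarrow> component \<Rightarrow> nat" where
  "conformality_rank d S = matrix_rank (conformality_rows d S) (conformality_matrix S)"

section \<open>Bipartitions and the CNDC\<close>

definition bipartition :: "tmesh \<Rightarrow> component \<Rightarrow> component \<Rightarrow> bool" where
  "bipartition T S1 S2 \<longleftrightarrow>
     (\<exists>L1 L2. L1 \<union> L2 = T_l_edges T \<and> L1 \<inter> L2 = {} \<and>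
        S1 = \<lparr>comp_edges = L1, comp_vertices = vertices T \<inter> \<Union> L1\<rparr> \<and>
        S2 = \<lparr>comp_edges = L2, comp_vertices = vertices T \<inter> \<Union> L2 - \<Union> L1\<rparr>)"

text \<open>
  An ordering of the l-edges of a component is a list \<^term>\<open>ls\<close>; the number of vertices left
  on its entry with index \<^term>\<open>i\<close> is the following.
\<close>

definition vertices_left :: "component \<Rightarrow> point set list \<Rightarrow> nat \<Rightarrow> nat" where
  "vertices_left S ls i = card (comp_vertices S \<inter> ls ! i - (\<Union>j<i. ls ! j))"

definition empty_component :: "component \<Rightarrow> bool" where
  "empty_component S \<longleftrightarrow> comp_edges S = {}"

definition diagonalizable :: "nat \<Rightarrow> component \<Rightarrow> bool" where
  "diagonalizable d S \<longleftrightarrow>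
     (\<exists>ls. distinct ls \<and> set ls = comp_edges S \<and>
           (\<forall>i<length ls. vertices_left S ls i \<ge> d + 1))"

definition regular_partition :: "nat \<Rightarrow> tmesh \<Rightarrow> component \<Rightarrow> component \<Rightarrow> bool" where
  "regular_partition d T S1 S2 \<longleftrightarrow>
     bipartition T S1 S2 \<and>
     (empty_component S1 \<or> \<not> diagonalizable d S1) \<and>
     (empty_component S2 \<or> diagonalizable d S2)"

definition complete_partition :: "nat \<Rightarrow> tmesh \<Rightarrow> component \<Rightarrow> component \<Rightarrow> bool" where
  "complete_partition d T S1 S2 \<longleftrightarrow>
     regular_partition d T S1 S2 \<and>
     (\<forall>S1' S2'. regular_partition d T S1' S2' \<and> component_le S1' S1 \<longrightarrow>
        S1' = S1 \<and> S2' = S2)"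

definition CNDC :: "nat \<Rightarrow> tmesh \<Rightarrow> component" where
  "CNDC d T = (THE S1. \<exists>S2. complete_partition d T S1 S2)"

end

theory Submission
  imports Defs "HOL-Complex_Analysis.Complex_Analysis"
begin

text \<open>
  Within a structurally isomorphic class the sum of \<^term>\<open>fun_space.dim (spline_space d T)\<close>
  and \<^term>\<open>conformality_rank d (CNDC d T)\<close> is constant, so one of them is constant on the
  class if and only if the other is.  Three facts combine to this.
  
  The first is a dimension formula (\<open>dim_spline_space\<close>): the dimension of the spline space plus the
  rank of the conformality matrix of all T l-edges is \<open>(d+1)\<^sup>2 + (d+1) c + v\<close>, where \<open>c\<close> is the
  number of cross-cuts and \<open>v\<close> the number of interior vertices.  Across an edge the polynomials
  of the two adjacent cells differ by the power \<open>d\<close> of the distance to the line of the edge, times a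
  polynomial along the line (\<open>spline_space_iff\<close>).  Going around an interior vertex shows that along
  either line through it this factor changes by the same multiple of \<open>(x - x\<^sub>v)\<^sup>d\<close>
  (\<open>balanced_if_jumps\<close>).  Following an l-edge from vertex to vertex (\<open>chain_if_balanced\<close>), the
  factors are determined by these multiples and by the factor at its lower end.  That factor is free
  on a cross-cut, can be chosen to fit on a ray, and is zero on a T l-edge; there the sum of all
  changes has to vanish, which is the system of conformality conditions (\<open>moments\<close>).  Conversely,
  such data come from a spline.  Here the topology of the domain enters: because it is simply
  connected, jumps that balance at every interior vertex are the jumps of a function on the cells
  (\<open>potential_exists\<close>), and no two cells touch at a boundary vertex from opposite quadrants only
  (\<open>no_pinch\<close>), so pieces that fit along the edges also fit at the vertices.
  
  The second fact identifies the CNDC.  Diagonalizability of the second component of a bipartition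
  means that its l-edges can be removed one after the other from the set of all T l-edges, each
  having at least \<open>d + 1\<close> vertices on no other remaining l-edge.  An l-edge that can be removed from
  a set can be removed from any smaller set containing it, so all maximal sequences of removals
  end in the same core, and this is the CNDC (\<open>CNDC_eq_core\<close>).  Each removal lowers the rank by
  exactly \<open>d + 1\<close>, by invertibility of a Vandermonde matrix (\<open>rank_remove_l_edge\<close>).
  
  The third fact is that all the numbers involved are determined by the intersection pattern of the
  l-edges: the vertices of a T l-edge correspond to the other l-edges that meet it
  (\<open>card_private_vertices\<close>), and the interior vertices to the pairs of interior l-edges
  that meet away from the boundary (\<open>card_interior_vertices\<close>).  Hence a structurally isomorphic map
  preserves them.
\<close>

section \<open>Linear algebra in spaces of real functions\<close>

abbreviation (input) scale_fun :: "real \<Rightarrow> ('a \<Rightarrow> real) \<Rightarrow> 'a \<Rightarrow> real" where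
  "scale_fun \<equiv> \<lambda>c f x. c * f x"

lemma vector_space_pair_fun:
  "vector_space_pair (scale_fun :: _ \<Rightarrow> ('a \<Rightarrow> real) \<Rightarrow> _) (scale_fun :: _ \<Rightarrow> ('b \<Rightarrow> real) \<Rightarrow> _)"
  by (simp add: vector_space_pair_def fun_space.vector_space_axioms)

text \<open>
  The correspondence is a relation, so that linearity need not be checked for values that are
  only known to exist: a linear map that follows the relation on a basis follows it everywhere.
\<close>

lemma dim_eq_if_linear_correspondence:
  fixes R :: "('a \<Rightarrow> real) \<Rightarrow> ('b \<Rightarrow> real) \<Rightarrow> bool"
  assumes A: "fun_space.subspace A" and B: "fun_space.subspace B"
    and add: "\<And>a b a' b'. R a b \<Longrightarrow> R a' b' \<Longrightarrow> R (a + a') (b + b')"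
    and scale: "\<And>c a b. R a b \<Longrightarrow> R (scale_fun c a) (scale_fun c b)"
    and jump_total: "\<And>a. a \<in> A \<Longrightarrow> \<exists>b\<in>B. R a b"
    and onto: "\<And>b. b \<in> B \<Longrightarrow> \<exists>a\<in>A. R a b"
    and inj: "\<And>a. a \<in> A \<Longrightarrow> R a 0 \<Longrightarrow> a = 0"
    and fct: "\<And>b. b \<in> B \<Longrightarrow> R 0 b \<Longrightarrow> b = 0"
  shows "fun_space.dim A = fun_space.dim B"
proof -
  interpret vector_space_pair "scale_fun :: _ \<Rightarrow> ('a \<Rightarrow> real) \<Rightarrow> _"
      "scale_fun :: _ \<Rightarrow> ('b \<Rightarrow> real) \<Rightarrow> _"
    by (rule vector_space_pair_fun)
  obtain S where S: "S \<subseteq> A" "fun_space.independent S" "A \<subseteq> fun_space.span S" "card S = fun_space.dim A"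
    using fun_space.basis_exists by blast
  have spanS: "fun_space.span S = A"
    using S A by (metis fun_space.span_minimal subset_antisym)
  obtain g0 where g0: "\<And>a. a \<in> A \<Longrightarrow> g0 a \<in> B \<and> R a (g0 a)" using jump_total by metis
  obtain g where g: "Vector_Spaces.linear scale_fun scale_fun g" "\<forall>x\<in>S. g x = g0 x"
    using linear_independent_extend[OF S(2)] by blast
  interpret g: Vector_Spaces.linear scale_fun scale_fun g by (rule g)
  have R0: "R 0 0"
  proof -
    have "(0::'a\<Rightarrow>real) \<in> A" using A by (simp add: fun_space.subspace_0)
    then obtain b where b: "R 0 b" using jump_total by blast
    show ?thesis using scale[OF b, of 0] by (simp add: zero_fun_def)
  qed
  have sub: "fun_space.subspace {a. R a (g a) \<and> g a \<in> B}"
    unfolding fun_space.subspace_def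
    using R0 B add scale by (auto simp: g.zero g.add g.scale fun_space.subspace_def)
  have gA: "R a (g a) \<and> g a \<in> B" if "a \<in> A" for a
  proof -
    have "S \<subseteq> {a. R a (g a) \<and> g a \<in> B}" using g(2) g0 S(1) by auto
    hence "fun_space.span S \<subseteq> {a. R a (g a) \<and> g a \<in> B}" using sub fun_space.span_minimal by blast
    thus ?thesis using spanS that by auto
  qed
  have injg: "inj_on g (fun_space.span S)"
  proof (subst g.inj_on_iff_eq_0[OF fun_space.subspace_span], safe)
    fix x assume "x \<in> fun_space.span S" "g x = 0"
    thus "x = 0" using gA[of x] inj[of x] spanS by auto
  qed
  have "g ` A = B"
  proof
    show "g ` A \<subseteq> B" using gA by auto
    show "B \<subseteq> g ` A"
    proof
      fix b assume b: "b \<in> B"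
      then obtain a where a: "a \<in> A" "R a b" using onto by blast
      have "R (a + scale_fun (-1) a) (b + scale_fun (-1) (g a))"
        using a gA by (intro add scale) auto
      moreover have "a + scale_fun (-1) a = 0" by (auto simp: fun_eq_iff)
      moreover have "b + scale_fun (-1) (g a) \<in> B" using b gA[OF a(1)] B
        by (metis fun_space.subspace_add fun_space.subspace_scale)
      ultimately have "b + scale_fun (-1) (g a) = 0" using fct by metis
      hence "b = g a" by (auto simp: fun_eq_iff)
      thus "b \<in> g ` A" using a by blast
    qed
  qed
  moreover have "fun_space.span (g ` S) = g ` A" using spanS linear_span_image[OF g(1)] by auto
  moreover have "fun_space.independent (g ` S)"
    using linear_independent_injective_image[OF g(1) S(2) injg] .
  ultimately have "fun_space.dim B = card (g ` S)"
    by (metis fun_space.dim_span_eq_card_independent)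
  also have "\<dots> = card S" by (intro card_image inj_on_subset[OF injg fun_space.span_superset])
  finally show ?thesis using S(4) by simp
qed

lemma dim_insert_Suc:
  fixes S :: "('a \<Rightarrow> real) set"
  assumes "finite S" "x \<notin> fun_space.span S"
  shows "fun_space.dim (insert x S) = Suc (fun_space.dim S)"
proof -
  obtain B where B: "B \<subseteq> S" "fun_space.independent B" "S \<subseteq> fun_space.span B" "card B = fun_space.dim S"
    using fun_space.basis_exists by blast
  have eq: "fun_space.span B = fun_space.span S"
    using B by (metis fun_space.span_eq fun_space.span_superset subset_trans)
  have fin: "finite B" using B assms finite_subset by auto
  have x: "x \<notin> fun_space.span B" using eq assms by auto
  have "fun_space.independent (insert x B)" using x B by (intro fun_space.independent_insertI)
  moreover have "fun_space.span (insert x B) = fun_space.span (insert x S)"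
    using eq by (simp add: fun_space.span_insert)
  ultimately have "fun_space.dim (insert x S) = card (insert x B)"
    by (metis fun_space.dim_span_eq_card_independent fun_space.dim_span)
  also have "\<dots> = Suc (card B)" using fin x by (metis card_insert_disjoint fun_space.span_base)
  finally show ?thesis using B by simp
qed

text \<open>
  A combination of the new rows that lies in the span of the old ones vanishes off \<^term>\<open>W\<close>,
  so it is trivial.
\<close>

lemma dim_add_rows_independent_off:
  fixes X :: "('a \<Rightarrow> real) set" and r :: "nat \<Rightarrow> 'a \<Rightarrow> real"
  assumes fin: "finite X" and X: "\<And>f v. f \<in> X \<Longrightarrow> v \<notin> W \<Longrightarrow> f v = 0"
    and ind: "\<And>c. (\<And>v. v \<notin> W \<Longrightarrow> (\<Sum>k<n. c k * r k v) = 0) \<Longrightarrow> \<forall>k<n. c k = (0::real)"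
  shows "fun_space.dim (X \<union> r ` {..<n}) = fun_space.dim X + n"
proof -
  have "fun_space.dim (X \<union> r ` {..<m}) = fun_space.dim X + m" if "m \<le> n" for m
    using that
  proof (induction m)
    case 0 thus ?case by simp
  next
    case (Suc m)
    define G where "G = {f. \<exists>c. \<forall>v. v \<notin> W \<longrightarrow> f v = (\<Sum>k<m. c k * r k v)}"
    have "fun_space.subspace G"
    proof (unfold fun_space.subspace_def, intro conjI ballI allI)
      show "0 \<in> G" unfolding G_def by (auto intro: exI[of _ "\<lambda>_. 0"])
    next
      fix f g assume "f \<in> G" "g \<in> G"
      then obtain c e where "\<forall>v. v \<notin> W \<longrightarrow> f v = (\<Sum>k<m. c k * r k v)"
        "\<forall>v. v \<notin> W \<longrightarrow> g v = (\<Sum>k<m. e k * r k v)" unfolding G_def by auto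
      hence "\<forall>v. v \<notin> W \<longrightarrow> (f + g) v = (\<Sum>k<m. (c k + e k) * r k v)"
        by (auto simp: algebra_simps sum.distrib)
      thus "f + g \<in> G" unfolding G_def by (intro CollectI exI)
    next
      fix a f assume "f \<in> G"
      then obtain c where "\<forall>v. v \<notin> W \<longrightarrow> f v = (\<Sum>k<m. c k * r k v)" unfolding G_def by auto
      hence "\<forall>v. v \<notin> W \<longrightarrow> (scale_fun a f) v = (\<Sum>k<m. (a * c k) * r k v)"
        by (auto simp: sum_distrib_left algebra_simps)
      thus "scale_fun a f \<in> G" unfolding G_def by (intro CollectI exI)
    qed
    moreover have "X \<union> r ` {..<m} \<subseteq> G"
    proof -
      have "f \<in> G" if "f \<in> X" for f
        unfolding G_def using X[OF that] by (intro CollectI exI[of _ "\<lambda>_. 0"]) auto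
      moreover have "r j \<in> G" if "j < m" for j
        unfolding G_def using that
        by (intro CollectI exI[of _ "\<lambda>k. if k = j then 1 else 0"]) (auto simp: if_distrib[of "\<lambda>x. x * _"] cong: if_cong)
      ultimately show ?thesis by auto
    qed
    ultimately have span: "fun_space.span (X \<union> r ` {..<m}) \<subseteq> G" by (simp add: fun_space.span_minimal)
    have "r m \<notin> G"
    proof
      assume "r m \<in> G"
      then obtain c where c: "\<And>v. v \<notin> W \<Longrightarrow> r m v = (\<Sum>k<m. c k * r k v)" unfolding G_def by auto
      define e where "e k = (if k < m then - c k else if k = m then 1 else 0)" for k
      have "(\<Sum>k<n. e k * r k v) = 0" if "v \<notin> W" for v
      proof -
        have "(\<Sum>k<n. e k * r k v) = (\<Sum>k<Suc m. e k * r k v)"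
          using Suc.prems by (intro sum.mono_neutral_right) (auto simp: e_def)
        also have "\<dots> = (\<Sum>k<m. - (c k * r k v)) + r m v" by (simp add: e_def)
        also have "\<dots> = 0" using c[OF that] by (simp add: sum_negf)
        finally show ?thesis .
      qed
      from ind[OF this] have "e m = 0" using Suc.prems by auto
      thus False by (simp add: e_def)
    qed
    hence "r m \<notin> fun_space.span (X \<union> r ` {..<m})" using span by auto
    hence "fun_space.dim (insert (r m) (X \<union> r ` {..<m})) = Suc (fun_space.dim (X \<union> r ` {..<m}))"
      using fin by (intro dim_insert_Suc) auto
    moreover have "X \<union> r ` {..<Suc m} = insert (r m) (X \<union> r ` {..<m})" by (auto simp: lessThan_Suc)
    ultimately show ?case using Suc by simp
  qed
  thus ?thesis by blast
qed

definition supported_on :: "'a set \<Rightarrow> ('a \<Rightarrow> real) set" where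
  "supported_on I = {f. \<forall>i. i \<notin> I \<longrightarrow> f i = 0}"

lemma subspace_supported_on: "fun_space.subspace (supported_on I)"
  by (auto simp: fun_space.subspace_def supported_on_def)

definition annihilator_on :: "'a set \<Rightarrow> ('a \<Rightarrow> real) set \<Rightarrow> ('a \<Rightarrow> real) set" where
  "annihilator_on I R = {f \<in> supported_on I. \<forall>r\<in>R. (\<Sum>i\<in>I. r i * f i) = 0}"

lemma subspace_annihilator_on: "fun_space.subspace (annihilator_on I R)"
  using subspace_supported_on[of I]
  by (auto simp: fun_space.subspace_def annihilator_on_def algebra_simps sum.distrib
      sum_distrib_left[symmetric] simp flip: sum_distrib_left)

definition unit_fun :: "'a \<Rightarrow> 'a \<Rightarrow> real" where
  "unit_fun i = (\<lambda>j. if j = i then 1 else 0)"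

lemma sum_fun_apply: "(\<Sum>i\<in>I. F i) x = (\<Sum>i\<in>I. F i x)" for F :: "'i \<Rightarrow> 'a \<Rightarrow> real"
  by (induction I rule: infinite_finite_induct) auto

lemma supported_on_expand:
  assumes "finite I" "f \<in> supported_on I"
  shows "f = (\<Sum>i\<in>I. scale_fun (f i) (unit_fun i))"
  using assms by (auto simp: fun_eq_iff sum_fun_apply unit_fun_def supported_on_def if_distrib cong: if_cong)

lemma dim_supported_on:
  assumes "finite I"
  shows "fun_space.dim (supported_on I) = card I"
proof -
  have dim0: "fun_space.dim ({} :: ('a \<Rightarrow> real) set) = 0"
    using fun_space.dim_le_card[of "{}" "{}"] by simp
  have "card J = fun_space.dim (unit_fun ` J :: ('a \<Rightarrow> real) set)" if "finite J" for J
    using that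
  proof (induction J)
    case empty
    show ?case using dim0 by simp
  next
    case (insert x F)
    have "fun_space.span (unit_fun ` F) \<subseteq> supported_on F"
      by (intro fun_space.span_minimal subspace_supported_on) (auto simp: supported_on_def unit_fun_def)
    moreover have "unit_fun x \<notin> supported_on F" using insert by (auto simp: supported_on_def unit_fun_def)
    ultimately have "unit_fun x \<notin> fun_space.span (unit_fun ` F)" by blast
    from dim_insert_Suc[OF _ this] show ?case using insert by simp
  qed
  moreover have "fun_space.span (unit_fun ` I) = supported_on I"
  proof
    show "fun_space.span (unit_fun ` I) \<subseteq> supported_on I"
      by (intro fun_space.span_minimal subspace_supported_on) (auto simp: supported_on_def unit_fun_def)
    show "supported_on I \<subseteq> fun_space.span (unit_fun ` I)"
    proof
      fix f :: "'a \<Rightarrow> real" assume f: "f \<in> supported_on I"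
      show "f \<in> fun_space.span (unit_fun ` I)"
        by (subst supported_on_expand[OF assms f])
          (intro fun_space.span_sum fun_space.span_scale fun_space.span_base imageI)
    qed
  qed
  ultimately show ?thesis using assms by (metis fun_space.dim_span)
qed

text \<open>
  Rank plus nullity.  A row outside the span of the others is not orthogonal to the common
  kernel of the others: a linear functional that is 1 on it and 0 on the others provides a witness.
\<close>

lemma dim_annihilator_on:
  assumes I: "finite I" and R: "finite R" "R \<subseteq> supported_on I"
  shows "fun_space.dim (annihilator_on I R) + fun_space.dim R = card I"
  using R
proof (induction R)
  case empty
  have "annihilator_on I {} = supported_on I" by (auto simp: annihilator_on_def)
  moreover have "fun_space.dim ({} :: ('a \<Rightarrow> real) set) = 0"
    using fun_space.dim_le_card[of "{}" "{}"] by simp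
  ultimately show ?case using dim_supported_on[OF I] by simp
next
  case (insert r R)
  define ip where "ip f g = (\<Sum>i\<in>I. f i * g i)" for f g :: "'a \<Rightarrow> real"
  have ip_add: "ip (f + g) h = ip f h + ip g h" "ip h (f + g) = ip h f + ip h g"
    and ip_scale: "ip (scale_fun c f) h = c * ip f h" "ip h (scale_fun c f) = c * ip h f" for f g h c
    by (auto simp: ip_def algebra_simps sum.distrib sum_distrib_left)
  have ann: "annihilator_on I R' = {f \<in> supported_on I. \<forall>r\<in>R'. ip r f = 0}" for R'
    by (auto simp: annihilator_on_def ip_def)
  show ?case
  proof (cases "r \<in> fun_space.span R")
    case True
    have "ip r f = 0" if "f \<in> annihilator_on I R" for f
    proof -
      have "fun_space.subspace {g. ip g f = 0}"
        using ip_add ip_scale by (auto simp: fun_space.subspace_def ip_def)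
      hence "fun_space.span R \<subseteq> {g. ip g f = 0}" using that
        by (intro fun_space.span_minimal) (auto simp: ann)
      thus ?thesis using True by auto
    qed
    hence "annihilator_on I (insert r R) = annihilator_on I R" by (auto simp: ann)
    moreover have "fun_space.dim (insert r R) = fun_space.dim R"
      using True by (metis fun_space.dim_span fun_space.span_redundant)
    ultimately show ?thesis using insert by simp
  next
    case False
    interpret vector_space_pair "scale_fun :: _ \<Rightarrow> ('a \<Rightarrow> real) \<Rightarrow> _"
        "scale_fun :: _ \<Rightarrow> (unit \<Rightarrow> real) \<Rightarrow> _"
      by (rule vector_space_pair_fun)
    obtain B where B: "B \<subseteq> R" "fun_space.independent B" "R \<subseteq> fun_space.span B"
        "card B = fun_space.dim R"
      using fun_space.basis_exists[of R] by blast
    have rB: "r \<notin> fun_space.span B" using False fun_space.span_mono[OF B(1)] by blast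
    hence ind: "fun_space.independent (insert r B)" using B by (intro fun_space.independent_insertI)
    obtain L :: "('a \<Rightarrow> real) \<Rightarrow> unit \<Rightarrow> real" where L: "Vector_Spaces.linear scale_fun scale_fun L"
      "\<forall>x\<in>insert r B. L x = (if x = r then (\<lambda>_. 1) else 0)"
      using linear_independent_extend[OF ind, of "\<lambda>x. if x = r then (\<lambda>_. 1) else 0"] by blast
    interpret L: Vector_Spaces.linear scale_fun scale_fun L by (rule L)
    \<comment> \<open>the functional \<open>L\<close> as an inner product\<close>
    define w where "w i = (if i \<in> I then L (unit_fun i) () else 0)" for i
    have w: "ip f w = L f ()" if "f \<in> supported_on I" for f
      by (subst (2) supported_on_expand[OF I that])
        (simp add: L.sum L.scale sum_fun_apply w_def ip_def)
    have wI: "w \<in> supported_on I" by (auto simp: supported_on_def w_def)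
    have rw: "ip r w = 1" using L(2) w insert.prems by auto
    have "fun_space.subspace {g. L g = 0}"
      by (auto simp: fun_space.subspace_def L.add L.scale L.zero)
    moreover have "B \<subseteq> {g. L g = 0}" using L(2) rB fun_space.span_base[of r B] by auto
    ultimately have "fun_space.span B \<subseteq> {g. L g = 0}" by (simp add: fun_space.span_minimal)
    hence Rw: "ip g w = 0" if "g \<in> R" for g
    proof -
      have "g \<in> {g. L g = 0}" using that B(3) \<open>fun_space.span B \<subseteq> {g. L g = 0}\<close> by (meson subsetD)
      thus ?thesis using w[of g] insert.prems that by auto
    qed
    define N where "N = annihilator_on I (insert r R)"
    have N: "fun_space.subspace N" unfolding N_def by (rule subspace_annihilator_on)
    obtain S where S: "S \<subseteq> N" "fun_space.independent S" "N \<subseteq> fun_space.span S" "card S = fun_space.dim N"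
      using fun_space.basis_exists by blast
    have spanS: "fun_space.span S = N"
      using S N by (metis fun_space.span_minimal subset_antisym)
    have finS: "finite S"
    proof -
      have "S \<subseteq> fun_space.span (unit_fun ` I)"
      proof
        fix f assume "f \<in> S"
        hence f: "f \<in> supported_on I" using S N_def by (auto simp: ann)
        show "f \<in> fun_space.span (unit_fun ` I)"
          by (subst supported_on_expand[OF I f])
            (intro fun_space.span_sum fun_space.span_scale fun_space.span_base imageI)
      qed
      thus ?thesis using fun_space.independent_span_bound[of "unit_fun ` I" S] I S(2) by auto
    qed
    have wN: "w \<notin> fun_space.span S" using spanS rw by (auto simp: N_def ann)
    have "fun_space.span (insert w S) = annihilator_on I R"
    proof
      have "insert w S \<subseteq> annihilator_on I R" using wI Rw S(1) by (auto simp: ann N_def)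
      thus "fun_space.span (insert w S) \<subseteq> annihilator_on I R"
        by (intro fun_space.span_minimal subspace_annihilator_on)
      show "annihilator_on I R \<subseteq> fun_space.span (insert w S)"
      proof
        fix f assume f: "f \<in> annihilator_on I R"
        have "f - scale_fun (ip r f) w \<in> annihilator_on I R"
          using f wI Rw subspace_annihilator_on[of I R]
          by (intro fun_space.subspace_diff fun_space.subspace_scale) (auto simp: ann)
        moreover have "ip r (f - scale_fun (ip r f) w) = 0"
          using ip_add(2)[of r "f - scale_fun (ip r f) w" "scale_fun (ip r f) w"]
          by (simp add: ip_scale rw)
        ultimately have "f - scale_fun (ip r f) w \<in> N" by (auto simp: N_def ann)
        thus "f \<in> fun_space.span (insert w S)" using spanS
          by (subst fun_space.span_insert) auto
      qed
    qed
    hence "fun_space.dim (annihilator_on I R) = Suc (fun_space.dim N)"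
      using dim_insert_Suc[OF finS wN] spanS by (metis fun_space.dim_span)
    moreover have "fun_space.dim (insert r R) = Suc (fun_space.dim R)"
      using False insert by (intro dim_insert_Suc)
    ultimately show ?thesis using insert by (simp add: N_def)
  qed
qed

text \<open>
  This turns the equations for the vertices into equations for a larger family of unknowns.
\<close>

lemma dim_image_column_embedding:
  fixes h :: "'a \<Rightarrow> 'b"
  assumes h: "inj h"
  shows "fun_space.dim ((\<lambda>f j. if j \<in> range h then f (inv h j) else 0) ` R) = fun_space.dim R"
    (is "fun_space.dim (?E ` R) = _")
proof -
  interpret vector_space_pair "scale_fun :: _ \<Rightarrow> ('a \<Rightarrow> real) \<Rightarrow> _"
      "scale_fun :: _ \<Rightarrow> ('b \<Rightarrow> real) \<Rightarrow> _"
    by (rule vector_space_pair_fun)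
  have lin: "Vector_Spaces.linear scale_fun scale_fun ?E"
    unfolding Vector_Spaces.linear_iff by (intro conjI fun_space.vector_space_axioms) (simp_all add: fun_eq_iff)
  have inj: "inj ?E"
  proof (rule injI)
    fix f g assume "?E f = ?E g"
    hence "?E f (h x) = ?E g (h x)" for x by metis
    thus "f = g" using h by (auto simp: fun_eq_iff)
  qed
  obtain B where B: "B \<subseteq> R" "fun_space.independent B" "R \<subseteq> fun_space.span B" "card B = fun_space.dim R"
    using fun_space.basis_exists by blast
  have "fun_space.independent (?E ` B)"
    using linear_independent_injective_image[OF lin B(2)] inj by (auto intro: inj_on_subset)
  moreover have "?E ` R \<subseteq> fun_space.span (?E ` B)"
    using linear_span_image[OF lin, of B] B(3) by auto
  moreover have "?E ` B \<subseteq> ?E ` R" using B by auto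
  ultimately have "fun_space.dim (?E ` R) = card (?E ` B)" by (intro fun_space.basis_card_eq_dim[symmetric])
  also have "\<dots> = card B" using inj by (intro card_image) (auto intro: inj_on_subset)
  finally show ?thesis using B by simp
qed

section \<open>Axis-parallel segments and rectangles\<close>

text \<open>
  Statements about horizontal and vertical edges are proved together by letting a truth value
  stand for a direction: \<^term>\<open>True\<close> is horizontal, \<^term>\<open>False\<close> vertical.
\<close>

definition coord :: "bool \<Rightarrow> point \<Rightarrow> real" where
  "coord b p = (if b then fst p else snd p)"

definition point_at :: "bool \<Rightarrow> real \<Rightarrow> real \<Rightarrow> point" where
  "point_at b x y = (if b then (x, y) else (y, x))"

lemma coord_point_at [simp]:
  "coord b (point_at b x y) = x" "coord (\<not> b) (point_at b x y) = y" "coord b (point_at (\<not> b) x y) = y"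
  "point_at b (coord b p) (coord (\<not> b) p) = p"
  by (auto simp: coord_def point_at_def)

lemma coord_point_at_bool [simp]:
  "coord True (point_at False x y) = y" "coord False (point_at True x y) = y"
  by (auto simp: coord_def point_at_def)

lemma point_at_eq_iff [simp]: "point_at b x y = point_at b x' y' \<longleftrightarrow> x = x' \<and> y = y'"
  by (auto simp: point_at_def)

lemma point_eqI: "coord b p = coord b q \<Longrightarrow> coord (\<not> b) p = coord (\<not> b) q \<Longrightarrow> p = q"
  by (cases b) (auto simp: coord_def prod_eq_iff)

lemma all_bool_split: "(\<forall>b. P b) \<longleftrightarrow> P c \<and> P (\<not> c)" for c :: bool
  by (cases c) (auto simp: all_bool_eq)

lemma coord_add: "coord b (p + q) = coord b p + coord b q"
  and coord_scaleR: "coord b (r *\<^sub>R p) = r * coord b p"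
  by (auto simp: coord_def)

lemma continuous_on_coord [continuous_intros]:
  "continuous_on S f \<Longrightarrow> continuous_on S (\<lambda>x. coord b (f x))"
  by (cases b) (auto simp: coord_def intro: continuous_intros)

definition axis_segment :: "bool \<Rightarrow> real \<Rightarrow> real \<Rightarrow> real \<Rightarrow> point set" where
  "axis_segment b x1 x2 y = {p. x1 \<le> coord b p \<and> coord b p \<le> x2 \<and> coord (\<not> b) p = y}"

lemma closed_segment_eq_axis_segment:
  assumes "x1 < x2"
  shows "closed_segment (point_at b x1 y) (point_at b x2 y) = axis_segment b x1 x2 y"
proof (intro set_eqI iffI)
  fix p assume "p \<in> closed_segment (point_at b x1 y) (point_at b x2 y)"
  then obtain u where u: "0 \<le> u" "u \<le> 1" "p = (1 - u) *\<^sub>R point_at b x1 y + u *\<^sub>R point_at b x2 y"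
    by (auto simp: in_segment)
  have c: "coord b p = x1 + u * (x2 - x1)" "coord (\<not> b) p = y"
    by (simp_all add: u(3) coord_add coord_scaleR) (simp_all add: algebra_simps)
  have "u * (x2 - x1) \<le> x2 - x1" using u assms by (intro mult_left_le_one_le) auto
  moreover have "0 \<le> u * (x2 - x1)" using u assms by simp
  ultimately have "x1 \<le> coord b p" "coord b p \<le> x2" unfolding c by linarith+
  thus "p \<in> axis_segment b x1 x2 y" using c by (simp add: axis_segment_def)
next
  fix p assume p: "p \<in> axis_segment b x1 x2 y"
  define u where "u = (coord b p - x1) / (x2 - x1)"
  have "0 \<le> u" "u \<le> 1" using p assms by (auto simp: u_def axis_segment_def)
  moreover have "coord b p = x1 + u * (x2 - x1)" using assms by (simp add: u_def)
  hence "p = (1 - u) *\<^sub>R point_at b x1 y + u *\<^sub>R point_at b x2 y" using p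
    by (intro point_eqI[of b]) (auto simp: axis_segment_def coord_def point_at_def algebra_simps)
  ultimately show "p \<in> closed_segment (point_at b x1 y) (point_at b x2 y)" by (auto simp: in_segment)
qed

lemma horizontal_iff: "horizontal l \<longleftrightarrow> (\<exists>a b y. a < b \<and> l = axis_segment True a b y)"
proof -
  have "closed_segment (a, y) (b, y) = axis_segment True a b y" if "a < b" for a b y
    using closed_segment_eq_axis_segment[OF that, of True] by (simp add: point_at_def)
  thus ?thesis unfolding horizontal_def by metis
qed

lemma vertical_iff: "vertical l \<longleftrightarrow> (\<exists>a b y. a < b \<and> l = axis_segment False a b y)"
proof -
  have "closed_segment (y, a) (y, b) = axis_segment False a b y" if "a < b" for a b y
    using closed_segment_eq_axis_segment[OF that, of False] by (simp add: point_at_def)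
  thus ?thesis unfolding vertical_def by metis
qed

text \<open>
  Edges and l-edges are plain point sets, so direction, range and level have to be recovered from
  the set.
\<close>
definition "dir e = horizontal e"
definition "lo e = Inf (coord (dir e) ` e)"
definition "hi e = Sup (coord (dir e) ` e)"
definition "lev e = (SOME y. \<exists>p\<in>e. coord (\<not> dir e) p = y)"

lemma coord_image_axis_segment: "x1 < x2 \<Longrightarrow> coord b ` axis_segment b x1 x2 y = {x1..x2}"
proof
  assume "x1 < x2"
  show "{x1..x2} \<subseteq> coord b ` axis_segment b x1 x2 y"
  proof
    fix x assume "x \<in> {x1..x2}"
    hence "point_at b x y \<in> axis_segment b x1 x2 y" by (auto simp: axis_segment_def)
    thus "x \<in> coord b ` axis_segment b x1 x2 y" by force
  qed
qed (auto simp: axis_segment_def)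

lemma dir_axis_segment [simp]:
  assumes "x1 < x2"
  shows "dir (axis_segment b x1 x2 y) = b"
proof (cases b)
  case True thus ?thesis using assms by (auto simp: dir_def horizontal_iff)
next
  case False
  have "\<not> horizontal (axis_segment False x1 x2 y)"
  proof
    assume "horizontal (axis_segment False x1 x2 y)"
    then obtain a c z where *: "axis_segment False x1 x2 y = axis_segment True a c z" by (auto simp: horizontal_iff)
    have "point_at False x1 y \<in> axis_segment False x1 x2 y" "point_at False x2 y \<in> axis_segment False x1 x2 y"
      using assms by (auto simp: axis_segment_def point_at_def coord_def)
    thus False using assms unfolding * by (auto simp: axis_segment_def point_at_def coord_def)
  qed
  thus ?thesis using False by (simp add: dir_def)
qed

lemma axis_segment_data [simp]:
  assumes "x1 < x2"
  shows "lo (axis_segment b x1 x2 y) = x1" "hi (axis_segment b x1 x2 y) = x2" "lev (axis_segment b x1 x2 y) = y"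
proof -
  show "lo (axis_segment b x1 x2 y) = x1" "hi (axis_segment b x1 x2 y) = x2"
    using assms by (auto simp: lo_def hi_def coord_image_axis_segment)
  have "point_at b x1 y \<in> axis_segment b x1 x2 y" using assms by (auto simp: axis_segment_def)
  moreover have "\<And>p. p \<in> axis_segment b x1 x2 y \<Longrightarrow> coord (\<not> b) p = y" by (auto simp: axis_segment_def)
  ultimately show "lev (axis_segment b x1 x2 y) = y" using assms
    by (simp only: lev_def dir_axis_segment) (rule some_equality, blast, blast)
qed

definition straight :: "point set \<Rightarrow> bool" where
  "straight e \<longleftrightarrow> lo e < hi e \<and> e = axis_segment (dir e) (lo e) (hi e) (lev e)"

lemma straight_axis_segment [simp]: "x1 < x2 \<Longrightarrow> straight (axis_segment b x1 x2 y)"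
  by (simp add: straight_def)

lemma straight_iff: "straight e \<longleftrightarrow> horizontal e \<or> vertical e"
proof
  assume "horizontal e \<or> vertical e"
  then obtain a b x y where "x < y" "e = axis_segment a x y b" by (auto simp: horizontal_iff vertical_iff)
  thus "straight e" by simp
next
  assume "straight e"
  thus "horizontal e \<or> vertical e" unfolding straight_def horizontal_iff vertical_iff
    by (metis (full_types))
qed

lemma vertical_iff_dir: "straight e \<Longrightarrow> vertical e \<longleftrightarrow> \<not> dir e"
  proof
  assume "vertical e"
  thus "\<not> dir e" by (auto simp: vertical_iff)
next
  assume "straight e" "\<not> dir e"
  thus "vertical e" by (auto simp: straight_iff dir_def)
qed

lemma straight_lt: "straight e \<Longrightarrow> lo e < hi e" by (simp add: straight_def)

lemma mem_straight:
  "straight e \<Longrightarrow> p \<in> e \<longleftrightarrow> lo e \<le> coord (dir e) p \<and> coord (dir e) p \<le> hi e \<and> coord (\<not> dir e) p = lev e"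
  unfolding straight_def axis_segment_def by blast

definition "lower_end e = point_at (dir e) (lo e) (lev e)"
definition "upper_end e = point_at (dir e) (hi e) (lev e)"

lemma endpoints_straight: "straight e \<Longrightarrow> endpoints e = {lower_end e, upper_end e}"
proof -
  assume e: "straight e"
  hence *: "e = closed_segment (lower_end e) (upper_end e)"
    unfolding lower_end_def upper_end_def by (metis closed_segment_eq_axis_segment straight_def)
  show ?thesis unfolding endpoints_def
    by (subst *, unfold closed_segment_eq doubleton_eq_iff) blast
qed

lemma ends_mem: "straight e \<Longrightarrow> lower_end e \<in> e" "straight e \<Longrightarrow> upper_end e \<in> e"
  by (auto simp: mem_straight lower_end_def upper_end_def straight_lt less_imp_le)

lemma lower_end_neq_upper_end: "straight e \<Longrightarrow> lower_end e \<noteq> upper_end e"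
  using straight_lt by (fastforce simp: lower_end_def upper_end_def)

lemma coord_ends [simp]:
  "coord (dir e) (lower_end e) = lo e" "coord (\<not> dir e) (lower_end e) = lev e"
  "coord (dir e) (upper_end e) = hi e" "coord (\<not> dir e) (upper_end e) = lev e"
  by (auto simp: lower_end_def upper_end_def)

lemma closed_straight: "straight e \<Longrightarrow> closed e"
  unfolding straight_def by (metis closed_segment closed_segment_eq_axis_segment)

definition open_edge :: "point set \<Rightarrow> point set" where
  "open_edge e = {p. lo e < coord (dir e) p \<and> coord (dir e) p < hi e \<and> coord (\<not> dir e) p = lev e}"

lemma open_edge_eq: "straight e \<Longrightarrow> open_edge e = e - endpoints e"
  by (auto simp: open_edge_def endpoints_straight mem_straight lower_end_def upper_end_def intro: point_eqI[of "dir e"])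

definition "rlo f b = Inf (coord b ` f)"
definition "rhi f b = Sup (coord b ` f)"

lemma rectangle_data:
  assumes "rectangle f"
  shows "rlo f b < rhi f b" "f = {p. \<forall>b. rlo f b \<le> coord b p \<and> coord b p \<le> rhi f b}"
    "interior f = {p. \<forall>b. rlo f b < coord b p \<and> coord b p < rhi f b}"
    "closed f" "convex f" "compact f"
proof -
  obtain a b' c e where f: "a < b'" "c < e" "f = {a..b'} \<times> {c..e}" using assms by (auto simp: rectangle_def)
  have im: "coord True ` f = {a..b'}" "coord False ` f = {c..e}"
    using f by (auto simp: coord_def)
  have d: "rlo f True = a" "rhi f True = b'" "rlo f False = c" "rhi f False = e"
    unfolding rlo_def rhi_def im using f by auto
  show "rlo f b < rhi f b" using d f by (cases b) auto
  show "f = {p. \<forall>b. rlo f b \<le> coord b p \<and> coord b p \<le> rhi f b}"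
    unfolding all_bool_split[where c=True] by (subst f(3)) (auto simp: d coord_def)
  show "interior f = {p. \<forall>b. rlo f b < coord b p \<and> coord b p < rhi f b}"
    unfolding all_bool_split[where c=True] by (subst f(3)) (auto simp: d coord_def interior_Times)
  show "closed f" "convex f" "compact f" unfolding f(3)
    by (auto intro: closed_Times convex_Times compact_Times)
qed

lemma mem_rectangle: "rectangle f \<Longrightarrow> p \<in> f \<longleftrightarrow> (\<forall>b. rlo f b \<le> coord b p \<and> coord b p \<le> rhi f b)"
  using rectangle_data(2)[of f] by blast

lemma frontier_rectangle: "rectangle f \<Longrightarrow> frontier f = f - interior f"
  by (simp add: frontier_def rectangle_data(4))

section \<open>Local structure of a T-mesh\<close>

definition open_square :: "point \<Rightarrow> real \<Rightarrow> point set" where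
  "open_square p r = {q. \<forall>b. \<bar>coord b q - coord b p\<bar> < r}"

lemma open_square_subset_open:
  assumes "open S" "p \<in> S"
  shows "\<exists>r>0. open_square p r \<subseteq> S"
proof -
  obtain e where e: "e > 0" "ball p e \<subseteq> S" using assms open_contains_ball by blast
  have "open_square p (e/2) \<subseteq> ball p e"
  proof
    fix q assume "q \<in> open_square p (e/2)"
    hence *: "\<bar>coord b q - coord b p\<bar> < e/2" for b by (auto simp: open_square_def)
    have "dist q p \<le> \<bar>fst q - fst p\<bar> + \<bar>snd q - snd p\<bar>"
      unfolding dist_prod_def dist_real_def using sqrt_sum_squares_le_sum_abs[of "fst q - fst p" "snd q - snd p"]
      by simp
    thus "q \<in> ball p e" using *[of True] *[of False] by (auto simp: coord_def dist_commute)
  qed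
  thus ?thesis using e by (intro exI[of _ "e/2"]) auto
qed

lemma mem_open_square_self: "r > 0 \<Longrightarrow> p \<in> open_square p r" by (simp add: open_square_def)

lemma open_open_square: "open (open_square p r)"
proof -
  have "open_square p r = {q. \<bar>fst q - fst p\<bar> < r} \<inter> {q. \<bar>snd q - snd p\<bar> < r}"
    by (auto simp: open_square_def coord_def all_bool_split[where c=True])
  moreover have "open {q. \<bar>fst q - fst p\<bar> < r}" "open {q. \<bar>snd q - snd p\<bar> < r}"
    by (intro open_Collect_less continuous_intros)+
  ultimately show ?thesis using open_Int by metis
qed

definition sg :: "bool \<Rightarrow> real" where "sg b = (if b then 1 else -1)"

text \<open>
  \<^term>\<open>\<sigma> b\<close> tells whether the coordinate in direction \<^term>\<open>b\<close> is larger or smaller than at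
  the corner \<^term>\<open>p\<close>.
\<close>
definition quadrant :: "point \<Rightarrow> real \<Rightarrow> (bool \<Rightarrow> bool) \<Rightarrow> point set" where
  "quadrant p r \<sigma> = {q. \<forall>b. 0 < sg (\<sigma> b) * (coord b q - coord b p) \<and> sg (\<sigma> b) * (coord b q - coord b p) < r}"

lemma quadrant_subset_open_square: "quadrant p r \<sigma> \<subseteq> open_square p r"
proof
  fix q assume q: "q \<in> quadrant p r \<sigma>"
  have "\<bar>coord b q - coord b p\<bar> < r" for b
    using q by (cases "\<sigma> b") (auto simp: quadrant_def sg_def dest!: spec[of _ b])
  thus "q \<in> open_square p r" by (simp add: open_square_def)
qed

lemma convex_quadrant: "convex (quadrant p r \<sigma>)"
proof -
  have c: "convex {x. 0 < sg s * (x - c) \<and> sg s * (x - c) < r}" for s c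
  proof -
    have "{x. 0 < sg s * (x - c) \<and> sg s * (x - c) < r} = (if s then {c<..<c+r} else {c-r<..<c})"
      by (auto simp: sg_def)
    thus ?thesis by simp
  qed
  have "quadrant p r \<sigma> = {x. 0 < sg (\<sigma> True) * (x - fst p) \<and> sg (\<sigma> True) * (x - fst p) < r} \<times>
      {x. 0 < sg (\<sigma> False) * (x - snd p) \<and> sg (\<sigma> False) * (x - snd p) < r}"
    unfolding quadrant_def all_bool_split[where c=True] by (auto simp: coord_def)
  thus ?thesis using c by (simp add: convex_Times)
qed

definition diagonal_point :: "point \<Rightarrow> real \<Rightarrow> (bool \<Rightarrow> bool) \<Rightarrow> point" where
  "diagonal_point p t \<sigma> = (fst p + sg (\<sigma> True) * t, snd p + sg (\<sigma> False) * t)"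

lemma coord_diagonal_point [simp]: "coord b (diagonal_point p t \<sigma>) = coord b p + sg (\<sigma> b) * t"
  by (cases b) (auto simp: coord_def diagonal_point_def)

lemma sg_sg [simp]: "sg b * (sg b * t) = t" by (simp add: sg_def)

lemma diagonal_point_mem_quadrant: "0 < t \<Longrightarrow> t < r \<Longrightarrow> diagonal_point p t \<sigma> \<in> quadrant p r \<sigma>"
  by (simp add: quadrant_def)

lemma linear_le_on_closure:
  fixes a b r :: real
  assumes "0 < r" and *: "\<And>t. 0 < t \<Longrightarrow> t < r \<Longrightarrow> a + b * t \<le> 0"
  shows "a \<le> 0" "a + b * r \<le> 0"
proof -
  have "a + b * t \<le> 0" if "t \<in> closure {0<..<r}" for t
    by (rule continuous_le_on_closure[OF _ that]) (auto intro!: continuous_intros *)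
  from this[of 0] this[of r] show "a \<le> 0" "a + b * r \<le> 0" using assms by auto
qed

lemma quadrant_subset_rectangle:
  assumes f: "rectangle f" and r: "0 < r" and sub: "quadrant p r \<sigma> \<subseteq> f"
  shows "if \<sigma> b then rlo f b \<le> coord b p \<and> coord b p + r \<le> rhi f b
         else rlo f b \<le> coord b p - r \<and> coord b p \<le> rhi f b"
proof -
  have *: "rlo f b \<le> coord b p + sg (\<sigma> b) * t \<and> coord b p + sg (\<sigma> b) * t \<le> rhi f b" if "0 < t" "t < r" for t
    using diagonal_point_mem_quadrant[OF that, of p \<sigma>] sub f by (auto simp: mem_rectangle dest!: subsetD)
  have "rlo f b - coord b p + (- sg (\<sigma> b)) * t \<le> 0" "coord b p - rhi f b + sg (\<sigma> b) * t \<le> 0"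
    if "0 < t" "t < r" for t using *[OF that] by auto
  from linear_le_on_closure[OF r this(1)] linear_le_on_closure[OF r this(2)]
  show ?thesis by (auto simp: sg_def)
qed

text \<open>
  The cell \<^term>\<open>f\<close> borders the whole of the edge \<^term>\<open>e\<close> from the side of the larger
  (\<^term>\<open>s = True\<close>) or smaller coordinate: above or below a horizontal edge, right or left of
  a vertical one.
\<close>
definition side :: "tmesh \<Rightarrow> bool \<Rightarrow> point set \<Rightarrow> point set \<Rightarrow> bool" where
  "side T s e f \<longleftrightarrow> f \<in> cells T \<and> rlo f (dir e) \<le> lo e \<and> hi e \<le> rhi f (dir e) \<and>
     (if s then rlo f (\<not> dir e) = lev e else rhi f (\<not> dir e) = lev e)"

lemma sideD:
  "side T s e f \<Longrightarrow> f \<in> cells T" "side T s e f \<Longrightarrow> rlo f (dir e) \<le> lo e"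
  "side T s e f \<Longrightarrow> hi e \<le> rhi f (dir e)"
  "side T True e f \<Longrightarrow> rlo f (\<not> dir e) = lev e" "side T False e f \<Longrightarrow> rhi f (\<not> dir e) = lev e"
  by (unfold side_def if_True if_False, (elim conjE, assumption)+)

locale T_mesh_geometry =
  fixes T :: tmesh
  assumes mesh: "mesh T"
begin

abbreviation \<Omega> :: "point set" where "\<Omega> \<equiv> dom_of T"

lemma finite_cells: "finite (cells T)" and rectangle_cell: "f \<in> cells T \<Longrightarrow> rectangle f"
  and finite_edges: "finite (edges T)" and straight_edge: "e \<in> edges T \<Longrightarrow> straight e"
  using mesh by (auto simp: mesh_def straight_iff)

lemma meshD:
  "\<forall>l\<in>edges T. l \<subseteq> (\<Union>f\<in>cells T. frontier f)"
  "\<forall>f\<in>cells T. \<exists>E\<subseteq>edges T. frontier f = \<Union> E"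
  "\<forall>f\<in>cells T. \<forall>f'\<in>cells T. f \<noteq> f' \<longrightarrow> f \<inter> f' = frontier f \<inter> frontier f' \<and>
     (\<exists>V\<subseteq>vertices T. \<exists>E\<subseteq>edges T. f \<inter> f' = V \<union> \<Union> E)"
  "\<forall>l\<in>edges T. \<forall>l'\<in>edges T. l \<noteq> l' \<longrightarrow>
     l \<inter> l' = endpoints l \<inter> endpoints l' \<and> l \<inter> l' \<subseteq> vertices T"
  "\<forall>v\<in>vertices T. \<exists>h\<in>edges T. \<exists>w\<in>edges T. horizontal h \<and> vertical w \<and> h \<inter> w = {v}"
  "simply_connected (dom_of T)" "connected (interior (dom_of T))"
proof -
  note m = mesh[unfolded mesh_def, THEN conjunct2, THEN conjunct2, THEN conjunct2, THEN conjunct2]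
  note m2 = m[THEN conjunct2] note m3 = m2[THEN conjunct2] note m4 = m3[THEN conjunct2]
  note m5 = m4[THEN conjunct2] note m6 = m5[THEN conjunct2]
  show "\<forall>l\<in>edges T. l \<subseteq> (\<Union>f\<in>cells T. frontier f)" by (rule m[THEN conjunct1])
  show "\<forall>f\<in>cells T. \<exists>E\<subseteq>edges T. frontier f = \<Union> E" by (rule m2[THEN conjunct1])
  show "\<forall>f\<in>cells T. \<forall>f'\<in>cells T. f \<noteq> f' \<longrightarrow> f \<inter> f' = frontier f \<inter> frontier f' \<and>
     (\<exists>V\<subseteq>vertices T. \<exists>E\<subseteq>edges T. f \<inter> f' = V \<union> \<Union> E)" by (rule m3[THEN conjunct1])
  show "\<forall>l\<in>edges T. \<forall>l'\<in>edges T. l \<noteq> l' \<longrightarrow>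
     l \<inter> l' = endpoints l \<inter> endpoints l' \<and> l \<inter> l' \<subseteq> vertices T" by (rule m4[THEN conjunct1])
  show "\<forall>v\<in>vertices T. \<exists>h\<in>edges T. \<exists>w\<in>edges T. horizontal h \<and> vertical w \<and> h \<inter> w = {v}"
    by (rule m5[THEN conjunct1])
  show "simply_connected (dom_of T)" by (rule m6[THEN conjunct1])
  show "connected (interior (dom_of T))" by (rule m6[THEN conjunct2])
qed

lemma edge_subset_frontiers: "e \<in> edges T \<Longrightarrow> p \<in> e \<Longrightarrow> \<exists>f\<in>cells T. p \<in> frontier f"
  using meshD(1) by blast

lemma frontier_cell_covered:
  "f \<in> cells T \<Longrightarrow> p \<in> frontier f \<Longrightarrow> \<exists>e\<in>edges T. p \<in> e \<and> e \<subseteq> frontier f"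
proof -
  assume f: "f \<in> cells T" and p: "p \<in> frontier f"
  from f obtain E where E: "E \<subseteq> edges T" "frontier f = \<Union> E" using meshD(2) by metis
  from p obtain e where "e \<in> E" "p \<in> e" unfolding E(2) by (rule UnionE)
  thus ?thesis using E by (intro bexI[of _ e]) auto
qed

lemma cells_inter: "f \<in> cells T \<Longrightarrow> g \<in> cells T \<Longrightarrow> f \<noteq> g \<Longrightarrow> f \<inter> g = frontier f \<inter> frontier g"
  by (rule meshD(3)[rule_format, THEN conjunct1])

lemma interior_cell_unique:
  assumes "f \<in> cells T" "g \<in> cells T" "p \<in> interior f" "p \<in> g"
  shows "f = g"
proof (rule ccontr)
  assume "f \<noteq> g"
  hence "p \<in> frontier f" using cells_inter[OF assms(1,2)] assms interior_subset by blast
  thus False using assms by (auto simp: frontier_def)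
qed

lemma edges_inter:
  "e \<in> edges T \<Longrightarrow> e' \<in> edges T \<Longrightarrow> e \<noteq> e' \<Longrightarrow> p \<in> e \<Longrightarrow> p \<in> e' \<Longrightarrow> p \<in> endpoints e \<and> p \<in> endpoints e'"
proof -
  assume a: "e \<in> edges T" "e' \<in> edges T" "e \<noteq> e'" "p \<in> e" "p \<in> e'"
  hence "e \<inter> e' = endpoints e \<inter> endpoints e'" by (intro meshD(4)[rule_format, THEN conjunct1])
  thus ?thesis using a by blast
qed

lemma vertex_has_edge:
  assumes "v \<in> vertices T"
  shows "\<exists>e\<in>edges T. dir e = b \<and> v \<in> endpoints e"
proof -
  obtain h w where hw: "h \<in> edges T" "w \<in> edges T" "horizontal h" "vertical w" "h \<inter> w = {v}"
    using meshD(5) assms by metis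
  have d: "dir h" "\<not> dir w" using hw straight_edge vertical_iff_dir by (auto simp: dir_def)
  hence "h \<noteq> w" by auto
  hence "v \<in> endpoints h \<and> v \<in> endpoints w" using edges_inter[OF hw(1,2)] hw(5) by blast
  thus ?thesis using d hw by (cases b) auto
qed

lemma vertex_on_edge_endpoint:
  assumes "v \<in> vertices T" "e \<in> edges T" "v \<in> e"
  shows "v \<in> endpoints e"
proof -
  obtain e' where e': "e' \<in> edges T" "dir e' = (\<not> dir e)" "v \<in> endpoints e'"
    using vertex_has_edge[OF assms(1)] by blast
  hence "v \<in> e'" using endpoints_straight[OF straight_edge[OF e'(1)]] ends_mem straight_edge by auto
  moreover have "e \<noteq> e'" using e' by auto
  ultimately show ?thesis using edges_inter assms e' by blast
qed

lemma endpoint_vertex: "e \<in> edges T \<Longrightarrow> v \<in> endpoints e \<Longrightarrow> v \<in> vertices T"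
  by (auto simp: vertices_def)

lemma finite_vertices: "finite (vertices T)"
  unfolding vertices_def
proof (rule finite_UN_I[OF finite_edges])
  fix e assume "e \<in> edges T"
  thus "finite (endpoints e)" using endpoints_straight[OF straight_edge] by simp
qed

lemma vertex_not_open_edge: "v \<in> vertices T \<Longrightarrow> e \<in> edges T \<Longrightarrow> v \<notin> open_edge e"
  using vertex_on_edge_endpoint open_edge_eq straight_edge by blast

lemma open_edge_unique: "e \<in> edges T \<Longrightarrow> e' \<in> edges T \<Longrightarrow> p \<in> open_edge e \<Longrightarrow> p \<in> e' \<Longrightarrow> e = e'"
  using edges_inter open_edge_eq straight_edge by blast

lemma edge_mem_cases: "e \<in> edges T \<Longrightarrow> p \<in> e \<Longrightarrow> p \<in> vertices T \<or> p \<in> open_edge e"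
  using open_edge_eq straight_edge endpoint_vertex by blast

lemma edge_subset_dom: "e \<in> edges T \<Longrightarrow> e \<subseteq> \<Omega>"
proof
  fix p assume "e \<in> edges T" "p \<in> e"
  then obtain f where "f \<in> cells T" "p \<in> frontier f" using edge_subset_frontiers by blast
  thus "p \<in> \<Omega>" using frontier_rectangle rectangle_cell by (auto simp: dom_of_def)
qed

lemma vertex_mem_dom: "v \<in> vertices T \<Longrightarrow> v \<in> \<Omega>"
proof -
  assume "v \<in> vertices T"
  then obtain e where e: "e \<in> edges T" "v \<in> endpoints e" using vertex_has_edge[of v True] by blast
  hence "v \<in> e" using endpoints_straight[OF straight_edge] ends_mem[OF straight_edge] by auto
  thus ?thesis using edge_subset_dom e by blast
qed

lemma interior_cell_not_edge: "f \<in> cells T \<Longrightarrow> p \<in> interior f \<Longrightarrow> e \<in> edges T \<Longrightarrow> p \<notin> e"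
proof
  assume a: "f \<in> cells T" "p \<in> interior f" "e \<in> edges T" "p \<in> e"
  then obtain g where g: "g \<in> cells T" "p \<in> frontier g" using edge_subset_frontiers by blast
  hence "p \<in> g" using frontier_rectangle rectangle_cell by auto
  hence "f = g" using interior_cell_unique a g by blast
  thus False using g a by (auto simp: frontier_def)
qed

text \<open>
  The boundary of the cell near \<^term>\<open>m\<close> is made of edges, and \<^term>\<open>e\<close> is the only edge
  through \<^term>\<open>m\<close>.
\<close>
lemma open_edge_in_cell:
  assumes e: "e \<in> edges T" and m: "m \<in> open_edge e" and f: "f \<in> cells T" "m \<in> f"
  shows "side T True e f \<or> side T False e f"
proof -
  have se: "straight e" using e straight_edge by auto
  have rf: "rectangle f" using f rectangle_cell by auto
  have me: "m \<in> e" using m open_edge_eq[OF se] by auto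
  have "m \<notin> interior f" using interior_cell_not_edge f(1) e me by blast
  hence "m \<in> frontier f" using frontier_rectangle rf f by auto
  then obtain e' where e': "e' \<in> edges T" "m \<in> e'" "e' \<subseteq> frontier f" using frontier_cell_covered f by blast
  hence sub: "e \<subseteq> frontier f" using open_edge_unique e m by metis
  hence subf: "e \<subseteq> f" using frontier_rectangle rf by auto
  have "lower_end e \<in> f" "upper_end e \<in> f" using subf ends_mem se by auto
  hence b: "rlo f (dir e) \<le> lo e" "hi e \<le> rhi f (dir e)" "rlo f (\<not> dir e) \<le> lev e" "lev e \<le> rhi f (\<not> dir e)"
    using rf mem_rectangle coord_ends by metis+
  have "rlo f (\<not> dir e) = lev e \<or> rhi f (\<not> dir e) = lev e"
  proof (rule ccontr)
    assume "\<not> ?thesis"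
    hence "m \<in> interior f" using b m
      by (auto simp: rectangle_data(3)[OF rf] open_edge_def all_bool_split[where c="dir e"])
    thus False using \<open>m \<notin> interior f\<close> by simp
  qed
  thus ?thesis using b f by (auto simp: side_def)
qed


lemma side_unique:
  assumes e: "e \<in> edges T" and f: "side T s e f" and g: "side T s e g"
  shows "f = g"
proof -
  have r: "rectangle f" "rectangle g" and c: "f \<in> cells T" "g \<in> cells T" using sideD(1)[OF f] sideD(1)[OF g] rectangle_cell by blast+
  let ?c = "\<not> dir e"
  obtain w where w: "0 < w" "w < rhi f ?c - rlo f ?c" "w < rhi g ?c - rlo g ?c"
    using rectangle_data(1)[OF r(1), of ?c] rectangle_data(1)[OF r(2), of ?c]
      field_lbound_gt_zero[of "rhi f ?c - rlo f ?c" "rhi g ?c - rlo g ?c"] by auto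
  define q where "q = point_at (dir e) ((lo e + hi e)/2) (lev e + (if s then w else - w))"
  have l: "lo e < hi e" using straight_lt straight_edge e by auto
  have "q \<in> interior f" "q \<in> interior g"
    unfolding rectangle_data(3)[OF r(1)] rectangle_data(3)[OF r(2)] q_def all_bool_split[where c="dir e"]
    using sideD(2,3)[OF f] sideD(2,3)[OF g] w l f g by (cases s; simp add: sideD(4,5))+
  thus ?thesis using interior_cell_unique c interior_subset by blast
qed

lemma side_subset:
  assumes e: "e \<in> edges T" and f: "side T s e f" and q: "q \<in> e"
  shows "q \<in> f"
  using assms straight_edge[OF e] rectangle_cell[of f] rectangle_data(1)[of f "\<not> dir e"]
  by (auto simp: side_def mem_rectangle mem_straight all_bool_split[where c="dir e"] split: if_splits)

lemma open_edge_subset_interior: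
  assumes e: "e \<in> edges T" and f: "side T True e f" and g: "side T False e g"
  shows "open_edge e \<subseteq> interior \<Omega>"
proof -
  let ?c = "\<not> dir e"
  have r: "rectangle f" "rectangle g" and c: "f \<in> cells T" "g \<in> cells T" using sideD(1)[OF f] sideD(1)[OF g] rectangle_cell by blast+
  define U where "U = {p. lo e < coord (dir e) p \<and> coord (dir e) p < hi e \<and> rlo g ?c < coord ?c p \<and> coord ?c p < rhi f ?c}"
  have "U = {p. lo e < coord (dir e) p} \<inter> {p. coord (dir e) p < hi e} \<inter> {p. rlo g ?c < coord ?c p} \<inter> {p. coord ?c p < rhi f ?c}"
    by (auto simp: U_def)
  moreover have "open \<dots>" by (intro open_Int open_Collect_less continuous_intros)
  ultimately have "open U" by simp
  moreover have "U \<subseteq> f \<union> g" using f g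
    by (auto simp: U_def mem_rectangle[OF r(1)] mem_rectangle[OF r(2)] side_def all_bool_split[where c="dir e"])
  moreover have "f \<union> g \<subseteq> \<Omega>" using c by (auto simp: dom_of_def)
  moreover have "open_edge e \<subseteq> U" using f g rectangle_data(1)[OF r(1), of ?c] rectangle_data(1)[OF r(2), of ?c]
    by (auto simp: U_def open_edge_def side_def)
  ultimately show ?thesis using interior_maximal by (metis subset_trans)
qed

text \<open>
  At this scale the mesh around \<^term>\<open>p\<close> looks like a cross of lines through \<^term>\<open>p\<close>, so each
  open quadrant lies in a single cell or outside the domain.
\<close>
definition isolating :: "point \<Rightarrow> real \<Rightarrow> bool" where
  "isolating p r \<longleftrightarrow> 0 < r \<and> (\<forall>f\<in>cells T. f \<inter> open_square p r \<noteq> {} \<longrightarrow> p \<in> f) \<and>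
     (\<forall>e\<in>edges T. e \<inter> open_square p r \<noteq> {} \<longrightarrow> p \<in> e) \<and> vertices T \<inter> open_square p r \<subseteq> {p} \<and>
     (p \<in> interior \<Omega> \<longrightarrow> open_square p r \<subseteq> interior \<Omega>)"

lemma isolating_exists: "\<exists>r. isolating p r"
proof -
  define S where "S = - \<Union>{f\<in>cells T. p \<notin> f} - \<Union>{e\<in>edges T. p \<notin> e} - (vertices T - {p}) - (if p \<in> interior \<Omega> then - interior \<Omega> else {})"
  have "closed (\<Union>{f\<in>cells T. p \<notin> f})" using finite_cells rectangle_cell rectangle_data(4) by (intro closed_Union) auto
  moreover have "closed (\<Union>{e\<in>edges T. p \<notin> e})" using finite_edges straight_edge closed_straight by (intro closed_Union) auto
  moreover have "closed (vertices T - {p})" using finite_vertices by (intro finite_imp_closed) auto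
  ultimately have "open S" unfolding S_def by (intro open_Diff) auto
  moreover have "p \<in> S" by (auto simp: S_def)
  ultimately obtain r where "r > 0" "open_square p r \<subseteq> S" using open_square_subset_open by blast
  hence "isolating p r" unfolding isolating_def S_def by (auto split: if_splits)
  thus ?thesis ..
qed

lemma isolating_pos: "isolating p r \<Longrightarrow> 0 < r" by (simp add: isolating_def)

lemma quadrant_no_edge:
  assumes g: "isolating p r" and e: "e \<in> edges T"
  shows "quadrant p r \<sigma> \<inter> e = {}"
proof (rule ccontr)
  assume "\<not> ?thesis"
  then obtain q where q: "q \<in> quadrant p r \<sigma>" "q \<in> e" by blast
  hence "p \<in> e" using g e quadrant_subset_open_square[of p r \<sigma>] unfolding isolating_def by blast
  hence "coord (\<not> dir e) p = coord (\<not> dir e) q" using q mem_straight[OF straight_edge[OF e]] by auto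
  thus False using q(1) by (auto simp: quadrant_def dest!: spec[of _ "\<not> dir e"])
qed

lemma quadrant_cell_cases:
  assumes g: "isolating p r" and f: "f \<in> cells T" and ne: "quadrant p r \<sigma> \<inter> f \<noteq> {}"
  shows "quadrant p r \<sigma> \<subseteq> interior f"
proof -
  have fr: "quadrant p r \<sigma> \<inter> frontier f = {}" using frontier_cell_covered[OF f] quadrant_no_edge[OF g] by blast
  have "connected (quadrant p r \<sigma>)" by (intro convex_connected convex_quadrant)
  hence "quadrant p r \<sigma> - f = {}" using connected_Int_frontier[OF _ ne] fr by blast
  thus ?thesis using fr frontier_rectangle rectangle_cell[OF f] by blast
qed

lemma quadrant_nonempty: "0 < r \<Longrightarrow> quadrant p r \<sigma> \<noteq> {}"
  using diagonal_point_mem_quadrant[of "r/2" r p \<sigma>] by auto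

lemma quadrant_cell_unique:
  assumes "0 < r" "f \<in> cells T" "g \<in> cells T" "quadrant p r \<sigma> \<subseteq> interior f" "quadrant p r \<sigma> \<subseteq> g"
  shows "f = g"
  using quadrant_nonempty[OF assms(1), of p \<sigma>] assms interior_cell_unique by blast

lemma cell_contains_quadrant:
  assumes g: "isolating p r" and f: "f \<in> cells T" "p \<in> f"
  shows "\<exists>\<sigma>. quadrant p r \<sigma> \<subseteq> interior f"
proof -
  have rf: "rectangle f" using f rectangle_cell by auto
  define \<sigma> where "\<sigma> b = (coord b p < rhi f b)" for b
  define w where "w b = (if \<sigma> b then rhi f b - coord b p else coord b p - rlo f b)" for b
  have w: "0 < w b" for b using f(2) rectangle_data(1)[OF rf, of b] by (auto simp: w_def \<sigma>_def mem_rectangle[OF rf])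
  define t where "t = min (r/2) (min (w True) (w False))"
  have t: "0 < t" "t < r" "t \<le> w b" for b using w isolating_pos[OF g] by (cases b; auto simp: t_def min_def)+
  have "diagonal_point p t \<sigma> \<in> f"
    unfolding mem_rectangle[OF rf]
  proof
    fix b show "rlo f b \<le> coord b (diagonal_point p t \<sigma>) \<and> coord b (diagonal_point p t \<sigma>) \<le> rhi f b"
      using t(3)[of b] f(2) t(1) by (auto simp: mem_rectangle[OF rf] w_def sg_def dest!: spec[of _ b] split: if_splits)
  qed
  hence "quadrant p r \<sigma> \<inter> f \<noteq> {}" using diagonal_point_mem_quadrant t by blast
  thus ?thesis using quadrant_cell_cases g f by blast
qed

text \<open>
  Otherwise a point of the line between the two quadrants would lie inside the cell, which would
  then meet the neighbouring quadrant, too.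
\<close>

lemma quadrant_border:
  assumes g: "isolating p r" and f: "f \<in> cells T"
    and qf: "quadrant p r \<sigma> \<subseteq> f" and nq: "\<not> quadrant p r \<tau> \<subseteq> f"
    and \<tau>: "\<tau> b = \<sigma> b" "\<tau> (\<not> b) = (\<not> \<sigma> (\<not> b))"
  shows "\<exists>e\<in>edges T. dir e = b \<and> p \<in> e \<and> side T (\<sigma> (\<not> b)) e f \<and>
    point_at b (coord b p + sg (\<sigma> b) * (r/2)) (coord (\<not> b) p) \<in> open_edge e"
proof -
  let ?c = "\<not> b"
  have rf: "rectangle f" using f rectangle_cell by auto
  have rp: "0 < r" using g isolating_pos by auto
  define m where "m = point_at b (coord b p + sg (\<sigma> b) * (r/2)) (coord ?c p)"
  note cf = quadrant_subset_rectangle[OF rf rp qf]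
  have mf: "m \<in> f"
    using cf[of b] cf[of ?c] rp unfolding mem_rectangle[OF rf]
    by (auto simp: m_def sg_def all_bool_split[where c=b] split: if_splits)
  have "m \<notin> interior f"
  proof
    assume "m \<in> interior f"
    hence *: "rlo f ?c < coord ?c p" "coord ?c p < rhi f ?c"
      unfolding rectangle_data(3)[OF rf] m_def by (auto simp: all_bool_split[where c=b])
    define t where "t = min (r/2) (min (coord ?c p - rlo f ?c) (rhi f ?c - coord ?c p))"
    have t: "0 < t" "t < r" "t \<le> coord ?c p - rlo f ?c" "t \<le> rhi f ?c - coord ?c p"
      using * rp by (auto simp: t_def)
    have "rlo f b \<le> coord b (diagonal_point p t \<tau>) \<and> coord b (diagonal_point p t \<tau>) \<le> rhi f b"
      using cf[of b] t(1,2) by (auto simp: \<tau> sg_def split: if_splits)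
    moreover have "rlo f ?c \<le> coord ?c (diagonal_point p t \<tau>) \<and> coord ?c (diagonal_point p t \<tau>) \<le> rhi f ?c"
      using * t by (auto simp: sg_def)
    ultimately have "diagonal_point p t \<tau> \<in> f" unfolding mem_rectangle[OF rf] all_bool_split[where c=b] by blast
    hence "quadrant p r \<tau> \<inter> f \<noteq> {}" using diagonal_point_mem_quadrant t by blast
    thus False using quadrant_cell_cases[OF g f] nq interior_subset by blast
  qed
  hence "m \<in> frontier f" using mf frontier_rectangle[OF rf] by blast
  then obtain e where e: "e \<in> edges T" "m \<in> e" using frontier_cell_covered f by blast
  have mn: "m \<in> open_square p r" using rp by (auto simp: open_square_def m_def sg_def all_bool_split[where c=b])
  hence pe: "p \<in> e" using g e unfolding isolating_def by blast
  have neq: "coord b m \<noteq> coord b p" using rp by (auto simp: m_def sg_def)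
  hence mp: "m \<noteq> p" by auto
  have db: "dir e = b"
  proof (rule ccontr)
    assume "dir e \<noteq> b" hence "b = (\<not> dir e)" by auto
    thus False using neq mem_straight[OF straight_edge[OF e(1)]] pe e(2) by simp
  qed
  have "m \<notin> vertices T" using g mn mp unfolding isolating_def by blast
  hence mo: "m \<in> open_edge e" using edge_mem_cases e by blast
  have lev: "lev e = coord ?c p" using pe mem_straight[OF straight_edge[OF e(1)]] db by auto
  have "side T (\<sigma> ?c) e f"
    using open_edge_in_cell[OF e(1) mo f mf] cf[of ?c] rp db lev rectangle_data(1)[OF rf, of ?c]
    by (auto simp: side_def split: if_splits)
  thus ?thesis using e pe db mo m_def by blast
qed

text \<open>
  The second quadrant is not contained in the first cell, so an edge bounding that cell runs
  between the quadrants; the second cell meets this open edge, too, and hence borders it.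
\<close>

lemma quadrants_adjacent:
  assumes g: "isolating p r" and fg: "f \<in> cells T" "g \<in> cells T" "f \<noteq> g"
    and qf: "quadrant p r \<sigma> \<subseteq> f" and qg: "quadrant p r \<tau> \<subseteq> g"
    and \<tau>: "\<tau> b = \<sigma> b" "\<tau> (\<not> b) = (\<not> \<sigma> (\<not> b))"
  shows "\<exists>e\<in>edges T. dir e = b \<and> p \<in> e \<and> side T (\<sigma> (\<not> b)) e f \<and> side T (\<not> \<sigma> (\<not> b)) e g \<and>
    point_at b (coord b p + sg (\<sigma> b) * (r/2)) (coord (\<not> b) p) \<in> open_edge e"
proof -
  let ?c = "\<not> b"
  have rg: "rectangle g" using fg rectangle_cell by auto
  have rp: "0 < r" using g isolating_pos by auto
  have "\<not> quadrant p r \<tau> \<subseteq> f"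
  proof
    assume *: "quadrant p r \<tau> \<subseteq> f"
    have "quadrant p r \<tau> \<subseteq> interior g" using quadrant_cell_cases[OF g fg(2)] qg quadrant_nonempty[OF rp, of p \<tau>] by blast
    thus False using quadrant_cell_unique[OF rp fg(2,1) _ *] fg(3) by blast
  qed
  from quadrant_border[OF g fg(1) qf this \<tau>] obtain e where e: "e \<in> edges T" "dir e = b" "p \<in> e"
    "side T (\<sigma> ?c) e f" "point_at b (coord b p + sg (\<sigma> b) * (r/2)) (coord ?c p) \<in> open_edge e" by blast
  note cg = quadrant_subset_rectangle[OF rg rp qg]
  have "point_at b (coord b p + sg (\<sigma> b) * (r/2)) (coord ?c p) \<in> g"
    using cg[of b] cg[of ?c] \<tau> rp unfolding mem_rectangle[OF rg]
    by (auto simp: sg_def all_bool_split[where c=b] split: if_splits)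
  from open_edge_in_cell[OF e(1,5) fg(2) this]
  have "side T True e g \<or> side T False e g" .
  moreover have "lev e = coord ?c p" using e(3) mem_straight[OF straight_edge[OF e(1)]] e(2) by auto
  ultimately have "side T (\<not> \<sigma> ?c) e g"
    using cg[of ?c] \<tau> rp e(2) rectangle_data(1)[OF rg, of ?c] by (auto simp: side_def split: if_splits)
  thus ?thesis using e by blast
qed

lemma side_contains_quadrant:
  assumes g: "isolating p r" and e: "e \<in> edges T" "p \<in> e" and f: "side T (\<sigma> (\<not> dir e)) e f"
    and arm: "if \<sigma> (dir e) then coord (dir e) p < hi e else lo e < coord (dir e) p"
  shows "quadrant p r \<sigma> \<subseteq> interior f"
proof -
  let ?b = "dir e" and ?c = "\<not> dir e"
  have fc: "f \<in> cells T" using f by (simp add: side_def)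
  have rf: "rectangle f" using fc rectangle_cell by auto
  have pe: "lo e \<le> coord ?b p" "coord ?b p \<le> hi e" "coord ?c p = lev e" using e mem_straight straight_edge by auto
  define w where "w = min (rhi f ?c - rlo f ?c) (if \<sigma> ?b then hi e - coord ?b p else coord ?b p - lo e)"
  have w: "0 < w" "w \<le> rhi f ?c - rlo f ?c" "if \<sigma> ?b then w \<le> hi e - coord ?b p else w \<le> coord ?b p - lo e"
    using arm rectangle_data(1)[OF rf, of ?c] by (auto simp: w_def split: if_splits)
  define t where "t = min (r/2) w"
  have t: "0 < t" "t < r" "t \<le> w" using w isolating_pos[OF g] by (auto simp: t_def)
  have "diagonal_point p t \<sigma> \<in> f" using f t w pe
    by (auto simp: mem_rectangle[OF rf] all_bool_split[where c="?b"] side_def sg_def split: if_splits)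
  hence "quadrant p r \<sigma> \<inter> f \<noteq> {}" using diagonal_point_mem_quadrant t by blast
  thus ?thesis using quadrant_cell_cases g fc by blast
qed

lemma closed_dom: "closed \<Omega>"
  unfolding dom_of_def using finite_cells rectangle_cell rectangle_data(4) by (intro closed_Union) auto

lemma interior_if_all_quadrants:
  assumes g: "isolating p r" and q: "\<And>\<sigma>. \<exists>f\<in>cells T. quadrant p r \<sigma> \<subseteq> f"
  shows "p \<in> interior \<Omega>"
proof -
  have rp: "0 < r" using g isolating_pos by auto
  have "open_square p r \<subseteq> \<Omega>"
  proof
    fix q assume qn: "q \<in> open_square p r"
    define \<sigma> where "\<sigma> b = (coord b p \<le> coord b q)" for b
    obtain f where f: "f \<in> cells T" "quadrant p r \<sigma> \<subseteq> f" using q by blast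
    have rf: "rectangle f" using f rectangle_cell by auto
    have "rlo f b \<le> coord b q \<and> coord b q \<le> rhi f b" for b
      using quadrant_subset_rectangle[OF rf rp f(2), of b] qn by (auto simp: \<sigma>_def open_square_def abs_less_iff dest!: spec[of _ b] split: if_splits)
    hence "q \<in> f" by (simp add: mem_rectangle[OF rf])
    thus "q \<in> \<Omega>" using f by (auto simp: dom_of_def)
  qed
  thus ?thesis using open_open_square mem_open_square_self[OF rp] interiorI by blast
qed

lemma quadrant_cell_exists_interior:
  assumes g: "isolating p r" and p: "p \<in> interior \<Omega>"
  shows "\<exists>f\<in>cells T. quadrant p r \<sigma> \<subseteq> interior f"
proof -
  have rp: "0 < r" using g isolating_pos by auto
  obtain q where q: "q \<in> quadrant p r \<sigma>" using quadrant_nonempty[OF rp] by blast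
  hence "q \<in> \<Omega>" using g p quadrant_subset_open_square[of p r \<sigma>] interior_subset unfolding isolating_def by blast
  then obtain f where "f \<in> cells T" "q \<in> f" by (auto simp: dom_of_def)
  thus ?thesis using quadrant_cell_cases[OF g] q by blast
qed

text \<open>
  If one point of the open edge is an interior point of the domain, then a cell covers its
  neighbourhood on the side \<^term>\<open>s\<close>, and this cell borders the whole edge.
\<close>

lemma edge_in_frontier:
  assumes e: "e \<in> edges T" and no: "\<And>f. \<not> side T s e f"
  shows "e \<subseteq> frontier \<Omega>"
proof -
  have "m \<in> frontier \<Omega>" if m: "m \<in> open_edge e" for m
  proof (rule ccontr)
    assume "m \<notin> frontier \<Omega>"
    moreover have me: "m \<in> e" using m open_edge_eq straight_edge e by blast
    hence "m \<in> \<Omega>" using edge_subset_dom e by blast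
    ultimately have mi: "m \<in> interior \<Omega>" using closed_dom by (simp add: frontier_def)
    obtain r where g: "isolating m r" using isolating_exists by blast
    have rp: "0 < r" using g isolating_pos by auto
    obtain f where f: "f \<in> cells T" "quadrant m r (\<lambda>b. if b = dir e then True else s) \<subseteq> interior f"
      using quadrant_cell_exists_interior[OF g mi] by blast
    have rf: "rectangle f" using f rectangle_cell by auto
    have sub: "quadrant m r (\<lambda>b. if b = dir e then True else s) \<subseteq> f" using f interior_subset by blast
    have "f \<inter> open_square m r \<noteq> {}" using sub quadrant_subset_open_square quadrant_nonempty[OF rp] by blast
    hence "m \<in> f" using g f unfolding isolating_def by blast
    from open_edge_in_cell[OF e m f(1) this]
    have "side T s e f" using quadrant_subset_rectangle[OF rf rp sub, of "\<not> dir e"] m rp rectangle_data(1)[OF rf, of "\<not> dir e"]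
      by (auto simp: side_def open_edge_def split: if_splits)
    thus False using no by blast
  qed
  hence sub: "open_edge e \<subseteq> frontier \<Omega>" by blast
  have se: "straight e" using straight_edge e by auto
  have "closure (open_segment (lower_end e) (upper_end e)) = closed_segment (lower_end e) (upper_end e)"
    using lower_end_neq_upper_end[OF se] by (simp add: closure_open_segment)
  moreover have "closed_segment (lower_end e) (upper_end e) = e" using se
    unfolding lower_end_def upper_end_def by (metis closed_segment_eq_axis_segment straight_def)
  moreover have "open_segment (lower_end e) (upper_end e) = open_edge e"
    using calculation(2) by (simp add: open_segment_def open_edge_eq[OF se] endpoints_straight[OF se])
  ultimately have "closure (open_edge e) = e" by simp
  thus ?thesis using sub closure_minimal[OF sub] by simp
qed

lemma interior_edgeD:
  assumes "e \<in> interior_edges T"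
  shows "e \<in> edges T" "\<exists>f. side T s e f" "open_edge e \<subseteq> interior \<Omega>"
proof -
  show e: "e \<in> edges T" using assms by (simp add: interior_edges_def)
  show ex: "\<exists>f. side T s e f" for s using assms edge_in_frontier[OF e] by (auto simp: interior_edges_def)
  show "open_edge e \<subseteq> interior \<Omega>" using ex[of True] ex[of False] open_edge_subset_interior[OF e] by blast
qed

lemma interior_edge_if_meets_interior:
  "e \<in> edges T \<Longrightarrow> p \<in> e \<Longrightarrow> p \<in> interior \<Omega> \<Longrightarrow> e \<in> interior_edges T"
  by (auto simp: interior_edges_def frontier_def)

lemma interior_edgeI: "e \<in> edges T \<Longrightarrow> side T True e f \<Longrightarrow> side T False e g \<Longrightarrow> e \<in> interior_edges T"
proof -
  assume e: "e \<in> edges T" "side T True e f" "side T False e g"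
  have "point_at (dir e) ((lo e + hi e)/2) (lev e) \<in> open_edge e"
    using straight_lt[OF straight_edge[OF e(1)]] by (auto simp: open_edge_def)
  thus ?thesis using open_edge_subset_interior[OF e] e(1) open_edge_eq straight_edge interior_edge_if_meets_interior
    by blast
qed

lemma boundary_edgeI:
  "e \<in> edges T \<Longrightarrow> (\<And>f. \<not> side T s e f) \<Longrightarrow> e \<in> boundary_edges T"
  using edge_in_frontier by (auto simp: boundary_edges_def)

text \<open>
  Around a boundary vertex some quadrant is covered and some quadrant is not, so two
  neighbouring quadrants differ in this respect.
\<close>

lemma boundary_vertex_on_boundary_edge:
  assumes v: "v \<in> vertices T" "v \<notin> interior \<Omega>"
  shows "\<exists>e\<in>boundary_edges T. v \<in> e"
proof -
  obtain r where g: "isolating v r" using isolating_exists by blast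
  define C where "C \<sigma> \<longleftrightarrow> (\<exists>f\<in>cells T. quadrant v r \<sigma> \<subseteq> f)" for \<sigma>
  obtain \<tau> where \<tau>: "\<not> C \<tau>" using interior_if_all_quadrants[OF g] v unfolding C_def by blast
  obtain f where f: "f \<in> cells T" "v \<in> f" using vertex_mem_dom[OF v(1)] by (auto simp: dom_of_def)
  obtain \<sigma> where "quadrant v r \<sigma> \<subseteq> interior f" using cell_contains_quadrant[OF g f] by blast
  hence \<sigma>: "C \<sigma>" unfolding C_def using f(1) interior_subset[of f] by (meson subset_trans)
  \<comment> \<open>Pass from one sign pattern to the other by changing one sign at a time.\<close>
  obtain b \<sigma>' \<tau>' where st: "C \<sigma>'" "\<not> C \<tau>'" "\<tau>' b = \<sigma>' b" "\<tau>' (\<not> b) = (\<not> \<sigma>' (\<not> b))"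
  proof (cases "C (\<sigma>(True := \<tau> True))")
    case True
    have "\<tau> False \<noteq> \<sigma> False"
    proof
      assume "\<tau> False = \<sigma> False"
      hence "\<tau> = \<sigma>(True := \<tau> True)" by (auto simp: fun_eq_iff all_bool_eq)
      thus False using True \<tau> by metis
    qed
    thus ?thesis using that[OF True \<tau>, of True] by auto
  next
    case False
    have "\<tau> True \<noteq> \<sigma> True"
    proof
      assume "\<tau> True = \<sigma> True"
      hence "\<sigma> = \<sigma>(True := \<tau> True)" by (auto simp: fun_eq_iff)
      thus False using False \<sigma> by metis
    qed
    thus ?thesis using that[OF \<sigma> False, of False] by auto
  qed
  from st(1) obtain h where h: "h \<in> cells T" "quadrant v r \<sigma>' \<subseteq> h" unfolding C_def by blast
  have "\<not> quadrant v r \<tau>' \<subseteq> h" using st(2) h(1) unfolding C_def by blast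
  from quadrant_border[OF g h this st(3,4)] obtain e where e: "e \<in> edges T" "dir e = b" "v \<in> e"
    "side T (\<sigma>' (\<not> b)) e h" "point_at b (coord b v + sg (\<sigma>' b) * (r/2)) (coord (\<not> b) v) \<in> open_edge e" by blast
  have "\<not> side T (\<not> \<sigma>' (\<not> b)) e k" for k
  proof
    assume k: "side T (\<not> \<sigma>' (\<not> b)) e k"
    have "side T (\<tau>' (\<not> dir e)) e k" using k st(4) e(2) by auto
    moreover have "if \<tau>' (dir e) then coord (dir e) v < hi e else lo e < coord (dir e) v"
      using e(5) st(3) e(2) isolating_pos[OF g] by (auto simp: open_edge_def sg_def)
    ultimately have "quadrant v r \<tau>' \<subseteq> interior k" using side_contains_quadrant[OF g e(1,3)] by blast
    thus False using st(2) sideD(1)[OF k] interior_subset[of k] unfolding C_def by (meson subset_trans)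
  qed
  thus ?thesis using boundary_edgeI[OF e(1)] e(3) by blast
qed

end

section \<open>l-edges\<close>

lemma coord_diff: "coord b (p - q) = coord b p - coord b q"
  by (simp add: coord_def)

lemma collinear_line:
  assumes "\<And>p. p \<in> S \<Longrightarrow> coord (\<not> b) p = y"
  shows "collinear S"
  unfolding collinear_def
proof (intro exI ballI)
  fix p q assume "p \<in> S" "q \<in> S"
  thus "p - q = (coord b p - coord b q) *\<^sub>R point_at b 1 0"
    by (intro point_eqI[of b]) (simp_all add: coord_diff coord_scaleR assms)
qed

lemma connected_straight: "straight e \<Longrightarrow> connected e"
  unfolding straight_def by (metis closed_segment_eq_axis_segment connected_segment(1))

lemma collinear_straight: "straight e \<Longrightarrow> collinear e"
  by (rule collinear_line[of _ "dir e" "lev e"]) (simp add: mem_straight)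

lemma straight_subset_parallel:
  assumes e: "straight e" and l: "straight l" and sub: "e \<subseteq> l"
  shows "dir e = dir l" "lev e = lev l" "lo l \<le> lo e" "hi e \<le> hi l"
proof -
  have m: "lower_end e \<in> l" "upper_end e \<in> l" using sub ends_mem[OF e] by auto
  show d: "dir e = dir l"
  proof (rule ccontr)
    assume "dir e \<noteq> dir l"
    hence "dir e = (\<not> dir l)" by auto
    hence "lo e = lev l" "hi e = lev l" using m coord_ends[of e] by (auto simp: mem_straight[OF l])
    thus False using straight_lt[OF e] by simp
  qed
  show "lev e = lev l" "lo l \<le> lo e" "hi e \<le> hi l"
    using m d coord_ends[of e] by (auto simp: mem_straight[OF l])
qed

lemma perpendicular_meet_once:
  assumes "straight l" "straight l'" "dir l \<noteq> dir l'" "p \<in> l" "p \<in> l'" "q \<in> l" "q \<in> l'"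
  shows "p = q"
proof -
  have "dir l' = (\<not> dir l)" using assms by auto
  thus ?thesis using assms by (intro point_eqI[of "dir l"]) (simp_all add: mem_straight)
qed

context T_mesh_geometry
begin

text \<open>
  All edges of a segment lie on the line of one of them by collinearity, and their union is an interval
  of this line by connectedness.
\<close>
lemma segment_straight:
  assumes E: "E \<subseteq> edges T" and s: "segment_of E s"
  shows "straight s"
proof -
  obtain E' where E': "E' \<subseteq> E" "E' \<noteq> {}" "s = \<Union> E'" "connected s" "collinear s"
    using s by (auto simp: segment_of_def)
  obtain e where e: "e \<in> E'" using E' by auto
  have se: "straight e" using e E' E straight_edge by auto
  define b where "b = dir e"
  have ends: "lower_end e \<in> s" "upper_end e \<in> s" using ends_mem[OF se] e E' by auto
  obtain u where u: "\<And>x y. x \<in> s \<Longrightarrow> y \<in> s \<Longrightarrow> \<exists>c. x - y = c *\<^sub>R u" using E'(5) unfolding collinear_def by blast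
  obtain c where c: "upper_end e - lower_end e = c *\<^sub>R u" using u ends by blast
  have "c * coord b u = hi e - lo e" "c * coord (\<not> b) u = 0"
    using arg_cong[OF c, of "coord b"] arg_cong[OF c, of "coord (\<not> b)"] by (simp_all add: coord_diff coord_scaleR b_def)
  hence u0: "coord (\<not> b) u = 0" using straight_lt[OF se] by auto
  have line: "coord (\<not> b) p = lev e" if ps: "p \<in> s" for p
  proof -
    obtain c where c: "p - lower_end e = c *\<^sub>R u" using u[OF ps ends(1)] by blast
    show ?thesis using arg_cong[OF c, of "coord (\<not> b)"] by (simp add: coord_diff coord_scaleR u0) (simp add: b_def)
  qed
  have "finite E'" by (rule finite_subset[OF subset_trans[OF E'(1) E] finite_edges])
  moreover have "compact e'" if "e' \<in> E'" for e'
  proof -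
    have "straight e'" using that E' E straight_edge by auto
    thus ?thesis unfolding straight_def by (metis closed_segment_eq_axis_segment compact_segment)
  qed
  ultimately have cs: "compact s" unfolding E'(3) by (intro compact_Union) auto
  have "compact (coord b ` s)" "connected (coord b ` s)"
    by (intro compact_continuous_image connected_continuous_image continuous_intros cs E'(4))+
  hence "\<exists>x1 x2. coord b ` s = cbox x1 x2" using connected_compact_interval_1[of "coord b ` s"] by simp
  then obtain x1 x2 where x: "coord b ` s = {x1..x2}" by auto
  have "lo e \<in> coord b ` s" "hi e \<in> coord b ` s" using imageI[OF ends(1), of "coord b"] imageI[OF ends(2), of "coord b"] coord_ends[of e] unfolding b_def by simp_all
  hence lt: "x1 < x2" using straight_lt[OF se] unfolding x by auto
  have "s = axis_segment b x1 x2 (lev e)"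
  proof
    show "s \<subseteq> axis_segment b x1 x2 (lev e)"
    proof
      fix p assume p: "p \<in> s"
      hence "coord b p \<in> {x1..x2}" unfolding x[symmetric] by simp
      thus "p \<in> axis_segment b x1 x2 (lev e)" using line[OF p] by (simp add: axis_segment_def)
    qed
    show "axis_segment b x1 x2 (lev e) \<subseteq> s"
    proof
      fix p assume p: "p \<in> axis_segment b x1 x2 (lev e)"
      hence "coord b p \<in> coord b ` s" unfolding x by (simp add: axis_segment_def)
      then obtain q where q: "q \<in> s" "coord b p = coord b q" by auto
      hence "p = q" using line[OF q(1)] p by (intro point_eqI[of b]) (auto simp: axis_segment_def)
      thus "p \<in> s" using q by simp
    qed
  qed
  thus ?thesis using lt by simp
qed

lemma segment_of_edge: "E \<subseteq> edges T \<Longrightarrow> e \<in> E \<Longrightarrow> segment_of E e"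
  unfolding segment_of_def using connected_straight collinear_straight straight_edge
  by (intro exI[of _ "{e}"]) auto

lemma max_segmentsD: "l \<in> max_segments E \<Longrightarrow> segment_of E l"
  by (simp add: max_segments_def)

lemma straight_max_segment: "E \<subseteq> edges T \<Longrightarrow> l \<in> max_segments E \<Longrightarrow> straight l"
  using segment_straight max_segmentsD by blast

lemma edge_in_max_segment:
  assumes E: "E \<subseteq> edges T" and e: "e \<in> E"
  shows "\<exists>l\<in>max_segments E. e \<subseteq> l"
proof -
  have "{s. segment_of E s} \<subseteq> Union ` Pow E" by (auto simp: segment_of_def)
  moreover have "finite (Union ` Pow E)" using E finite_edges finite_subset by auto
  ultimately have "finite {s. segment_of E s}" using finite_subset by blast
  moreover have "e \<in> {s. segment_of E s}" using segment_of_edge[OF E e] by simp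
  ultimately obtain m where m: "m \<in> {s. segment_of E s}" "e \<subseteq> m" "\<forall>b\<in>{s. segment_of E s}. m \<subseteq> b \<longrightarrow> m = b"
    using finite_has_maximal2 by metis
  hence "m \<in> max_segments E" by (auto simp: max_segments_def)
  thus ?thesis using m by blast
qed

lemma finite_max_segments: "E \<subseteq> edges T \<Longrightarrow> finite (max_segments E)"
proof -
  assume "E \<subseteq> edges T"
  hence "finite (Union ` Pow E)" using finite_edges finite_subset by auto
  moreover have "max_segments E \<subseteq> Union ` Pow E" by (auto simp: max_segments_def segment_of_def)
  ultimately show ?thesis using finite_subset by blast
qed

lemma max_segment_unique:
  assumes E: "E \<subseteq> edges T" and l: "l \<in> max_segments E" "l' \<in> max_segments E"
    and d: "dir l = dir l'" and p: "p \<in> l" "p \<in> l'"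
  shows "l = l'"
proof -
  have s: "straight l" "straight l'" using l E straight_max_segment by auto
  have lev: "lev l = lev l'" using p d s by (simp add: mem_straight)
  obtain A where A: "A \<subseteq> E" "A \<noteq> {}" "l = \<Union> A" "connected l"
    using max_segmentsD[OF l(1)] by (auto simp: segment_of_def)
  obtain B where B: "B \<subseteq> E" "B \<noteq> {}" "l' = \<Union> B" "connected l'"
    using max_segmentsD[OF l(2)] by (auto simp: segment_of_def)
  have "segment_of E (l \<union> l')" unfolding segment_of_def
  proof (intro exI conjI)
    show "A \<union> B \<subseteq> E" "A \<union> B \<noteq> {}" "l \<union> l' = \<Union> (A \<union> B)" using A B by auto
    show "connected (l \<union> l')" using A(4) B(4) p by (intro connected_Un) auto
    show "collinear (l \<union> l')"
      by (rule collinear_line[of _ "dir l" "lev l"]) (use s d lev in \<open>auto simp: mem_straight\<close>)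
  qed
  thus ?thesis using l by (auto simp: max_segments_def)
qed

lemma edge_subset_max_segment:
  assumes E: "E \<subseteq> edges T" and l: "l \<in> max_segments E" and e: "e \<in> E" "dir e = dir l" "p \<in> e" "p \<in> l"
  shows "e \<subseteq> l"
proof -
  obtain l' where l': "l' \<in> max_segments E" "e \<subseteq> l'" using edge_in_max_segment[OF E e(1)] by blast
  have "dir l' = dir e"
    using straight_subset_parallel(1)[OF straight_edge straight_max_segment[OF E l'(1)] l'(2)] e(1) E by auto
  hence "l = l'" using max_segment_unique[OF E l l'(1), of p] e l' by auto
  thus ?thesis using l' by simp
qed

lemma max_segment_covered:
  assumes E: "E \<subseteq> edges T" and l: "l \<in> max_segments E" and p: "p \<in> l"
  shows "\<exists>e\<in>E. e \<subseteq> l \<and> p \<in> e"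
  using max_segmentsD[OF l] p by (auto simp: segment_of_def)

text \<open>
  Only edges through \<^term>\<open>p\<close> come close to \<^term>\<open>p\<close>, so the one that covers the next points of
  the l-edge starts at \<^term>\<open>p\<close> or passes through it.
\<close>

lemma max_segment_arm:
  assumes E: "E \<subseteq> edges T" and l: "l \<in> max_segments E" and p: "p \<in> l"
    and s: "if s then coord (dir l) p < hi l else lo l < coord (dir l) p"
  shows "\<exists>e\<in>E. e \<subseteq> l \<and> p \<in> e \<and> (if s then coord (dir l) p < hi e else lo e < coord (dir l) p)"
proof -
  let ?b = "dir l"
  have sl: "straight l" using straight_max_segment[OF E l] .
  obtain r where g: "isolating p r" using isolating_exists by blast
  have rp: "0 < r" using g isolating_pos by auto
  define t where "t = min (r/2) (if s then hi l - coord ?b p else coord ?b p - lo l)"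
  have t: "0 < t" "t < r" "if s then t \<le> hi l - coord ?b p else t \<le> coord ?b p - lo l"
    using rp s by (auto simp: t_def)
  define q where "q = point_at ?b (coord ?b p + sg s * t) (lev l)"
  have q: "q \<in> l" using p t by (auto simp: mem_straight[OF sl] q_def sg_def split: if_splits)
  obtain e where e: "e \<in> E" "e \<subseteq> l" "q \<in> e" using max_segment_covered[OF E l q] by blast
  have "coord (\<not> ?b) p = lev l" using p by (simp add: mem_straight[OF sl])
  hence "q \<in> open_square p r" using t by (auto simp: open_square_def q_def sg_def all_bool_split[where c="?b"])
  hence pe: "p \<in> e" using g e E unfolding isolating_def by blast
  have se: "straight e" using e E straight_edge by auto
  have "dir e = ?b" using straight_subset_parallel(1)[OF se sl e(2)] .
  hence "lo e \<le> coord ?b p + sg s * t" "coord ?b p + sg s * t \<le> hi e"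
    using e(3) by (auto simp: mem_straight[OF se] q_def)
  hence "if s then coord ?b p < hi e else lo e < coord ?b p" using t(1) by (auto simp: sg_def)
  thus ?thesis using e pe by blast
qed

lemma max_segment_ends_vertices:
  assumes E: "E \<subseteq> edges T" and l: "l \<in> max_segments E"
  shows "lower_end l \<in> vertices T" "upper_end l \<in> vertices T"
proof -
  have sl: "straight l" using straight_max_segment[OF E l] .
  have "v \<in> vertices T" if v: "v \<in> {lower_end l, upper_end l}" for v
  proof -
    have vl: "v \<in> l" using v ends_mem[OF sl] by auto
    obtain e where e: "e \<in> E" "e \<subseteq> l" "v \<in> e" using max_segment_covered[OF E l vl] by blast
    have ee: "e \<in> edges T" using e E by auto
    have se: "straight e" using straight_edge[OF ee] .
    note par = straight_subset_parallel[OF se sl e(2)]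
    have "v \<notin> open_edge e" unfolding open_edge_def par(1) using v par(3,4) coord_ends[of l] by auto
    thus ?thesis using edge_mem_cases[OF ee e(3)] by blast
  qed
  thus "lower_end l \<in> vertices T" "upper_end l \<in> vertices T" by auto
qed

lemma interior_edges_subset: "interior_edges T \<subseteq> edges T"
  and boundary_edges_subset: "boundary_edges T \<subseteq> edges T"
  by (auto simp: interior_edges_def boundary_edges_def)

lemma straight_interior_l_edge: "l \<in> interior_l_edges T \<Longrightarrow> straight l"
  and straight_boundary_l_edge: "l \<in> boundary_l_edges T \<Longrightarrow> straight l"
  using straight_max_segment interior_edges_subset boundary_edges_subset
  by (auto simp: interior_l_edges_def boundary_l_edges_def)

lemma finite_l_edges: "finite (l_edges T)"
  using finite_max_segments interior_edges_subset boundary_edges_subset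
  by (auto simp: l_edges_def interior_l_edges_def boundary_l_edges_def)

lemma boundary_l_edge_frontier: "l \<in> boundary_l_edges T \<Longrightarrow> p \<in> l \<Longrightarrow> p \<in> frontier \<Omega>"
  using max_segment_covered[OF boundary_edges_subset]
  by (fastforce simp: boundary_l_edges_def boundary_edges_def)

text \<open>
  At a vertex inside the l-edge the edges before and after it have cells on both sides, and these
  cover the four quadrants.
\<close>
lemma interior_l_edge_point:
  assumes l: "l \<in> interior_l_edges T" and p: "p \<in> l" "lo l < coord (dir l) p" "coord (dir l) p < hi l"
  shows "p \<in> interior \<Omega>"
proof (cases "p \<in> vertices T")
  case False
  obtain e where e: "e \<in> interior_edges T" "p \<in> e"
    using max_segment_covered[OF interior_edges_subset _ p(1)] l by (auto simp: interior_l_edges_def)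
  hence "p \<in> open_edge e" using edge_mem_cases False interior_edges_subset by blast
  thus ?thesis using interior_edgeD(3)[OF e(1)] by blast
next
  case True
  have l': "l \<in> max_segments (interior_edges T)" using l by (simp add: interior_l_edges_def)
  have sl: "straight l" using straight_interior_l_edge[OF l] .
  obtain r where g: "isolating p r" using isolating_exists by blast
  show ?thesis
  proof (rule interior_if_all_quadrants[OF g])
    fix \<sigma>
    have "if \<sigma> (dir l) then coord (dir l) p < hi l else lo l < coord (dir l) p" using p by simp
    from max_segment_arm[OF interior_edges_subset l' p(1) this]
    obtain e where e: "e \<in> interior_edges T" "e \<subseteq> l" "p \<in> e"
      "if \<sigma> (dir l) then coord (dir l) p < hi e else lo e < coord (dir l) p" by blast
    have ee: "e \<in> edges T" using e(1) interior_edges_subset by auto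
    have d: "dir e = dir l" using straight_subset_parallel(1)[OF straight_edge[OF ee] sl e(2)] .
    obtain f where f: "side T (\<sigma> (\<not> dir e)) e f" using interior_edgeD(2)[OF e(1)] by blast
    have "quadrant p r \<sigma> \<subseteq> interior f" using side_contains_quadrant[where \<sigma> = \<sigma>, OF g ee e(3) f] e(4) d by auto
    thus "\<exists>f\<in>cells T. quadrant p r \<sigma> \<subseteq> f" using sideD(1)[OF f] interior_subset[of f] by (meson subset_trans)
  qed
qed

lemma T_l_edge_subset_interior:
  assumes l: "l \<in> T_l_edges T"
  shows "l \<subseteq> interior \<Omega>"
proof
  fix p assume p: "p \<in> l"
  have li: "l \<in> interior_l_edges T" using l by (simp add: T_l_edges_def)
  have sl: "straight l" using straight_interior_l_edge[OF li] .
  have ends: "lower_end l \<in> interior \<Omega>" "upper_end l \<in> interior \<Omega>"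
    using l by (auto simp: T_l_edges_def interior_vertices_def endpoints_straight[OF sl])
  show "p \<in> interior \<Omega>"
  proof (cases "lo l < coord (dir l) p \<and> coord (dir l) p < hi l")
    case True thus ?thesis using interior_l_edge_point[OF li p] by blast
  next
    case False
    hence "p = lower_end l \<or> p = upper_end l" using p
      by (auto simp: mem_straight[OF sl] intro!: point_eqI[of "dir l"])
    thus ?thesis using ends by auto
  qed
qed

lemma interior_vertex_l_edge:
  assumes v: "v \<in> interior_vertices T"
  shows "\<exists>l\<in>interior_l_edges T. dir l = b \<and> v \<in> l"
proof -
  have v': "v \<in> vertices T" "v \<in> interior \<Omega>" using v by (auto simp: interior_vertices_def)
  obtain e where e: "e \<in> edges T" "dir e = b" "v \<in> endpoints e" using vertex_has_edge[OF v'(1)] by blast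
  have ve: "v \<in> e" using e endpoints_straight[OF straight_edge[OF e(1)]] ends_mem[OF straight_edge[OF e(1)]] by auto
  have ei: "e \<in> interior_edges T" using interior_edge_if_meets_interior e v' ve by blast
  obtain l where l: "l \<in> interior_l_edges T" "e \<subseteq> l"
    using edge_in_max_segment[OF interior_edges_subset ei] by (auto simp: interior_l_edges_def)
  have "dir l = b"
    using straight_subset_parallel(1)[OF straight_edge[OF e(1)] straight_interior_l_edge[OF l(1)] l(2)] e by simp
  thus ?thesis using l ve by blast
qed

lemma interior_l_edge_unique:
  "l \<in> interior_l_edges T \<Longrightarrow> l' \<in> interior_l_edges T \<Longrightarrow> dir l = dir l' \<Longrightarrow> p \<in> l \<Longrightarrow> p \<in> l' \<Longrightarrow> l = l'"
  using max_segment_unique[OF interior_edges_subset] by (auto simp: interior_l_edges_def)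

lemma crossing_is_vertex:
  assumes l: "l \<in> interior_l_edges T" "l' \<in> interior_l_edges T" "dir l \<noteq> dir l'" "p \<in> l" "p \<in> l'"
  shows "p \<in> vertices T"
proof -
  obtain e where e: "e \<in> interior_edges T" "e \<subseteq> l" "p \<in> e"
    using max_segment_covered[OF interior_edges_subset _ l(4)] l by (auto simp: interior_l_edges_def)
  obtain e' where e': "e' \<in> interior_edges T" "e' \<subseteq> l'" "p \<in> e'"
    using max_segment_covered[OF interior_edges_subset _ l(5)] l by (auto simp: interior_l_edges_def)
  have ee: "e \<in> edges T" "e' \<in> edges T" using e e' interior_edges_subset by auto
  have "dir e \<noteq> dir e'"
    using straight_subset_parallel(1)[OF straight_edge[OF ee(1)] straight_interior_l_edge[OF l(1)] e(2)]
      straight_subset_parallel(1)[OF straight_edge[OF ee(2)] straight_interior_l_edge[OF l(2)] e'(2)] l(3) by simp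
  hence "p \<in> endpoints e" using edges_inter[OF ee] e e' by blast
  thus ?thesis using endpoint_vertex ee by blast
qed

lemma interior_l_edges_eq: "interior_l_edges T = cross_cuts T \<union> rays T \<union> T_l_edges T"
proof
  show "interior_l_edges T \<subseteq> cross_cuts T \<union> rays T \<union> T_l_edges T"
  proof
    fix l assume l: "l \<in> interior_l_edges T"
    have sl: "straight l" using straight_interior_l_edge[OF l] .
    have ends: "lower_end l \<in> vertices T" "upper_end l \<in> vertices T"
      using max_segment_ends_vertices[OF interior_edges_subset] l by (auto simp: interior_l_edges_def)
    have ne: "lower_end l \<noteq> upper_end l" using lower_end_neq_upper_end[OF sl] .
    show "l \<in> cross_cuts T \<union> rays T \<union> T_l_edges T"
    proof (cases "lower_end l \<in> interior \<Omega>"; cases "upper_end l \<in> interior \<Omega>")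
      assume a: "lower_end l \<in> interior \<Omega>" "upper_end l \<notin> interior \<Omega>"
      hence "endpoints l \<inter> boundary_vertices T = {upper_end l}"
        using ends endpoints_straight[OF sl] by (auto simp: boundary_vertices_def)
      thus ?thesis using l by (simp add: rays_def)
    next
      assume a: "lower_end l \<notin> interior \<Omega>" "upper_end l \<in> interior \<Omega>"
      hence "endpoints l \<inter> boundary_vertices T = {lower_end l}"
        using ends endpoints_straight[OF sl] by (auto simp: boundary_vertices_def)
      thus ?thesis using l by (simp add: rays_def)
    qed (use l ends endpoints_straight[OF sl] in
        \<open>auto simp: T_l_edges_def cross_cuts_def interior_vertices_def boundary_vertices_def\<close>)
  qed
qed (auto simp: cross_cuts_def rays_def T_l_edges_def)

text \<open>
  Distinct l-edges meeting a T l-edge meet it in distinct vertices, and every vertex of it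
  arises in this way.  So vertices can be counted by means of the intersection pattern alone.
\<close>

lemma card_private_vertices:
  assumes X: "X \<subseteq> T_l_edges T" and l: "l \<in> X"
  shows "card (vertices T \<inter> l - \<Union> (X - {l})) = card {l' \<in> l_edges T. l' \<noteq> l \<and> l' \<inter> l \<noteq> {} \<and> l' \<notin> X}"
proof -
  have lT: "l \<in> T_l_edges T" using X l by auto
  have li: "l \<in> interior_l_edges T" using lT by (simp add: T_l_edges_def)
  have sl: "straight l" using straight_interior_l_edge[OF li] .
  have sub: "l \<subseteq> interior \<Omega>" using T_l_edge_subset_interior[OF lT] .
  define S where "S = {l' \<in> l_edges T. l' \<noteq> l \<and> l' \<inter> l \<noteq> {} \<and> l' \<notin> X}"
  have perp: "l' \<in> interior_l_edges T \<and> dir l' \<noteq> dir l" if "l' \<in> l_edges T" "l' \<noteq> l" "q \<in> l'" "q \<in> l" for l' q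
  proof -
    have "l' \<notin> boundary_l_edges T" using boundary_l_edge_frontier[of l' q] that sub by (auto simp: frontier_def)
    hence "l' \<in> interior_l_edges T" using that by (auto simp: l_edges_def)
    thus ?thesis using interior_l_edge_unique[OF _ li] that by blast
  qed
  define \<psi> where "\<psi> l' = (SOME q. q \<in> l' \<and> q \<in> l)" for l'
  have \<psi>: "\<psi> l' \<in> l' \<and> \<psi> l' \<in> l" if "l' \<in> S" for l'
    unfolding \<psi>_def by (rule someI_ex) (use that in \<open>auto simp: S_def\<close>)
  have perpS: "a \<in> interior_l_edges T \<and> dir a \<noteq> dir l" if "a \<in> S" for a
    using perp[of a "\<psi> a"] \<psi>[OF that] that unfolding S_def by blast
  have "inj_on \<psi> S"
  proof (rule inj_onI)
    fix a b assume ab: "a \<in> S" "b \<in> S" "\<psi> a = \<psi> b"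
    have "a \<in> interior_l_edges T" "dir a \<noteq> dir l" "b \<in> interior_l_edges T" "dir b \<noteq> dir l"
      using perpS[OF ab(1)] perpS[OF ab(2)] by blast+
    thus "a = b" using interior_l_edge_unique[of a b "\<psi> a"] \<psi>[OF ab(1)] \<psi>[OF ab(2)] ab(3) by auto
  qed
  moreover have "\<psi> ` S = vertices T \<inter> l - \<Union> (X - {l})"
  proof (intro equalityI subsetI)
    fix v assume "v \<in> \<psi> ` S"
    then obtain l' where l': "l' \<in> S" "v = \<psi> l'" by auto
    have v: "v \<in> l'" "v \<in> l" using \<psi>[OF l'(1)] l'(2) by auto
    have p: "l' \<in> interior_l_edges T" "dir l' \<noteq> dir l" using perp[of l' v] l' v by (auto simp: S_def)
    have "v \<in> vertices T" using crossing_is_vertex[OF p(1) li p(2) v] .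
    moreover have "v \<notin> k" if k: "k \<in> X - {l}" for k
    proof
      assume vk: "v \<in> k"
      have "k \<in> interior_l_edges T" using k X by (auto simp: T_l_edges_def)
      moreover have "dir k \<noteq> dir l" using interior_l_edge_unique[OF _ li _ vk v(2)] calculation k by blast
      ultimately have "k = l'" using interior_l_edge_unique[OF _ p(1) _ vk v(1)] p(2) by auto
      thus False using k l' by (auto simp: S_def)
    qed
    ultimately show "v \<in> vertices T \<inter> l - \<Union> (X - {l})" using v by auto
  next
    fix v assume v: "v \<in> vertices T \<inter> l - \<Union> (X - {l})"
    hence "v \<in> interior_vertices T" using sub by (auto simp: interior_vertices_def)
    then obtain l' where l': "l' \<in> interior_l_edges T" "dir l' = (\<not> dir l)" "v \<in> l'"
      using interior_vertex_l_edge by blast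
    have "l' \<noteq> l" using l'(2) by auto
    moreover have "l' \<notin> X" using v l'(3) calculation by auto
    ultimately have S: "l' \<in> S" using l' v by (auto simp: S_def l_edges_def)
    have "\<psi> l' = v" using perpendicular_meet_once[OF straight_interior_l_edge[OF l'(1)] sl] l' v \<psi>[OF S] by auto
    thus "v \<in> \<psi> ` S" using S by blast
  qed
  ultimately show ?thesis using card_image[of \<psi> S] by (simp add: S_def)
qed

text \<open>
  Two interior l-edges may also meet in a boundary vertex, at a reentrant corner; then
  a boundary l-edge passes through it and meets both.
\<close>

definition crossing_pairs :: "point set set set" where
  "crossing_pairs = {{l, l'} | l l'. l \<in> interior_l_edges T \<and> l' \<in> interior_l_edges T \<and> l \<noteq> l' \<and> l \<inter> l' \<noteq> {} \<and>
     \<not> (\<exists>b\<in>boundary_l_edges T. b \<inter> l \<noteq> {} \<and> b \<inter> l' \<noteq> {})}"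

lemma card_interior_vertices: "card (interior_vertices T) = card crossing_pairs"
proof -
  have cross: "\<exists>v\<in>interior_vertices T. v \<in> l \<and> v \<in> l'"
    if l: "l \<in> interior_l_edges T" "l' \<in> interior_l_edges T" "l \<noteq> l'" "l \<inter> l' \<noteq> {}"
      "\<not> (\<exists>b\<in>boundary_l_edges T. b \<inter> l \<noteq> {} \<and> b \<inter> l' \<noteq> {})" for l l'
  proof -
    obtain v where v: "v \<in> l" "v \<in> l'" using l by auto
    have "dir l \<noteq> dir l'" using interior_l_edge_unique l v by blast
    hence vv: "v \<in> vertices T" using crossing_is_vertex l v by blast
    have "v \<in> interior \<Omega>"
    proof (rule ccontr)
      assume "v \<notin> interior \<Omega>"
      then obtain e where e: "e \<in> boundary_edges T" "v \<in> e" using boundary_vertex_on_boundary_edge vv by blast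
      then obtain b where "b \<in> boundary_l_edges T" "v \<in> b"
        using edge_in_max_segment[OF boundary_edges_subset e(1)] by (auto simp: boundary_l_edges_def)
      thus False using l(5) v by blast
    qed
    thus ?thesis using vv v by (auto simp: interior_vertices_def)
  qed
  define meet where "meet X = (SOME v. v \<in> interior_vertices T \<and> v \<in> \<Inter> X)" for X :: "point set set"
  have meet: "meet X \<in> interior_vertices T \<and> meet X \<in> \<Inter> X" if "X \<in> crossing_pairs" for X
    unfolding meet_def
  proof (rule someI_ex)
    from that obtain l l' where "X = {l, l'}" "l \<in> interior_l_edges T" "l' \<in> interior_l_edges T" "l \<noteq> l'" "l \<inter> l' \<noteq> {}"
      "\<not> (\<exists>b\<in>boundary_l_edges T. b \<inter> l \<noteq> {} \<and> b \<inter> l' \<noteq> {})" unfolding crossing_pairs_def by blast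
    thus "\<exists>v. v \<in> interior_vertices T \<and> v \<in> \<Inter> X" using cross[of l l'] by auto
  qed
  have pair: "\<exists>h w. h \<in> interior_l_edges T \<and> w \<in> interior_l_edges T \<and> dir h \<and> \<not> dir w \<and> X = {h, w}"
    if "X \<in> crossing_pairs" for X
  proof -
    from that obtain l l' where l: "X = {l, l'}" "l \<in> interior_l_edges T" "l' \<in> interior_l_edges T" "l \<noteq> l'" "l \<inter> l' \<noteq> {}"
      unfolding crossing_pairs_def by blast
    hence "dir l \<noteq> dir l'" using interior_l_edge_unique by blast
    thus ?thesis using l by (cases "dir l") (auto simp: insert_commute)
  qed
  have "inj_on meet crossing_pairs"
  proof (rule inj_onI)
    fix X Y assume XY: "X \<in> crossing_pairs" "Y \<in> crossing_pairs" "meet X = meet Y"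
    obtain h w where hw: "h \<in> interior_l_edges T" "w \<in> interior_l_edges T" "dir h" "\<not> dir w" "X = {h, w}"
      using pair[OF XY(1)] by blast
    obtain h' w' where hw': "h' \<in> interior_l_edges T" "w' \<in> interior_l_edges T" "dir h'" "\<not> dir w'" "Y = {h', w'}"
      using pair[OF XY(2)] by blast
    have "h = h'" "w = w'" using interior_l_edge_unique[of h h' "meet X"] interior_l_edge_unique[of w w' "meet X"]
        hw hw' meet[OF XY(1)] meet[OF XY(2)] XY(3) by auto
    thus "X = Y" using hw hw' by simp
  qed
  moreover have "meet ` crossing_pairs = interior_vertices T"
  proof (intro equalityI subsetI)
    fix v assume v: "v \<in> interior_vertices T"
    obtain h where h: "h \<in> interior_l_edges T" "dir h = True" "v \<in> h" using interior_vertex_l_edge[OF v] by blast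
    obtain w where w: "w \<in> interior_l_edges T" "dir w = False" "v \<in> w" using interior_vertex_l_edge[OF v] by blast
    have sh: "straight h" "straight w" using h w straight_interior_l_edge by auto
    have no: "\<not> (\<exists>b\<in>boundary_l_edges T. b \<inter> h \<noteq> {} \<and> b \<inter> w \<noteq> {})"
    proof
      assume "\<exists>b\<in>boundary_l_edges T. b \<inter> h \<noteq> {} \<and> b \<inter> w \<noteq> {}"
      then obtain b p q where b: "b \<in> boundary_l_edges T" "p \<in> b" "p \<in> h" "q \<in> b" "q \<in> w" by auto
      have sb: "straight b" using straight_boundary_l_edge b by auto
      have "v \<in> b"
      proof (cases "dir b")
        case True
        hence "q = v" using b h w by (intro point_eqI[of True]) (simp_all add: mem_straight sb sh)
        thus ?thesis using b by simp
      next
        case False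
        hence "p = v" using b h w by (intro point_eqI[of True]) (simp_all add: mem_straight sb sh)
        thus ?thesis using b by simp
      qed
      thus False using boundary_l_edge_frontier[OF b(1)] v by (auto simp: interior_vertices_def frontier_def)
    qed
    have "h \<noteq> w" using h w by auto
    hence X: "{h, w} \<in> crossing_pairs" using h w no unfolding crossing_pairs_def by blast
    have "meet {h, w} = v" using perpendicular_meet_once[OF sh] meet[OF X] h w by auto
    thus "v \<in> meet ` crossing_pairs" using X by blast
  qed (use meet in auto)
  ultimately show ?thesis using card_image[of meet crossing_pairs] by simp
qed

end

section \<open>The CNDC by peeling\<close>

definition private_vertices :: "tmesh \<Rightarrow> point set set \<Rightarrow> point set \<Rightarrow> nat" where
  "private_vertices T X l = card (vertices T \<inter> l - \<Union> (X - {l}))"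

text \<open>
  Read backwards, an ordering that diagonalizes the second component of a bipartition removes
  from all T l-edges, one at a time, an l-edge with at least \<^term>\<open>d + 1\<close> vertices on no
  other remaining l-edge.
\<close>

inductive peels_to :: "nat \<Rightarrow> tmesh \<Rightarrow> point set set \<Rightarrow> bool" for d T where
  peels_to_all: "peels_to d T (T_l_edges T)"
| peels_to_remove: "peels_to d T X \<Longrightarrow> l \<in> X \<Longrightarrow> d + 1 \<le> private_vertices T X l \<Longrightarrow> peels_to d T (X - {l})"

definition unpeelable :: "nat \<Rightarrow> tmesh \<Rightarrow> point set set \<Rightarrow> bool" where
  "unpeelable d T X \<longleftrightarrow> (\<forall>l\<in>X. private_vertices T X l < d + 1)"

definition is_core :: "nat \<Rightarrow> tmesh \<Rightarrow> point set set \<Rightarrow> bool" where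
  "is_core d T C \<longleftrightarrow> peels_to d T C \<and> unpeelable d T C"

definition part1 :: "tmesh \<Rightarrow> point set set \<Rightarrow> component" where
  "part1 T X = \<lparr>comp_edges = X, comp_vertices = vertices T \<inter> \<Union> X\<rparr>"

definition part2 :: "tmesh \<Rightarrow> point set set \<Rightarrow> component" where
  "part2 T X = \<lparr>comp_edges = T_l_edges T - X,
     comp_vertices = vertices T \<inter> \<Union> (T_l_edges T - X) - \<Union> X\<rparr>"

lemma bipartition_iff: "bipartition T S1 S2 \<longleftrightarrow> (\<exists>X\<subseteq>T_l_edges T. S1 = part1 T X \<and> S2 = part2 T X)"
proof
  assume "bipartition T S1 S2"
  then obtain L1 L2 where L: "L1 \<union> L2 = T_l_edges T" "L1 \<inter> L2 = {}"
    "S1 = \<lparr>comp_edges = L1, comp_vertices = vertices T \<inter> \<Union> L1\<rparr>"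
    "S2 = \<lparr>comp_edges = L2, comp_vertices = vertices T \<inter> \<Union> L2 - \<Union> L1\<rparr>"
    unfolding bipartition_def by blast
  have "L2 = T_l_edges T - L1" using L by blast
  thus "\<exists>X\<subseteq>T_l_edges T. S1 = part1 T X \<and> S2 = part2 T X"
    using L by (intro exI[of _ L1]) (auto simp: part1_def part2_def)
next
  assume "\<exists>X\<subseteq>T_l_edges T. S1 = part1 T X \<and> S2 = part2 T X"
  then obtain X where X: "X \<subseteq> T_l_edges T" "S1 = part1 T X" "S2 = part2 T X" by blast
  thus "bipartition T S1 S2" unfolding bipartition_def part1_def part2_def
    by (intro exI[of _ X] exI[of _ "T_l_edges T - X"]) auto
qed

lemma peels_to_subset: "peels_to d T X \<Longrightarrow> X \<subseteq> T_l_edges T"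
  by (induction rule: peels_to.induct) auto

lemma vertices_left_part2:
  assumes "X \<subseteq> T_l_edges T" "set ls \<subseteq> T_l_edges T - X" "i < length ls"
  shows "vertices_left (part2 T X) ls i = card (vertices T \<inter> ls ! i - \<Union> (X \<union> set (take i ls)))"
proof -
  have "ls ! i \<in> T_l_edges T - X" using assms nth_mem by blast
  moreover have "(\<Union>j<i. ls ! j) = \<Union> (set (take i ls))" using assms(3)
    by (subst nth_image[symmetric]) (auto simp: lessThan_atLeast0)
  ultimately have "comp_vertices (part2 T X) \<inter> ls ! i - (\<Union>j<i. ls ! j) = vertices T \<inter> ls ! i - \<Union> (X \<union> set (take i ls))"
    by (auto simp: part2_def)
  thus ?thesis by (simp add: vertices_left_def)
qed

text \<open>
  The l-edge placed last in the ordering is the first to be removed.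
\<close>
lemma diagonalizable_part2_iff:
  assumes X: "X \<subseteq> T_l_edges T"
  shows "diagonalizable d (part2 T X) \<longleftrightarrow> peels_to d T X"
proof
  assume "diagonalizable d (part2 T X)"
  then obtain ls where ls: "distinct ls" "set ls = T_l_edges T - X"
    "\<And>i. i < length ls \<Longrightarrow> d + 1 \<le> vertices_left (part2 T X) ls i"
    unfolding diagonalizable_def by (auto simp: part2_def)
  have "peels_to d T (X \<union> set (take (length ls - k) ls))" if "k \<le> length ls" for k
    using that
  proof (induction k)
    case 0
    have "X \<union> set ls = T_l_edges T" using ls X by auto
    thus ?case using peels_to_all by simp
  next
    case (Suc k)
    define i where "i = length ls - Suc k"
    have i: "i < length ls" "length ls - k = Suc i" using Suc.prems by (auto simp: i_def)
    define Y where "Y = X \<union> set (take (Suc i) ls)"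
    have Y: "peels_to d T Y" using Suc i by (simp add: Y_def)
    have t: "set (take (Suc i) ls) = insert (ls ! i) (set (take i ls))" using i by (simp add: take_Suc_conv_app_nth)
    have "ls ! i \<notin> set (take i ls)"
      using distinct_take[OF ls(1), of "Suc i"] i by (simp add: take_Suc_conv_app_nth)
    moreover have "ls ! i \<notin> X" using ls(2) nth_mem[OF i(1)] by auto
    ultimately have Yl: "Y - {ls ! i} = X \<union> set (take i ls)" by (auto simp: Y_def t)
    have "private_vertices T Y (ls ! i) = vertices_left (part2 T X) ls i"
      using vertices_left_part2[OF X _ i(1)] ls(2) by (simp add: private_vertices_def Yl)
    hence "peels_to d T (Y - {ls ! i})" using ls(3)[OF i(1)] Y
      by (intro peels_to_remove) (auto simp: Y_def t)
    thus ?case using Yl unfolding i_def by simp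
  qed
  from this[of "length ls"] show "peels_to d T X" by simp
next
  assume "peels_to d T X"
  hence "\<exists>ls. distinct ls \<and> set ls = T_l_edges T - X \<and> (\<forall>i<length ls. d + 1 \<le> vertices_left (part2 T X) ls i)"
  proof (induction rule: peels_to.induct)
    case peels_to_all
    show ?case by (intro exI[of _ "[]"]) auto
  next
    case (peels_to_remove X l)
    then obtain ls where ls: "distinct ls" "set ls = T_l_edges T - X"
      "\<And>i. i < length ls \<Longrightarrow> d + 1 \<le> vertices_left (part2 T X) ls i" by blast
    have XT: "X \<subseteq> T_l_edges T" using peels_to_subset peels_to_remove(1) by blast
    have set: "set (l # ls) = T_l_edges T - (X - {l})" using ls(2) peels_to_remove(2) XT by auto
    have s1: "X - {l} \<subseteq> T_l_edges T" and s2: "set (l # ls) \<subseteq> T_l_edges T - (X - {l})" and s3: "set ls \<subseteq> T_l_edges T - X"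
      using XT set ls(2) by blast+
    have "d + 1 \<le> vertices_left (part2 T (X - {l})) (l # ls) i" if i: "i < length (l # ls)" for i
    proof (cases i)
      case 0
      have "vertices_left (part2 T (X - {l})) (l # ls) 0 = private_vertices T X l"
        using vertices_left_part2[OF s1 s2, of 0] by (simp add: private_vertices_def)
      thus ?thesis using peels_to_remove(3) 0 by simp
    next
      case (Suc j)
      have j: "j < length ls" using i Suc by simp
      have "X - {l} \<union> set (take (Suc j) (l # ls)) = X \<union> set (take j ls)"
        using peels_to_remove(2) by (simp only: take_Suc_Cons list.set) blast
      hence "vertices_left (part2 T (X - {l})) (l # ls) i = vertices_left (part2 T X) ls j"
        using vertices_left_part2[OF s1 s2 i] vertices_left_part2[OF XT s3 j] Suc by simp
      thus ?thesis using ls(3)[OF j] by simp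
    qed
    moreover have "distinct (l # ls)" using ls peels_to_remove(2) by auto
    ultimately show ?case using set by blast
  qed
  thus "diagonalizable d (part2 T X)" by (simp add: diagonalizable_def part2_def)
qed

context T_mesh_geometry
begin

lemma private_vertices_antimono:
  "C \<subseteq> X \<Longrightarrow> private_vertices T X l \<le> private_vertices T C l"
  unfolding private_vertices_def by (intro card_mono) (auto simp: finite_vertices)

text \<open>
  An l-edge that can be removed from a set of l-edges can also be removed from every smaller
  set containing it, so removals never reach into an unpeelable set.
\<close>

lemma unpeelable_subset_peels_to:
  assumes C: "unpeelable d T C" "C \<subseteq> T_l_edges T" and X: "peels_to d T X"
  shows "C \<subseteq> X"
  using X
proof (induction rule: peels_to.induct)
  case (peels_to_remove X l)
  have "l \<notin> C"
  proof
    assume "l \<in> C"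
    hence "private_vertices T C l < d + 1" using C by (auto simp: unpeelable_def)
    thus False using private_vertices_antimono[OF peels_to_remove(4), of l] peels_to_remove(3) by simp
  qed
  thus ?case using peels_to_remove by auto
qed (use C in auto)

lemma core_exists: "\<exists>C. is_core d T C"
proof -
  obtain C where C: "peels_to d T C" "\<forall>Y. peels_to d T Y \<longrightarrow> card C \<le> card Y"
    using ex_has_least_nat[of "peels_to d T" _ card] peels_to_all by blast
  have "finite (T_l_edges T)" using finite_l_edges
    by (rule finite_subset[rotated]) (auto simp: T_l_edges_def l_edges_def)
  hence fin: "finite C" using peels_to_subset[OF C(1)] finite_subset by blast
  have "unpeelable d T C" unfolding unpeelable_def
  proof (rule ballI, rule ccontr)
    fix l assume l: "l \<in> C" "\<not> private_vertices T C l < d + 1"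
    hence "card C \<le> card (C - {l})" using C peels_to_remove[OF C(1), of l] by auto
    thus False using l fin by (metis card_Diff1_less leD)
  qed
  thus ?thesis using C by (auto simp: is_core_def)
qed

text \<open>
  The last l-edge of a diagonalizing ordering could be removed.
\<close>
lemma unpeelable_not_diagonalizable:
  assumes C: "unpeelable d T C" "C \<noteq> {}"
  shows "\<not> diagonalizable d (part1 T C)"
proof
  assume "diagonalizable d (part1 T C)"
  then obtain ls where ls: "distinct ls" "set ls = C"
    "\<And>i. i < length ls \<Longrightarrow> d + 1 \<le> vertices_left (part1 T C) ls i"
    unfolding diagonalizable_def by (auto simp: part1_def)
  have ne: "ls \<noteq> []" using ls C by auto
  define n where "n = length ls - 1"
  have n: "n < length ls" "length ls = Suc n" using ne by (auto simp: n_def)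
  have l: "ls ! n \<in> C" using ls n nth_mem by blast
  have "set (take n ls) = C - {ls ! n}"
  proof -
    have *: "ls = take n ls @ [ls ! n]" using n by (metis take_Suc_conv_app_nth take_all order_refl)
    have "distinct (take n ls @ [ls ! n])" using ls(1) * by metis
    moreover have "set (take n ls @ [ls ! n]) = C" using ls(2) * by metis
    ultimately show ?thesis by auto
  qed
  moreover have "(\<Union>j<n. ls ! j) = \<Union> (set (take n ls))" using n
    by (subst nth_image[symmetric]) (auto simp: lessThan_atLeast0)
  ultimately have "vertices_left (part1 T C) ls n = private_vertices T C (ls ! n)"
    using l unfolding vertices_left_def private_vertices_def part1_def
    by (intro arg_cong[where f = card]) auto
  thus False using ls(3)[OF n(1)] C l by (auto simp: unpeelable_def)
qed

text \<open>
  In every regular partition the first component is reached by removals, so it contains the core;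
  and the core is itself the first component of a regular partition.
\<close>
lemma CNDC_eq_core:
  assumes C: "is_core d T C"
  shows "CNDC d T = part1 T C"
proof -
  have CT: "C \<subseteq> T_l_edges T" and peel: "peels_to d T C" and un: "unpeelable d T C"
    using C peels_to_subset by (auto simp: is_core_def)
  have regD: "\<exists>X. X \<subseteq> T_l_edges T \<and> S1 = part1 T X \<and> S2 = part2 T X \<and> C \<subseteq> X" if "regular_partition d T S1 S2" for S1 S2
  proof -
    from that obtain X where X: "X \<subseteq> T_l_edges T" "S1 = part1 T X" "S2 = part2 T X"
      unfolding regular_partition_def bipartition_iff by blast
    have "peels_to d T X"
    proof (cases "empty_component S2")
      case True
      hence "X = T_l_edges T" using X by (auto simp: empty_component_def part2_def)
      thus ?thesis using peels_to_all by simp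
    next
      case False
      hence "diagonalizable d S2" using that by (simp add: regular_partition_def)
      thus ?thesis using diagonalizable_part2_iff[OF X(1)] X(3) by simp
    qed
    thus ?thesis using unpeelable_subset_peels_to[OF un CT] X by blast
  qed
  have reg: "regular_partition d T (part1 T C) (part2 T C)"
    unfolding regular_partition_def
  proof (intro conjI)
    show "bipartition T (part1 T C) (part2 T C)" using CT bipartition_iff by blast
    show "empty_component (part1 T C) \<or> \<not> diagonalizable d (part1 T C)"
      using unpeelable_not_diagonalizable[OF un] by (auto simp: empty_component_def part1_def)
    show "empty_component (part2 T C) \<or> diagonalizable d (part2 T C)"
      using diagonalizable_part2_iff[OF CT] peel by blast
  qed
  have le: "component_le (part1 T X) (part1 T Y) \<longleftrightarrow> X \<subseteq> Y" for X Y
    by (auto simp: component_le_def part1_def)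
  have "complete_partition d T (part1 T C) (part2 T C)"
    unfolding complete_partition_def
  proof (intro conjI allI impI reg; elim conjE)
    fix S1 S2 assume "regular_partition d T S1 S2" and c: "component_le S1 (part1 T C)"
    then obtain X where X: "S1 = part1 T X" "S2 = part2 T X" "C \<subseteq> X" using regD by blast
    hence "X = C" using c le by auto
    thus "S1 = part1 T C" "S2 = part2 T C" using X by auto
  qed
  moreover have "S1 = part1 T C" if "complete_partition d T S1 S2" for S1 S2
  proof -
    have "regular_partition d T S1 S2" using that by (simp add: complete_partition_def)
    then obtain X where X: "S1 = part1 T X" "C \<subseteq> X" using regD by blast
    hence "component_le (part1 T C) S1" using le by simp
    thus ?thesis using that reg unfolding complete_partition_def by metis
  qed
  ultimately show ?thesis unfolding CNDC_def by (intro the_equality) blast+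
qed

section \<open>The rank of the conformality matrix under peeling\<close>

definition moment_row :: "point set \<Rightarrow> nat \<Rightarrow> point \<Rightarrow> real" where
  "moment_row l k v = (if v \<in> vertices T \<inter> l then coord (dir l) v ^ k else 0)"

lemma coord_along_eq: "coord_along l v = coord (dir l) v"
  by (simp add: coord_along_def coord_def dir_def)

lemma rows_part1:
  "conformality_matrix (part1 T X) ` conformality_rows d (part1 T X) = (\<Union>l\<in>X. moment_row l ` {..d})"
proof -
  have "conformality_matrix (part1 T X) (l, k) = moment_row l k" if "l \<in> X" for l k
    using that by (auto simp: fun_eq_iff conformality_matrix_def moment_row_def part1_def coord_along_eq)
  moreover have "conformality_rows d (part1 T X) = X \<times> {..d}" by (simp add: conformality_rows_def part1_def)
  ultimately show ?thesis by (force simp: image_iff)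
qed

text \<open>
  The powers of the coordinates of \<^term>\<open>d + 1\<close> points form an invertible Vandermonde matrix,
  so removing an l-edge with that many private vertices removes \<^term>\<open>d + 1\<close> from the rank.
\<close>

lemma rank_remove_l_edge:
  assumes X: "X \<subseteq> T_l_edges T" and l: "l \<in> X" and p: "d + 1 \<le> private_vertices T X l"
  shows "conformality_rank d (part1 T X) = conformality_rank d (part1 T (X - {l})) + (d + 1)"
proof -
  have sl: "straight l" using X l straight_interior_l_edge by (auto simp: T_l_edges_def)
  have "finite X" using finite_l_edges X
    by (rule_tac finite_subset[of _ "l_edges T"]) (auto simp: T_l_edges_def l_edges_def)
  hence fin: "finite (\<Union>l\<in>X - {l}. moment_row l ` {..d})" by auto
  have eq: "(\<Union>l\<in>X. moment_row l ` {..d}) = (\<Union>l\<in>X - {l}. moment_row l ` {..d}) \<union> moment_row l ` {..<d + 1}"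
    using l by (auto simp: lessThan_Suc_atMost)
  have "fun_space.dim ((\<Union>l\<in>X - {l}. moment_row l ` {..d}) \<union> moment_row l ` {..<d + 1}) =
      fun_space.dim (\<Union>l\<in>X - {l}. moment_row l ` {..d}) + (d + 1)"
  proof (rule dim_add_rows_independent_off[where W = "\<Union> (X - {l})", OF fin])
    fix f v assume "v \<notin> \<Union> (X - {l})" "f \<in> (\<Union>l\<in>X - {l}. moment_row l ` {..d})"
    then obtain k l' where f: "f = moment_row l' k" and l': "l' \<in> X - {l}" by blast
    hence "v \<notin> l'" using \<open>v \<notin> \<Union> (X - {l})\<close> by blast
    thus "f v = 0" by (simp add: f moment_row_def)
  next
    fix c assume c: "\<And>v. v \<notin> \<Union> (X - {l}) \<Longrightarrow> (\<Sum>k<d + 1. c k * moment_row l k v) = 0"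
    let ?P = "vertices T \<inter> l - \<Union> (X - {l})"
    have inj: "inj_on (coord (dir l)) ?P"
      by (rule inj_onI, rule point_eqI[of "dir l"]) (auto simp: mem_straight[OF sl])
    have roots: "coord (dir l) ` ?P \<subseteq> {z. (\<Sum>k\<le>d. c k * z ^ k) = 0}"
    proof safe
      fix v assume v: "v \<in> vertices T" "v \<in> l" "v \<notin> \<Union> (X - {l})"
      show "(\<Sum>k\<le>d. c k * coord (dir l) v ^ k) = 0"
        using c[OF v(3)] v by (simp add: moment_row_def lessThan_Suc_atMost)
    qed
    show "\<forall>k<d + 1. c k = 0"
    proof (rule ccontr)
      assume "\<not> (\<forall>k<d + 1. c k = 0)"
      then obtain k where k: "k \<le> d" "c k \<noteq> 0" by (auto simp: less_Suc_eq_le)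
      have "card (coord (dir l) ` ?P) \<le> d"
        using card_mono[OF polyfun_rootbound_finite[of d c] roots] polyfun_rootbound_card[of d c] k
        by (meson order_trans)
      thus False using p card_image[OF inj] by (simp add: private_vertices_def)
    qed
  qed
  thus ?thesis unfolding conformality_rank_def matrix_rank_def rows_part1 eq .
qed

lemma finite_T_l_edges: "finite (T_l_edges T)"
  using finite_l_edges by (rule finite_subset[rotated]) (auto simp: T_l_edges_def l_edges_def)

lemma rank_peels_to:
  assumes "peels_to d T X"
  shows "conformality_rank d (part1 T (T_l_edges T)) =
    conformality_rank d (part1 T X) + (d + 1) * (card (T_l_edges T) - card X)"
  using assms
proof (induction rule: peels_to.induct)
  case (peels_to_remove X l)
  have X: "X \<subseteq> T_l_edges T" using peels_to_remove peels_to_subset by blast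
  hence fin: "finite X" using finite_T_l_edges finite_subset by blast
  have "card X \<le> card (T_l_edges T)" using X finite_T_l_edges card_mono by blast
  moreover have "card X = Suc (card (X - {l}))" using card.remove[OF fin peels_to_remove(2)] by simp
  ultimately have "card (T_l_edges T) - card (X - {l}) = card (T_l_edges T) - card X + 1" by simp
  hence "(d + 1) * (card (T_l_edges T) - card (X - {l})) = (d + 1) * (card (T_l_edges T) - card X) + (d + 1)"
    by (simp add: algebra_simps)
  thus ?case using peels_to_remove.IH rank_remove_l_edge[OF X peels_to_remove(2,3)] by linarith
qed simp

end

section \<open>Invariants of the structurally isomorphic class\<close>

locale isomorphic_T_meshes = A: T_mesh_geometry T + B: T_mesh_geometry T' for T T' +
  fixes \<alpha>
  assumes iso: "structurally_isomorphic_map T T' \<alpha>"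
begin

lemma inj: "inj_on \<alpha> (l_edges T)" and image: "\<alpha> ` l_edges T = l_edges T'"
  and image_boundary: "\<alpha> ` boundary_l_edges T = boundary_l_edges T'"
  and image_cross_cuts: "\<alpha> ` cross_cuts T = cross_cuts T'"
  and image_rays: "\<alpha> ` rays T = rays T'"
  and image_T_l_edges: "\<alpha> ` T_l_edges T = T_l_edges T'"
  and meet: "l \<in> l_edges T \<Longrightarrow> l' \<in> l_edges T \<Longrightarrow> \<alpha> l \<inter> \<alpha> l' \<noteq> {} \<longleftrightarrow> l \<inter> l' \<noteq> {}"
  using iso by (simp_all add: structurally_isomorphic_map_def bij_betw_def)

lemma image_interior: "\<alpha> ` interior_l_edges T = interior_l_edges T'"
  unfolding A.interior_l_edges_eq B.interior_l_edges_eq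
  by (simp add: image_Un image_cross_cuts image_rays image_T_l_edges)

lemma T_l_edges_subset: "T_l_edges T \<subseteq> l_edges T" "cross_cuts T \<subseteq> l_edges T" "interior_l_edges T \<subseteq> l_edges T"
  by (auto simp: T_l_edges_def cross_cuts_def l_edges_def)

lemma card_cross_cuts_eq: "card (cross_cuts T') = card (cross_cuts T)"
  using card_image[OF inj_on_subset[OF inj T_l_edges_subset(2)]] image_cross_cuts by simp

lemma card_T_l_edges_eq: "card (T_l_edges T') = card (T_l_edges T)"
  using card_image[OF inj_on_subset[OF inj T_l_edges_subset(1)]] image_T_l_edges by simp

lemma private_vertices_eq:
  assumes X: "X \<subseteq> T_l_edges T" and l: "l \<in> X"
  shows "private_vertices T' (\<alpha> ` X) (\<alpha> l) = private_vertices T X l"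
proof -
  define S where "S = {l' \<in> l_edges T. l' \<noteq> l \<and> l' \<inter> l \<noteq> {} \<and> l' \<notin> X}"
  have lL: "l \<in> l_edges T" "X \<subseteq> l_edges T" using X l T_l_edges_subset by auto
  have "\<alpha> ` S = {l' \<in> l_edges T'. l' \<noteq> \<alpha> l \<and> l' \<inter> \<alpha> l \<noteq> {} \<and> l' \<notin> \<alpha> ` X}"
  proof (intro equalityI subsetI)
    fix l' assume "l' \<in> \<alpha> ` S"
    then obtain k where k: "l' = \<alpha> k" "k \<in> l_edges T" "k \<noteq> l" "k \<inter> l \<noteq> {}" "k \<notin> X" by (auto simp: S_def)
    have "\<alpha> k \<noteq> \<alpha> l" using inj k lL by (meson inj_onD)
    moreover have "\<alpha> k \<notin> \<alpha> ` X" using k lL inj by (meson inj_on_image_mem_iff)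
    moreover have "\<alpha> k \<inter> \<alpha> l \<noteq> {}" using meet k lL by blast
    moreover have "\<alpha> k \<in> l_edges T'" using image k by blast
    ultimately show "l' \<in> {l' \<in> l_edges T'. l' \<noteq> \<alpha> l \<and> l' \<inter> \<alpha> l \<noteq> {} \<and> l' \<notin> \<alpha> ` X}" using k by simp
  next
    fix l' assume l': "l' \<in> {l' \<in> l_edges T'. l' \<noteq> \<alpha> l \<and> l' \<inter> \<alpha> l \<noteq> {} \<and> l' \<notin> \<alpha> ` X}"
    then obtain k where k: "l' = \<alpha> k" "k \<in> l_edges T" using image by blast
    have "k \<inter> l \<noteq> {}" using meet[OF k(2) lL(1)] l' k(1) by blast
    thus "l' \<in> \<alpha> ` S" using l' k by (auto simp: S_def)
  qed
  moreover have "card (\<alpha> ` S) = card S" by (intro card_image inj_on_subset[OF inj]) (auto simp: S_def)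
  moreover have "\<alpha> ` X \<subseteq> T_l_edges T'" "\<alpha> l \<in> \<alpha> ` X" using X l image_T_l_edges by auto
  ultimately show ?thesis
    unfolding private_vertices_def using A.card_private_vertices[OF X l] B.card_private_vertices[of "\<alpha> ` X" "\<alpha> l"]
    by (simp add: S_def)
qed

lemma peels_to_image: "peels_to d T X \<Longrightarrow> peels_to d T' (\<alpha> ` X)"
proof (induction rule: peels_to.induct)
  case peels_to_all
  show ?case unfolding image_T_l_edges by (rule peels_to.peels_to_all)
next
  case (peels_to_remove X l)
  have X: "X \<subseteq> T_l_edges T" using peels_to_remove peels_to_subset by blast
  hence "inj_on \<alpha> X" using T_l_edges_subset inj by (meson inj_on_subset subset_trans)
  hence "\<alpha> ` (X - {l}) = \<alpha> ` X - {\<alpha> l}" using peels_to_remove(2) by (simp add: inj_on_image_set_diff[of _ X])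
  moreover have "peels_to d T' (\<alpha> ` X - {\<alpha> l})"
    using peels_to_remove private_vertices_eq[OF X peels_to_remove(2)] by (intro peels_to.peels_to_remove) auto
  ultimately show ?case by simp
qed

text \<open>
  The image of a core is again reached by removals and unpeelable, and there is only one such set.
\<close>
lemma card_core_eq:
  assumes C: "is_core d T C" and C': "is_core d T' C'"
  shows "card C' = card C"
proof -
  have CT: "C \<subseteq> T_l_edges T" "C' \<subseteq> T_l_edges T'" using C C' peels_to_subset by (auto simp: is_core_def)
  have p: "peels_to d T' (\<alpha> ` C)" using C peels_to_image by (simp add: is_core_def)
  have "unpeelable d T' (\<alpha> ` C)"
    using C private_vertices_eq[OF CT(1)] by (auto simp: unpeelable_def is_core_def)
  moreover have "\<alpha> ` C \<subseteq> T_l_edges T'" using p peels_to_subset by blast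
  ultimately have "\<alpha> ` C \<subseteq> C'" using B.unpeelable_subset_peels_to C' by (auto simp: is_core_def)
  moreover have "C' \<subseteq> \<alpha> ` C" using B.unpeelable_subset_peels_to[OF _ CT(2) p] C' by (simp add: is_core_def)
  ultimately have "C' = \<alpha> ` C" by blast
  moreover have "inj_on \<alpha> C" using CT T_l_edges_subset inj by (meson inj_on_subset subset_trans)
  ultimately show ?thesis by (simp add: card_image)
qed

lemma card_interior_vertices_eq: "card (interior_vertices T') = card (interior_vertices T)"
proof -
  have I: "interior_l_edges T \<subseteq> l_edges T" "boundary_l_edges T \<subseteq> l_edges T" by (auto simp: l_edges_def)
  have touch: "(\<exists>b\<in>boundary_l_edges T'. b \<inter> \<alpha> l \<noteq> {} \<and> b \<inter> \<alpha> l' \<noteq> {}) \<longleftrightarrow>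
      (\<exists>b\<in>boundary_l_edges T. b \<inter> l \<noteq> {} \<and> b \<inter> l' \<noteq> {})" if "l \<in> l_edges T" "l' \<in> l_edges T" for l l'
  proof -
    have "\<alpha> b \<inter> \<alpha> l \<noteq> {} \<longleftrightarrow> b \<inter> l \<noteq> {}" "\<alpha> b \<inter> \<alpha> l' \<noteq> {} \<longleftrightarrow> b \<inter> l' \<noteq> {}" if "b \<in> boundary_l_edges T" for b
      using meet that I \<open>l \<in> l_edges T\<close> \<open>l' \<in> l_edges T\<close> by auto
    thus ?thesis unfolding image_boundary[symmetric] by simp
  qed
  have "image \<alpha> ` A.crossing_pairs = B.crossing_pairs"
  proof (intro equalityI subsetI)
    fix Y assume "Y \<in> image \<alpha> ` A.crossing_pairs"
    then obtain l l' where l: "Y = {\<alpha> l, \<alpha> l'}" "l \<in> interior_l_edges T" "l' \<in> interior_l_edges T" "l \<noteq> l'" "l \<inter> l' \<noteq> {}"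
      "\<not> (\<exists>b\<in>boundary_l_edges T. b \<inter> l \<noteq> {} \<and> b \<inter> l' \<noteq> {})" unfolding A.crossing_pairs_def by auto
    have ll: "l \<in> l_edges T" "l' \<in> l_edges T" using l I by auto
    have "\<alpha> l \<noteq> \<alpha> l'" using inj ll l(4) by (meson inj_onD)
    moreover have "\<alpha> l \<in> interior_l_edges T'" "\<alpha> l' \<in> interior_l_edges T'" using image_interior l by blast+
    moreover have "\<alpha> l \<inter> \<alpha> l' \<noteq> {}" using l(5) meet[OF ll] by simp
    moreover have "\<not> (\<exists>b\<in>boundary_l_edges T'. b \<inter> \<alpha> l \<noteq> {} \<and> b \<inter> \<alpha> l' \<noteq> {})"
      using l(6) touch[OF ll] by simp
    ultimately show "Y \<in> B.crossing_pairs" unfolding B.crossing_pairs_def mem_Collect_eq l(1)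
      by (intro exI[of _ "\<alpha> l"] exI[of _ "\<alpha> l'"] conjI refl)
  next
    fix Y assume "Y \<in> B.crossing_pairs"
    then obtain k k' where k: "Y = {k, k'}" "k \<in> interior_l_edges T'" "k' \<in> interior_l_edges T'" "k \<noteq> k'" "k \<inter> k' \<noteq> {}"
      "\<not> (\<exists>b\<in>boundary_l_edges T'. b \<inter> k \<noteq> {} \<and> b \<inter> k' \<noteq> {})" unfolding B.crossing_pairs_def by auto
    obtain l where l1: "l \<in> interior_l_edges T" "k = \<alpha> l" using k(2) unfolding image_interior[symmetric] by (rule imageE)
    obtain l' where l2: "l' \<in> interior_l_edges T" "k' = \<alpha> l'" using k(3) unfolding image_interior[symmetric] by (rule imageE)
    note l = l1(1) l2(1) l1(2) l2(2)
    have ll: "l \<in> l_edges T" "l' \<in> l_edges T" using l I by auto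
    have "l \<noteq> l'" using k(4) l(3,4) by auto
    moreover have "l \<inter> l' \<noteq> {}" using k(5) meet[OF ll] l(3,4) by simp
    moreover have "\<not> (\<exists>b\<in>boundary_l_edges T. b \<inter> l \<noteq> {} \<and> b \<inter> l' \<noteq> {})"
      using k(6) touch[OF ll] l(3,4) by simp
    ultimately have "{l, l'} \<in> A.crossing_pairs" unfolding A.crossing_pairs_def mem_Collect_eq
      using l(1,2) by (intro exI[of _ l] exI[of _ l'] conjI refl)
    moreover have "Y = \<alpha> ` {l, l'}" using k l by simp
    ultimately show "Y \<in> image \<alpha> ` A.crossing_pairs" by blast
  qed
  moreover have "inj_on (image \<alpha>) A.crossing_pairs"
  proof (rule inj_on_subset[OF inj_on_image_Pow[OF inj]])
    show "A.crossing_pairs \<subseteq> Pow (l_edges T)" using I unfolding A.crossing_pairs_def by auto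
  qed
  ultimately show ?thesis
    using A.card_interior_vertices B.card_interior_vertices card_image by metis
qed

end

section \<open>Simple connectedness and potentials\<close>

definition cpx :: "point \<Rightarrow> complex" where
  "cpx p = Complex (fst p) (snd p)"

lemma linear_cpx: "linear cpx"
  by (rule linearI) (auto simp: cpx_def complex_eq_iff)

lemma bij_cpx: "bij cpx"
  by (rule bij_betw_byWitness[where f' = "\<lambda>z. (Re z, Im z)"]) (auto simp: cpx_def)

lemma cpx_eq_iff [simp]: "cpx p = cpx q \<longleftrightarrow> p = q"
  using bij_cpx by (auto simp: bij_def inj_eq)

lemma cpx_mem_image [simp]: "cpx p \<in> cpx ` S \<longleftrightarrow> p \<in> S"
  by auto

lemma homeomorphic_cpx: "S homeomorphic (cpx ` S)"
proof -
  have "homeomorphism S (cpx ` S) cpx (\<lambda>z. (Re z, Im z))"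
    unfolding homeomorphism_def
    by (auto simp: cpx_def image_comp o_def intro!: continuous_intros
        linear_continuous_on[OF linear_conv_bounded_linear[THEN iffD1, OF linear_cpx], unfolded cpx_def])
  thus ?thesis using homeomorphic_def by blast
qed

text \<open>
  The winding number around a point of the boundary of \<^term>\<open>S\<close> is the one around a nearby
  point outside \<^term>\<open>S\<close>.
\<close>

lemma simply_connected_interior:
  fixes S :: "complex set"
  assumes S: "simply_connected S" and con: "connected (interior S)"
  shows "simply_connected (interior S)"
  unfolding simply_connected_eq_winding_number_zero[OF open_interior]
proof (intro conjI allI impI con; elim conjE)
  fix g z assume g: "path g" "path_image g \<subseteq> interior S" "pathfinish g = pathstart g" and z: "z \<notin> interior S"
  have "closed (path_image g)" using g(1) compact_path_image compact_imp_closed by blast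
  moreover have "z \<notin> path_image g" using g(2) z by blast
  ultimately obtain e where e: "0 < e" "ball z e \<subseteq> - path_image g"
    by (meson ComplI open_Compl open_contains_ball)
  have "z \<in> closure (- S)" using z by (simp add: closure_complement)
  then obtain z' where z': "z' \<in> - S" "dist z' z < e" using e(1) closure_approachable by blast
  have "winding_number g z' = 0"
    using simply_connected_imp_winding_number_zero[OF S g(1) _ g(3)] g(2) interior_subset z'(1) by blast
  moreover have "winding_number g z = winding_number g z'"
  proof (rule winding_number_eq[OF g(1,3)])
    show "z \<in> ball z e" "z' \<in> ball z e" using e z' by (auto simp: dist_commute)
    show "connected (ball z e)" by simp
    show "ball z e \<inter> path_image g = {}" using e(2) by blast
  qed
  ultimately show "winding_number g z = 0" by simp
qed

text \<open>
  The principal branch of the logarithm of \<open>(w - b) / (w - a)\<close> has its cut exactly on the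
  segment from \<^term>\<open>a\<close> to \<^term>\<open>b\<close>.
\<close>
lemma ratio_nonpos_imp_in_segment:
  fixes a b w :: complex
  assumes "w \<noteq> a" "(w - b) / (w - a) \<in> \<real>\<^sub>\<le>\<^sub>0"
  shows "w \<in> closed_segment a b"
proof -
  obtain r where r: "(w - b) / (w - a) = - of_real r" "0 \<le> r"
    using assms(2) by (metis nonpos_Reals_cases of_real_minus neg_0_le_iff_le minus_minus)
  have "w - b = - of_real r * (w - a)" using r assms(1) by (simp add: field_simps)
  hence eq: "w * (1 + of_real r) = b + of_real r * a" by (simp add: algebra_simps)
  define u where "u = 1 / (1 + r)"
  have rp: "0 < 1 + r" using r(2) by simp
  have u: "0 \<le> u" "u \<le> 1" unfolding u_def using rp r(2) by simp_all
  have u3: "(1 + r) * u = 1" using rp by (simp add: u_def)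
  have u4: "u * r = 1 - u" using u3 by (simp add: algebra_simps)
  have "(1 + of_real r) * of_real u = (1 :: complex)"
    using arg_cong[OF u3, of complex_of_real] by simp
  hence "w = (w * (1 + of_real r)) * of_real u" by (simp add: mult.assoc)
  also have "\<dots> = of_real (u * r) * a + of_real u * b" unfolding eq by (simp add: algebra_simps)
  also have "\<dots> = (1 - u) *\<^sub>R a + u *\<^sub>R b" unfolding u4 by (simp add: scaleR_conv_of_real)
  finally have "w = (1 - u) *\<^sub>R a + u *\<^sub>R b" .
  thus ?thesis using u by (auto simp: in_segment)
qed

lemma DERIV_Ln_ratio:
  fixes a b w :: complex
  assumes "w \<notin> closed_segment a b"
  shows "((\<lambda>w. Ln ((w - b) / (w - a))) has_field_derivative (1 / (w - b) - 1 / (w - a))) (at w)"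
proof -
  have ne: "w \<noteq> a" "w \<noteq> b" using assms by auto
  have "(w - b) / (w - a) \<notin> \<real>\<^sub>\<le>\<^sub>0" using ratio_nonpos_imp_in_segment assms ne by blast
  hence c: "(Ln has_field_derivative inverse ((w - b) / (w - a))) (at ((w - b) / (w - a)))"
    by (rule has_field_derivative_Ln)
  have d: "((\<lambda>w. (w - b) / (w - a)) has_field_derivative ((w - a) - (w - b)) / ((w - a) * (w - a))) (at w)"
    using ne by (auto intro!: derivative_eq_intros)
  have "inverse (y / x) * ((x - y) / (x * x)) = 1 / y - 1 / x" if "x \<noteq> 0" "y \<noteq> 0" for x y :: complex
    using that by (simp add: field_simps)
  from this[of "w - a" "w - b"] show ?thesis
    using ne by (intro DERIV_cong[OF DERIV_chain2[OF c d]]) simp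
qed

text \<open>
  Crossing the middle of the segment from \<open>m - c\<close> to \<open>m + c\<close> perpendicularly, the
  branch jumps by \<open>2\<pi>\<i>\<close>.
\<close>

definition across :: "real \<Rightarrow> complex" where
  "across t = (\<i> * of_real t - 1) / (\<i> * of_real t + 1)"

lemma across_eq:
  fixes m c :: complex
  assumes "c \<noteq> 0"
  shows "(m + \<i> * c * of_real t - (m + c)) / (m + \<i> * c * of_real t - (m - c)) = across t"
proof -
  have "m + \<i> * c * of_real t - (m + c) = c * (\<i> * of_real t - 1)"
    "m + \<i> * c * of_real t - (m - c) = c * (\<i> * of_real t + 1)" by (simp_all add: algebra_simps)
  thus ?thesis using assms by (simp add: across_def)
qed

lemma across_nz: "\<i> * of_real t + 1 \<noteq> 0" "\<i> * of_real t - 1 \<noteq> 0"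
  by (auto simp: complex_eq_iff)

lemma Ln_across:
  assumes "t \<noteq> 0"
  shows "Ln (across t) = Ln (- across t) + of_real (sgn t) * \<i> * pi"
proof -
  have im: "Im (- across t) = - (2 * t / (1 + t\<^sup>2))" by (simp add: across_def Im_divide)
  have pos: "0 < 1 + t\<^sup>2" by (simp add: add_pos_nonneg)
  have nz: "- across t \<noteq> 0" using across_nz by (simp add: across_def)
  show ?thesis
  proof (cases "0 < t")
    case True
    hence "Im (- across t) < 0" using im pos by simp
    thus ?thesis using Ln_minus[OF nz] True by auto
  next
    case False
    hence "Im (- across t) > 0" using im pos assms by (simp add: divide_neg_pos)
    thus ?thesis using Ln_minus[OF nz] False assms by auto
  qed
qed

lemma isCont_Ln_minus_across: "isCont (\<lambda>t. Ln (- across t)) 0"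
  unfolding across_def by (intro continuous_intros) (auto simp: across_nz)

lemma Ln_minus_across_0: "Ln (- across 0) = 0"
  by (simp add: across_def)

context T_mesh_geometry
begin

lemma simply_connected_cpx_dom: "simply_connected (cpx ` \<Omega>)"
  using meshD(6) homeomorphic_simply_connected homeomorphic_cpx by blast

lemma interior_cpx_dom: "interior (cpx ` \<Omega>) = cpx ` interior \<Omega>"
  by (rule interior_bijective_linear_image[OF linear_cpx bij_cpx])

lemma connected_cpx_interior: "connected (cpx ` interior \<Omega>)"
  using meshD(7) homeomorphic_connectedness homeomorphic_cpx by blast

lemma simply_connected_cpx_interior: "simply_connected (cpx ` interior \<Omega>)"
  using simply_connected_interior[OF simply_connected_cpx_dom] connected_cpx_interior interior_cpx_dom by simp

lemma open_cpx_interior: "open (cpx ` interior \<Omega>)"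
  using interior_cpx_dom by (metis open_interior)

lemma cpx_edge:
  assumes "straight e"
  shows "closed_segment (cpx (lower_end e)) (cpx (upper_end e)) = cpx ` e"
proof -
  have "e = closed_segment (lower_end e) (upper_end e)" using assms
    unfolding lower_end_def upper_end_def by (metis closed_segment_eq_axis_segment straight_def)
  thus ?thesis using closed_segment_linear_image[OF linear_cpx] by metis
qed

lemma near_edge_in_cell:
  assumes e: "e \<in> edges T" and f: "side T s e f" and x: "lo e < x" "x < hi e"
  shows "\<exists>\<delta>>0. \<forall>t. 0 < t \<longrightarrow> t < \<delta> \<longrightarrow> point_at (dir e) x (lev e + sg s * t) \<in> interior f"
proof (intro exI conjI allI impI)
  have rf: "rectangle f" using sideD(1)[OF f] rectangle_cell by auto
  let ?c = "\<not> dir e"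
  show "0 < rhi f ?c - rlo f ?c" using rectangle_data(1)[OF rf, of ?c] by simp
  fix t assume "0 < t" "t < rhi f ?c - rlo f ?c"
  thus "point_at (dir e) x (lev e + sg s * t) \<in> interior f"
    unfolding rectangle_data(3)[OF rf] all_bool_split[where c="dir e"] using x sideD(2,3)[OF f] f
    by (cases s) (auto simp: sg_def sideD(4,5))
qed

text \<open>
  Around a boundary vertex the domain does not consist of two opposite quadrants: the branch of
  the logarithm of \<open>(w - z\<^sub>2) / (w - z\<^sub>4)\<close>, with \<open>z\<^sub>2\<close> and \<open>z\<^sub>4\<close> in the other two
  quadrants, would have different limits from the two sides, but it extends continuously
  to the simply connected domain.
\<close>

lemma no_pinch:
  assumes g: "isolating v r" and f: "f \<in> cells T" "quadrant v r \<sigma> \<subseteq> interior f"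
    and f': "f' \<in> cells T" "quadrant v r (\<lambda>b. \<not> \<sigma> b) \<subseteq> interior f'"
    and \<tau>: "\<tau> = \<sigma>(True := \<not> \<sigma> True)"
    and no1: "\<And>h. h \<in> cells T \<Longrightarrow> \<not> quadrant v r \<tau> \<subseteq> interior h"
    and no2: "\<And>h. h \<in> cells T \<Longrightarrow> \<not> quadrant v r (\<lambda>b. \<not> \<tau> b) \<subseteq> interior h"
  shows False
proof -
  have rp: "0 < r" using g isolating_pos by auto
  define \<epsilon> where "\<epsilon> = r / 2"
  have \<epsilon>: "0 < \<epsilon>" "\<epsilon> < r" using rp by (auto simp: \<epsilon>_def)
  define dirc where "dirc \<rho> = Complex (sg (\<rho> True)) (sg (\<rho> False))" for \<rho> :: "bool \<Rightarrow> bool"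
  have cq: "cpx (diagonal_point v t \<rho>) = cpx v + of_real t * dirc \<rho>" for t \<rho>
    by (simp add: cpx_def diagonal_point_def dirc_def complex_eq_iff)
  have sgn_neg: "sg (\<not> x) = - sg x" for x by (simp add: sg_def)
  have dneg: "dirc (\<lambda>b. \<not> \<rho> b) = - dirc \<rho>" for \<rho> by (simp add: dirc_def sgn_neg complex_eq_iff)
  define c where "c = of_real \<epsilon> * dirc \<tau>"
  have c0: "c \<noteq> 0" using \<epsilon> by (auto simp: c_def dirc_def complex_eq_iff sg_def)
  have out: "q \<notin> \<Omega>" if "q \<in> quadrant v r \<tau> \<or> q \<in> quadrant v r (\<lambda>b. \<not> \<tau> b)" for q
  proof
    assume "q \<in> \<Omega>"
    then obtain h where h: "h \<in> cells T" "q \<in> h" by (auto simp: dom_of_def)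
    show False using that quadrant_cell_cases[OF g h(1)] no1[OF h(1)] no2[OF h(1)] h(2) by blast
  qed
  have vn: "v \<notin> interior \<Omega>" using quadrant_cell_exists_interior[OF g, of \<tau>] no1 by blast
  define z2 where "z2 = cpx v + c"
  define z4 where "z4 = cpx v - c"
  \<comment> \<open>the segment from \<open>z\<^sub>4\<close> to \<open>z\<^sub>2\<close> meets the domain only in \<open>v\<close>\<close>
  have seg_out: "cpx v + of_real x * c \<notin> cpx ` \<Omega>" if x: "x \<noteq> 0" "\<bar>x\<bar> \<le> 1" for x
  proof (cases "0 < x")
    case True
    have "\<epsilon> * x \<le> \<epsilon>" using mult_left_le[of x \<epsilon>] x \<epsilon> True by auto
    hence "\<epsilon> * x < r" using \<epsilon> by linarith
    hence "diagonal_point v (\<epsilon> * x) \<tau> \<in> quadrant v r \<tau>" using \<epsilon> True by (intro diagonal_point_mem_quadrant) auto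
    hence "diagonal_point v (\<epsilon> * x) \<tau> \<notin> \<Omega>" using out by blast
    moreover have "cpx (diagonal_point v (\<epsilon> * x) \<tau>) = cpx v + of_real x * c" unfolding cq c_def by simp
    ultimately show ?thesis by (metis cpx_mem_image)
  next
    case False
    have "\<epsilon> * (-x) \<le> \<epsilon>" using mult_left_le[of "-x" \<epsilon>] x \<epsilon> False by auto
    hence "\<epsilon> * (-x) < r" using \<epsilon> by linarith
    moreover have "0 < \<epsilon> * (-x)" using x \<epsilon> False by (simp add: mult_pos_neg)
    ultimately have "diagonal_point v (\<epsilon> * (-x)) (\<lambda>b. \<not> \<tau> b) \<in> quadrant v r (\<lambda>b. \<not> \<tau> b)" using \<epsilon> by (intro diagonal_point_mem_quadrant) auto
    hence "diagonal_point v (\<epsilon> * (-x)) (\<lambda>b. \<not> \<tau> b) \<notin> \<Omega>" using out by blast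
    moreover have "cpx (diagonal_point v (\<epsilon> * (-x)) (\<lambda>b. \<not> \<tau> b)) = cpx v + of_real x * c" unfolding cq dneg c_def by simp
    ultimately show ?thesis by (metis cpx_mem_image)
  qed
  define S where "S = cpx ` \<Omega>"
  define S0 where "S0 = cpx ` interior \<Omega>"
  have S0S: "S0 \<subseteq> S" using interior_subset by (auto simp: S_def S0_def)
  have z: "z2 \<notin> S" "z4 \<notin> S" using seg_out[of 1] seg_out[of "-1"] by (auto simp: S_def z2_def z4_def)
  define R where "R w = (w - z2) / (w - z4)" for w
  have R0: "R w \<noteq> 0" if "w \<in> S" for w using z that by (auto simp: R_def)
  have contR: "continuous_on S R" unfolding R_def using z by (intro continuous_intros) auto
  have locS: "locally path_connected S"
  proof -
    have "S = \<Union> ((`) cpx ` cells T)" by (auto simp: S_def dom_of_def)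
    moreover have "ANR (\<Union> ((`) cpx ` cells T))"
    proof (rule ANR_finite_Union_convex_closed)
      fix C assume "C \<in> (`) cpx ` cells T"
      then obtain h where h: "C = cpx ` h" "rectangle h" using rectangle_cell by auto
      have "compact C" unfolding h(1) using rectangle_data(6)[OF h(2)]
        by (intro compact_continuous_image linear_continuous_on[OF linear_conv_bounded_linear[THEN iffD1, OF linear_cpx]])
      thus "closed C" by (rule compact_imp_closed)
      show "convex C" unfolding h(1) using rectangle_data(5)[OF h(2)] convex_linear_image[OF linear_cpx] by blast
    qed (use finite_cells in auto)
    ultimately show ?thesis using ANR_imp_locally_path_connected by metis
  qed
  obtain L where L: "continuous_on S L" "\<And>w. w \<in> S \<Longrightarrow> R w = exp (L w)"
    using continuous_logarithm_on_simply_connected[OF contR _ locS R0] simply_connected_cpx_dom by (auto simp: S_def)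
  have Rn: "R w \<notin> \<real>\<^sub>\<le>\<^sub>0" if w: "w \<in> S0" for w
  proof
    assume "R w \<in> \<real>\<^sub>\<le>\<^sub>0"
    hence "w \<in> closed_segment z4 z2" using ratio_nonpos_imp_in_segment[of w z4 z2] w S0S z by (auto simp: R_def)
    then obtain u where u: "0 \<le> u" "u \<le> 1" "w = (1 - u) *\<^sub>R z4 + u *\<^sub>R z2" by (auto simp: in_segment)
    have w': "w = cpx v + of_real (2 * u - 1) * c"
      using u(3) by (simp add: z2_def z4_def scaleR_conv_of_real algebra_simps)
    have "w \<in> cpx ` \<Omega>" using w S0S by (auto simp: S_def)
    hence wS: "cpx v + of_real (2 * u - 1) * c \<in> cpx ` \<Omega>" using w' by simp
    have "2 * u - 1 = 0"
    proof (rule ccontr)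
      assume ne: "2 * u - 1 \<noteq> 0"
      have "\<bar>2 * u - 1\<bar> \<le> 1" using u(1,2) by linarith
      from seg_out[OF ne this] wS show False by blast
    qed
    hence "w = cpx v" unfolding w' by simp
    thus False using w vn by (auto simp: S0_def)
  qed
  define D where "D w = L w - Ln (R w)" for w
  have contD: "continuous_on S0 D" unfolding D_def
    by (intro continuous_on_diff continuous_on_Ln' continuous_on_subset[OF L(1) S0S]
        continuous_on_subset[OF contR S0S] Rn)
  have expD: "exp (D w) = 1" if "w \<in> S0" for w
    using L(2)[of w] R0[of w] that S0S by (auto simp: D_def exp_diff)
  have "D constant_on S0"
  proof (rule continuous_discrete_range_constant[OF _ contD])
    show "connected S0" using connected_cpx_interior by (simp add: S0_def)
    fix x assume x: "x \<in> S0"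
    show "\<exists>e>0. \<forall>y. y \<in> S0 \<and> D y \<noteq> D x \<longrightarrow> e \<le> norm (D y - D x)"
    proof (intro exI conjI allI impI)
      show "(2 * pi :: real) > 0" by simp
      fix y assume y: "y \<in> S0 \<and> D y \<noteq> D x"
      have "exp (D y - D x) = 1" using expD x y by (simp add: exp_diff)
      then obtain n :: int where "Re (D y - D x) = 0" "Im (D y - D x) = of_int (2 * n) * pi"
        unfolding exp_eq_1 by blast
      hence n: "D y - D x = of_int (2 * n) * pi * \<i>" by (simp add: complex_eq_iff)
      have "n \<noteq> 0" using n y by auto
      hence "1 \<le> \<bar>real_of_int n\<bar>" by linarith
      hence "2 * pi * 1 \<le> 2 * pi * \<bar>real_of_int n\<bar>" by (intro mult_left_mono) auto
      thus "2 * pi \<le> norm (D y - D x)" unfolding n by (simp add: norm_mult abs_mult mult_ac)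
    qed
  qed
  then obtain k where k: "\<And>w. w \<in> S0 \<Longrightarrow> D w = k" by (auto simp: constant_on_def)
  define W where "W t = cpx v + \<i> * c * of_real t" for t :: real
  have "f \<subseteq> \<Omega>" "f' \<subseteq> \<Omega>" using f f' by (auto simp: dom_of_def)
  hence int: "interior f \<subseteq> interior \<Omega>" "interior f' \<subseteq> interior \<Omega>" by (simp_all add: interior_mono)
  have W: "W t \<in> S0" if t: "t \<noteq> 0" "\<bar>t\<bar> < 1" for t
  proof -
    have qin: "cpx (diagonal_point v x \<rho>) \<in> S0" if "\<rho> = \<sigma> \<or> \<rho> = (\<lambda>b. \<not> \<sigma> b)" "0 < x" "x < r" for x \<rho>
      using diagonal_point_mem_quadrant[OF that(2,3), of v \<rho>] that(1) f(2) f'(2) int by (auto simp: S0_def)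
    have "\<epsilon> * \<bar>t\<bar> \<le> \<epsilon>" using mult_left_le[of "\<bar>t\<bar>" \<epsilon>] t \<epsilon> by simp
    hence et: "0 < \<epsilon> * \<bar>t\<bar>" "\<epsilon> * \<bar>t\<bar> < r" using \<epsilon> t by (simp, linarith)
    \<comment> \<open>Multiplication by \<open>\<i>\<close> turns the diagonal of the quadrant \<open>\<tau>\<close> into the diagonal of
      \<open>\<sigma>\<close> or of the opposite quadrant, according to the signs.\<close>
    define \<rho> where "\<rho> = (if (0 < t) = (\<sigma> True \<noteq> \<sigma> False) then \<sigma> else (\<lambda>b. \<not> \<sigma> b))"
    have "W t = cpx (diagonal_point v (\<epsilon> * \<bar>t\<bar>) \<rho>)"
      unfolding W_def cq c_def dirc_def \<rho>_def \<tau> using t(1)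
      by (auto simp: complex_eq_iff sg_def)
    thus ?thesis using qin[OF _ et, of \<rho>] by (auto simp: \<rho>_def)
  qed
  have vS: "cpx v \<in> S"
  proof -
    have "f \<inter> open_square v r \<noteq> {}" using f(2) interior_subset[of f] quadrant_subset_open_square[of v r \<sigma>] quadrant_nonempty[OF rp, of v \<sigma>] by blast
    hence "v \<in> f" using g f(1) unfolding isolating_def by blast
    thus ?thesis using f(1) by (auto simp: S_def dom_of_def)
  qed
  have RW: "R (W t) = across t" for t
    unfolding R_def W_def z2_def z4_def by (rule across_eq[OF c0])
  have val: "L (W t) - Ln (- across t) = k + of_real (sgn t) * \<i> * pi" if t: "t \<noteq> 0" "\<bar>t\<bar> < 1" for t
    using k[OF W[OF t]] Ln_across[OF t(1)] by (simp add: D_def RW diff_eq_eq)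
  have lim: "((\<lambda>t. L (W t) - Ln (- across t)) \<longlongrightarrow> L (cpx v) - Ln (- across 0)) (at 0 within {-1<..<1})"
  proof (intro tendsto_diff)
    have "continuous_on {-1<..<1} (\<lambda>t. L (W t))"
    proof (rule continuous_on_compose2[OF L(1)])
      show "continuous_on {-1<..<1} W" unfolding W_def by (intro continuous_intros)
      have "W t \<in> S" if "-1 < t" "t < 1" for t
        using W[of t] that vS S0S by (cases "t = 0") (auto simp: W_def)
      thus "W ` {-1<..<1} \<subseteq> S" by auto
    qed
    moreover have "W 0 = cpx v" by (simp add: W_def)
    ultimately show "((\<lambda>t. L (W t)) \<longlongrightarrow> L (cpx v)) (at 0 within {-1<..<1})"
      by (metis continuous_on_def greaterThanLessThan_iff neg_less_0_iff_less zero_less_one)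
    show "((\<lambda>t. Ln (- across t)) \<longlongrightarrow> Ln (- across 0)) (at 0 within {-1<..<1})"
      using isCont_Ln_minus_across by (auto simp: isCont_def intro: tendsto_within_subset[of _ _ _ UNIV])
  qed
  have lim': "((\<lambda>t. L (W t) - Ln (- across t)) \<longlongrightarrow> L (cpx v)) (at 0)"
    using lim by (simp add: Ln_minus_across_0 at_within_open[of 0 "{-1<..<1}"])
  have "L (cpx v) = k + \<i> * pi"
  proof (rule tendsto_unique[of "at_right (0::real)"])
    show "((\<lambda>t. L (W t) - Ln (- across t)) \<longlongrightarrow> L (cpx v)) (at_right 0)"
      using lim' by (rule tendsto_within_subset) auto
    have "\<forall>\<^sub>F t in at_right 0. L (W t) - Ln (- across t) = k + \<i> * pi"
      unfolding eventually_at_right_field using val by (intro exI[of _ 1]) auto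
    thus "((\<lambda>t. L (W t) - Ln (- across t)) \<longlongrightarrow> k + \<i> * pi) (at_right 0)" by (rule tendsto_eventually)
  qed simp
  moreover have "L (cpx v) = k - \<i> * pi"
  proof (rule tendsto_unique[of "at_left (0::real)"])
    show "((\<lambda>t. L (W t) - Ln (- across t)) \<longlongrightarrow> L (cpx v)) (at_left 0)"
      using lim' by (rule tendsto_within_subset) auto
    have "\<forall>\<^sub>F t in at_left 0. L (W t) - Ln (- across t) = k - \<i> * pi"
      unfolding eventually_at_left_field using val by (intro exI[of _ "-1"]) auto
    thus "((\<lambda>t. L (W t) - Ln (- across t)) \<longlongrightarrow> k - \<i> * pi) (at_left 0)" by (rule tendsto_eventually)
  qed simp
  ultimately show False by simp
qed

text \<open>
  Two cells at a point are joined by a chain of neighbouring quadrants inside the domain; where the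
  cells of neighbouring quadrants differ, an interior edge separates them.
\<close>
lemma cells_agree_at_point:
  assumes p: "f \<in> cells T" "g \<in> cells T" "p \<in> f" "p \<in> g"
    and K: "\<And>e f g. e \<in> interior_edges T \<Longrightarrow> p \<in> e \<Longrightarrow> side T True e f \<Longrightarrow> side T False e g \<Longrightarrow> K f = K g"
  shows "K f = K g"
proof -
  obtain r where gd: "isolating p r" using isolating_exists by blast
  have rp: "0 < r" using gd isolating_pos by auto
  have adj: "K a = K b" if a: "a \<in> cells T" "quadrant p r \<sigma> \<subseteq> interior a" and b: "b \<in> cells T" "quadrant p r \<tau> \<subseteq> interior b"
    and s: "\<tau> c = \<sigma> c" "\<tau> (\<not> c) = (\<not> \<sigma> (\<not> c))" for a b \<sigma> \<tau> c
  proof (cases "a = b")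
    case False
    have "quadrant p r \<sigma> \<subseteq> a" "quadrant p r \<tau> \<subseteq> b" using a b interior_subset by blast+
    from quadrants_adjacent[OF gd a(1) b(1) False this s]
    obtain e where e: "e \<in> edges T" "p \<in> e" "side T (\<sigma> (\<not> c)) e a" "side T (\<not> \<sigma> (\<not> c)) e b" by blast
    show ?thesis
    proof (cases "\<sigma> (\<not> c)")
      case True
      hence s2: "side T True e a" "side T False e b" using e by auto
      show ?thesis using K[OF interior_edgeI[OF e(1) s2] e(2) s2] .
    next
      case False
      hence s2: "side T True e b" "side T False e a" using e by auto
      show ?thesis using K[OF interior_edgeI[OF e(1) s2] e(2) s2] by simp
    qed
  qed simp
  obtain \<sigma> where \<sigma>: "quadrant p r \<sigma> \<subseteq> interior f" using cell_contains_quadrant[OF gd p(1,3)] by blast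
  obtain \<tau> where \<tau>: "quadrant p r \<tau> \<subseteq> interior g" using cell_contains_quadrant[OF gd p(2,4)] by blast
  consider "\<tau> = \<sigma>" | c where "\<tau> c = \<sigma> c" "\<tau> (\<not> c) = (\<not> \<sigma> (\<not> c))" | "\<tau> = (\<lambda>b. \<not> \<sigma> b)"
  proof (cases "\<tau> True = \<sigma> True"; cases "\<tau> False = \<sigma> False")
    assume "\<tau> True = \<sigma> True" "\<tau> False = \<sigma> False"
    hence "\<tau> = \<sigma>" by (auto simp: fun_eq_iff all_bool_eq)
    thus thesis using that(1) by blast
  next
    assume "\<tau> True = \<sigma> True" "\<tau> False \<noteq> \<sigma> False"
    thus thesis using that(2)[of True] by auto
  next
    assume "\<tau> True \<noteq> \<sigma> True" "\<tau> False = \<sigma> False"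
    thus thesis using that(2)[of False] by auto
  next
    assume "\<tau> True \<noteq> \<sigma> True" "\<tau> False \<noteq> \<sigma> False"
    hence "\<tau> = (\<lambda>b. \<not> \<sigma> b)" by (auto simp: fun_eq_iff all_bool_eq)
    thus thesis using that(3) by blast
  qed
  thus ?thesis
  proof cases
    case 1
    have "f = g" using quadrant_cell_unique[OF rp p(1,2) \<sigma>] \<tau> 1 interior_subset[of g] by blast
    thus ?thesis by simp
  next
    case (2 c)
    show ?thesis using adj[OF p(1) \<sigma> p(2) \<tau> 2] .
  next
    case 3
    define \<rho> where "\<rho> = \<sigma>(True := \<not> \<sigma> True)"
    have "\<exists>h\<in>cells T. quadrant p r \<rho> \<subseteq> interior h \<or> quadrant p r (\<lambda>b. \<not> \<rho> b) \<subseteq> interior h"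
    proof (rule ccontr)
      assume no: "\<not> ?thesis"
      have q: "quadrant p r (\<lambda>b. \<not> \<sigma> b) \<subseteq> interior g" using \<tau> 3 by simp
      show False by (rule no_pinch[OF gd p(1) \<sigma> p(2) q \<rho>_def]) (use no in blast)+
    qed
    then obtain h where h: "h \<in> cells T" "quadrant p r \<rho> \<subseteq> interior h \<or> quadrant p r (\<lambda>b. \<not> \<rho> b) \<subseteq> interior h" by blast
    from h(2) show ?thesis
    proof
      assume q: "quadrant p r \<rho> \<subseteq> interior h"
      have "K f = K h" by (rule adj[OF p(1) \<sigma> h(1) q, of False]) (auto simp: \<rho>_def)
      moreover have "K h = K g" by (rule adj[OF h(1) q p(2) \<tau>, of True]) (auto simp: \<rho>_def 3)
      ultimately show ?thesis by simp
    next
      assume q: "quadrant p r (\<lambda>b. \<not> \<rho> b) \<subseteq> interior h"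
      have "K f = K h" by (rule adj[OF p(1) \<sigma> h(1) q, of True]) (auto simp: \<rho>_def)
      moreover have "K h = K g" by (rule adj[OF h(1) q p(2) \<tau>, of False]) (auto simp: \<rho>_def 3)
      ultimately show ?thesis by simp
    qed
  qed
qed

lemma interior_cell_nonempty: "f \<in> cells T \<Longrightarrow> interior f \<noteq> {}"
proof -
  assume "f \<in> cells T"
  hence rf: "rectangle f" using rectangle_cell by auto
  have "point_at True ((rlo f True + rhi f True)/2) ((rlo f False + rhi f False)/2) \<in> interior f"
    using rectangle_data(1)[OF rf, of True] rectangle_data(1)[OF rf, of False]
    by (simp add: rectangle_data(3)[OF rf] all_bool_eq)
  thus ?thesis by blast
qed

text \<open>
  A function on the cells that does not change across interior edges is locally constant on the
  connected interior of the domain.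
\<close>
lemma cells_agree:
  assumes fg: "f \<in> cells T" "g \<in> cells T"
    and K: "\<And>e f g. e \<in> interior_edges T \<Longrightarrow> side T True e f \<Longrightarrow> side T False e g \<Longrightarrow> K f = K g"
  shows "K f = K g"
proof -
  define \<phi> where "\<phi> p = K (SOME h. h \<in> cells T \<and> p \<in> h)" for p
  have \<phi>: "\<phi> p = K h" if h: "h \<in> cells T" "p \<in> h" for p h
  proof -
    have "(SOME h. h \<in> cells T \<and> p \<in> h) \<in> cells T \<and> p \<in> (SOME h. h \<in> cells T \<and> p \<in> h)"
      by (rule someI[of _ h]) (use h in simp)
    thus ?thesis unfolding \<phi>_def using cells_agree_at_point[of _ h p K] K h by blast
  qed
  obtain p where p: "p \<in> interior f" using interior_cell_nonempty fg by blast
  obtain q where q: "q \<in> interior g" using interior_cell_nonempty fg by blast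
  have sub: "interior h \<subseteq> interior \<Omega>" if "h \<in> cells T" for h
    using that by (intro interior_mono) (auto simp: dom_of_def)
  have "\<phi> p = \<phi> q"
  proof (rule connected_local_const[OF meshD(7)])
    show "p \<in> interior \<Omega>" "q \<in> interior \<Omega>" using p q sub fg by blast+
    show "\<forall>a\<in>interior \<Omega>. \<forall>\<^sub>F b in at a within interior \<Omega>. \<phi> a = \<phi> b"
    proof
      fix a assume "a \<in> interior \<Omega>"
      obtain r where g: "isolating a r" using isolating_exists by blast
      have "\<phi> a = \<phi> b" if b: "b \<in> interior \<Omega>" "b \<in> open_square a r" for b
      proof -
        have "b \<in> \<Omega>" using b(1) interior_subset by blast
        then obtain h where h: "h \<in> cells T" "b \<in> h" by (auto simp: dom_of_def)
        hence "a \<in> h" using g b(2) unfolding isolating_def by blast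
        thus ?thesis using \<phi> h by simp
      qed
      thus "\<forall>\<^sub>F b in at a within interior \<Omega>. \<phi> a = \<phi> b"
        unfolding eventually_at_topological using open_open_square[of a r] mem_open_square_self[OF isolating_pos[OF g]] by blast
    qed
  qed
  moreover have "\<phi> p = K f" "\<phi> q = K g" using \<phi> fg p q interior_subset by blast+
  ultimately show ?thesis by simp
qed

text \<open>
  The potential is the double layer potential of the jumps, corrected at the boundary vertices.
  The jumps cancel at an interior vertex, so no logarithmic singularity remains there; at a
  boundary vertex a branch of the logarithm exists on the simply connected interior.
\<close>

lemma potential_exists:
  fixes j :: "point set \<Rightarrow> real"
  assumes bal: "\<And>v. v \<in> interior_vertices T \<Longrightarrow>
    (\<Sum>e\<in>interior_edges T. sg (dir e) * j e * (of_bool (v = upper_end e) - of_bool (v = lower_end e))) = 0"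
  shows "\<exists>u. \<forall>e\<in>interior_edges T. \<forall>f g. side T True e f \<longrightarrow> side T False e g \<longrightarrow> u f - u g = j e"
proof -
  let ?I = "interior_edges T" and ?B = "vertices T - interior \<Omega>"
  define S0 where "S0 = cpx ` interior \<Omega>"
  define a where "a e = sg (dir e) * j e" for e
  \<comment> \<open>the coefficient with which \<open>1 / (w - v)\<close> occurs in the derivative of the sum over the edges\<close>
  define \<kappa> where "\<kappa> v = (\<Sum>e\<in>?I. a e * (of_bool (v = upper_end e) - of_bool (v = lower_end e)))" for v
  have finI: "finite ?I" using finite_edges interior_edges_subset finite_subset by blast
  have "\<exists>h. \<forall>w\<in>S0. (h has_field_derivative 1 / (w - cpx v)) (at w)" if v: "v \<in> ?B" for v
  proof -
    have "(\<lambda>w. 1 / (w - cpx v)) holomorphic_on S0"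
      using v by (intro holomorphic_intros) (auto simp: S0_def)
    thus ?thesis using simply_connected_eq_global_primitive[OF open_cpx_interior] simply_connected_cpx_interior
      unfolding S0_def by blast
  qed
  then obtain h where h: "\<And>v w. v \<in> ?B \<Longrightarrow> w \<in> S0 \<Longrightarrow> (h v has_field_derivative 1 / (w - cpx v)) (at w)"
    by metis
  define lg where "lg e w = Ln ((w - cpx (upper_end e)) / (w - cpx (lower_end e)))" for e w
  have lg: "(lg e has_field_derivative (1 / (cpx p - cpx (upper_end e)) - 1 / (cpx p - cpx (lower_end e)))) (at (cpx p))"
    if "e \<in> ?I" "p \<notin> e" for e p
    unfolding lg_def using that interior_edges_subset straight_edge
    by (intro DERIV_Ln_ratio) (auto simp: cpx_edge)
  define F where "F w = (\<Sum>e\<in>?I. of_real (a e) * lg e w) - (\<Sum>v\<in>?B. of_real (\<kappa> v) * h v w)" for w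
  have F0: "(F has_field_derivative 0) (at (cpx p))" if f: "f \<in> cells T" "p \<in> interior f" for f p
  proof -
    have pn: "p \<notin> e" if "e \<in> edges T" for e using interior_cell_not_edge f that by blast
    have p0: "cpx p \<in> S0" using f interior_mono[of f \<Omega>] by (auto simp: S0_def dom_of_def)
    have "(F has_field_derivative
        (\<Sum>e\<in>?I. of_real (a e) * (1 / (cpx p - cpx (upper_end e)) - 1 / (cpx p - cpx (lower_end e))))
        - (\<Sum>v\<in>?B. of_real (\<kappa> v) * (1 / (cpx p - cpx v)))) (at (cpx p))"
      unfolding F_def using pn interior_edges_subset
      by (intro DERIV_diff DERIV_sum DERIV_cmult lg h p0) auto
    moreover have "(\<Sum>e\<in>?I. of_real (a e) * (1 / (cpx p - cpx (upper_end e)) - 1 / (cpx p - cpx (lower_end e)))) =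
        (\<Sum>v\<in>?B. of_real (\<kappa> v) * (1 / (cpx p - cpx v)))"
    proof -
      have "of_real (a e) * (1 / (cpx p - cpx (upper_end e)) - 1 / (cpx p - cpx (lower_end e))) =
          (\<Sum>v\<in>vertices T. of_real (a e * (of_bool (v = upper_end e) - of_bool (v = lower_end e))) * (1 / (cpx p - cpx v)))"
        if e: "e \<in> ?I" for e
      proof -
        have ee: "e \<in> edges T" using e interior_edges_subset by auto
        have v: "upper_end e \<in> vertices T" "lower_end e \<in> vertices T"
          using endpoint_vertex[OF ee] endpoints_straight[OF straight_edge[OF ee]] by auto
        have ofb: "complex_of_real (of_bool P) = of_bool P" for P by (cases P) auto
        have pick: "(\<Sum>v\<in>vertices T. of_bool (v = x) * (1 / (cpx p - cpx v))) = 1 / (cpx p - cpx x)"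
          if "x \<in> vertices T" for x
        proof -
          have "(\<Sum>v\<in>vertices T. of_bool (v = x) * (1 / (cpx p - cpx v))) =
              (\<Sum>v\<in>{x}. of_bool (v = x) * (1 / (cpx p - cpx v)))"
            using that finite_vertices by (intro sum.mono_neutral_right) auto
          thus ?thesis by simp
        qed
        have "(\<Sum>v\<in>vertices T. of_real (a e * (of_bool (v = upper_end e) - of_bool (v = lower_end e))) * (1 / (cpx p - cpx v))) =
            of_real (a e) * ((\<Sum>v\<in>vertices T. of_bool (v = upper_end e) * (1 / (cpx p - cpx v))) -
              (\<Sum>v\<in>vertices T. of_bool (v = lower_end e) * (1 / (cpx p - cpx v))))"
          by (simp add: ofb sum_subtractf[symmetric] sum_distrib_left left_diff_distrib right_diff_distrib diff_divide_distrib mult.assoc)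
        thus ?thesis using pick v by simp
      qed
      hence "(\<Sum>e\<in>?I. of_real (a e) * (1 / (cpx p - cpx (upper_end e)) - 1 / (cpx p - cpx (lower_end e)))) =
         (\<Sum>e\<in>?I. \<Sum>v\<in>vertices T. of_real (a e * (of_bool (v = upper_end e) - of_bool (v = lower_end e))) * (1 / (cpx p - cpx v)))"
        by (intro sum.cong) auto
      also have "\<dots> = (\<Sum>v\<in>vertices T. of_real (\<kappa> v) * (1 / (cpx p - cpx v)))"
        by (subst sum.swap) (simp add: \<kappa>_def sum_divide_distrib)
      also have "\<dots> = (\<Sum>v\<in>?B. of_real (\<kappa> v) * (1 / (cpx p - cpx v)))"
        using bal finite_vertices
        by (intro sum.mono_neutral_right) (auto simp: \<kappa>_def a_def interior_vertices_def)
      finally show ?thesis .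
    qed
    ultimately show ?thesis by simp
  qed
  have "\<exists>c. \<forall>p\<in>interior f. F (cpx p) = c" if f: "f \<in> cells T" for f
  proof -
    have "convex (cpx ` interior f)"
      using rectangle_data(5)[OF rectangle_cell[OF f]] convex_linear_image[OF linear_cpx] convex_interior by blast
    hence "\<exists>c. \<forall>x\<in>cpx ` interior f. F x = c"
      using F0[OF f] by (intro has_field_derivative_zero_constant) (auto intro: has_field_derivative_at_within)
    thus ?thesis by auto
  qed
  then obtain c where c: "\<And>f p. f \<in> cells T \<Longrightarrow> p \<in> interior f \<Longrightarrow> F (cpx p) = c f" by metis
  \<comment> \<open>Compare the limits at the midpoint of the edge along the perpendicular from both sides.  Only the
    term of the edge itself is discontinuous there.\<close>
  have jump: "c f - c g = of_real (j e) * (2 * pi * \<i>)"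
    if e: "e \<in> ?I" and f: "side T True e f" and g: "side T False e g" for e f g
  proof -
    have ee: "e \<in> edges T" using e interior_edges_subset by auto
    have se: "straight e" using straight_edge[OF ee] .
    define mid where "mid = (lo e + hi e) / 2"
    define r where "r = (hi e - lo e) / 2"
    define m where "m = point_at (dir e) mid (lev e)"
    have r: "0 < r" and mid: "lo e < mid" "mid < hi e" using straight_lt[OF se] by (auto simp: r_def mid_def)
    have mo: "m \<in> open_edge e" using mid by (simp add: m_def open_edge_def)
    define k where "k = cpx (upper_end e) - cpx m"
    have k: "cpx (upper_end e) = cpx m + k" "cpx (lower_end e) = cpx m - k"
      by (auto simp: k_def upper_end_def lower_end_def m_def mid_def cpx_def point_at_def complex_eq_iff field_simps)
    have k0: "k \<noteq> 0" using r by (auto simp: k_def upper_end_def m_def mid_def r_def cpx_def point_at_def complex_eq_iff split: if_splits)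
    \<comment> \<open>Multiplication by \<open>\<i>\<close> turns the direction of a horizontal edge upwards, towards larger
      coordinates, but that of a vertical edge to the left; the sign makes up for this.\<close>
    define s where "s = sg (dir e)"
    have s: "s * s = 1" "s = 1 \<or> s = -1" by (auto simp: s_def sg_def)
    define W where "W t = cpx m + \<i> * k * of_real t" for t :: real
    have W: "W (s * t) = cpx (point_at (dir e) mid (lev e + r * t))" for t
    proof -
      have "t * r + mid * t = t * hi e" by (simp add: r_def mid_def field_simps)
      thus ?thesis unfolding W_def s_def
        by (auto simp: sg_def k_def upper_end_def m_def cpx_def point_at_def complex_eq_iff algebra_simps)
    qed
    define Rest where "Rest w = (\<Sum>e'\<in>?I - {e}. of_real (a e') * lg e' w) - (\<Sum>v\<in>?B. of_real (\<kappa> v) * h v w)" for w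
    have FR: "F w = of_real (a e) * lg e w + Rest w" for w
      unfolding F_def Rest_def using sum.remove[OF finI e, of "\<lambda>e. of_real (a e) * lg e w"] by simp
    have m0: "cpx m \<in> S0" using interior_edgeD(3)[OF e] mo by (auto simp: S0_def)
    have "isCont Rest (cpx m)"
    proof -
      have "isCont (lg e') (cpx m)" if "e' \<in> ?I - {e}" for e'
        using lg[of e' m] open_edge_unique[OF ee _ mo, of e'] that interior_edges_subset DERIV_isCont by blast
      moreover have "isCont (h v) (cpx m)" if "v \<in> ?B" for v using h[OF that m0] DERIV_isCont by blast
      ultimately show ?thesis unfolding Rest_def by (intro continuous_intros) auto
    qed
    moreover have "W 0 = cpx m" by (simp add: W_def)
    ultimately have "isCont Rest (W 0)" by simp
    moreover have "isCont W 0" unfolding W_def by (intro continuous_intros)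
    ultimately have "isCont (\<lambda>t. Rest (W t)) 0" by (rule isCont_o2[rotated])
    define G where "G t = of_real (a e) * Ln (- across t) + Rest (W t)" for t
    have G: "isCont G 0" unfolding G_def
      by (intro isCont_add isCont_mult continuous_const isCont_Ln_minus_across \<open>isCont (\<lambda>t. Rest (W t)) 0\<close>)
    have FG: "F (W t) = G t + of_real (a e * sgn t) * \<i> * pi" if "t \<noteq> 0" for t
      using Ln_across[OF that] across_eq[OF k0, of "cpx m" t] by (simp add: FR G_def lg_def W_def k algebra_simps)
    have limit: "c f' = G 0 + of_real (a e * s * sg x) * \<i> * pi" if f': "side T x e f'" for x f'
    proof -
      obtain \<delta> where \<delta>: "\<delta> > 0" "\<And>t. 0 < t \<Longrightarrow> t < \<delta> \<Longrightarrow> point_at (dir e) mid (lev e + sg x * t) \<in> interior f'"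
        using near_edge_in_cell[OF ee f' mid] by blast
      have ev: "G (s * (sg x * t)) = c f' - of_real (a e * s * sg x) * \<i> * pi" if t: "0 < t" "t < \<delta> / r" for t
      proof -
        have "r * t < \<delta>" "0 < r * t" using t r by (auto simp: field_simps)
        hence "point_at (dir e) mid (lev e + r * (sg x * t)) \<in> interior f'" using \<delta>(2)[of "r * t"] by (simp add: mult_ac)
        hence "F (W (s * (sg x * t))) = c f'" using c[OF sideD(1)[OF f']] W by simp
        moreover have "sgn (s * (sg x * t)) = s * sg x" using s(2) t by (auto simp: sg_def)
        moreover have "s * (sg x * t) \<noteq> 0" using s(2) t by (auto simp: sg_def)
        ultimately show ?thesis using FG[of "s * (sg x * t)"] by (simp add: mult_ac)
      qed
      have "((\<lambda>t. s * (sg x * t)) \<longlongrightarrow> 0) (at_right 0)"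
        by (rule tendsto_eq_intros | simp)+
      hence "((\<lambda>t. G (s * (sg x * t))) \<longlongrightarrow> G 0) (at_right 0)" by (rule isCont_tendsto_compose[OF G])
      moreover have "\<forall>\<^sub>F t in at_right 0. G (s * (sg x * t)) = c f' - of_real (a e * s * sg x) * \<i> * pi"
        unfolding eventually_at_right_field using ev \<delta>(1) r by (intro exI[of _ "\<delta> / r"]) auto
      hence "((\<lambda>t. G (s * (sg x * t))) \<longlongrightarrow> c f' - of_real (a e * s * sg x) * \<i> * pi) (at_right 0)"
        by (rule tendsto_eventually)
      ultimately have "G 0 = c f' - of_real (a e * s * sg x) * \<i> * pi"
        using tendsto_unique[of "at_right (0::real)"] by (metis trivial_limit_at_right_real)
      thus ?thesis by simp
    qed
    have as: "a e * s = j e" using s(2) by (auto simp: a_def s_def)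
    show ?thesis using limit[OF f, unfolded as] limit[OF g, unfolded as] by (simp add: sg_def algebra_simps)
  qed
  show ?thesis
  proof (intro exI ballI allI impI)
    fix e f g assume "e \<in> ?I" "side T True e f" "side T False e g"
    from jump[OF this] have "Im (c f) - Im (c g) = j e * (2 * pi)" by (simp add: complex_eq_iff)
    thus "Im (c f) / (2 * pi) - Im (c g) / (2 * pi) = j e" by (simp add: field_simps)
  qed
qed

end

section \<open>Polynomials of bidegree (d, d)\<close>

definition upoly :: "nat \<Rightarrow> (real \<Rightarrow> real) \<Rightarrow> bool" where
  "upoly d q \<longleftrightarrow> (\<exists>R. degree R \<le> d \<and> (\<forall>x. q x = poly R x))"

lemma upoly_add: "upoly d q \<Longrightarrow> upoly d r \<Longrightarrow> upoly d (\<lambda>x. q x + r x)"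
  unfolding upoly_def by (metis degree_add_le poly_add)

lemma upoly_cmult: "upoly d q \<Longrightarrow> upoly d (\<lambda>x. c * q x)"
  unfolding upoly_def by (metis degree_smult_le order_trans poly_smult)

lemma upoly_diff: "upoly d q \<Longrightarrow> upoly d r \<Longrightarrow> upoly d (\<lambda>x. q x - r x)"
  unfolding upoly_def by (metis degree_diff_le poly_diff)

lemma upoly_zero: "upoly d (\<lambda>x. 0)"
  unfolding upoly_def by (intro exI[of _ 0]) auto

lemma upoly_sum: "(\<And>i. i \<in> I \<Longrightarrow> upoly d (q i)) \<Longrightarrow> upoly d (\<lambda>x. \<Sum>i\<in>I. q i x)"
  by (induction I rule: infinite_finite_induct) (auto intro: upoly_add upoly_zero)

lemma upoly_monom: "k \<le> d \<Longrightarrow> upoly d (\<lambda>x. x ^ k)"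
  unfolding upoly_def by (intro exI[of _ "monom 1 k"]) (auto simp: degree_monom_eq poly_monom)

lemma upoly_power: "upoly d (\<lambda>x. (x - a) ^ d)"
  unfolding upoly_def
  by (intro exI[of _ "[:-a, 1:] ^ d"]) (auto simp: degree_linear_power poly_power)

lemma upoly_coeffs: "upoly d q \<Longrightarrow> \<exists>a. \<forall>x. q x = (\<Sum>k\<le>d. a k * x ^ k)"
proof -
  assume "upoly d q"
  then obtain R where R: "degree R \<le> d" "\<And>x. q x = poly R x" unfolding upoly_def by blast
  have "poly R x = (\<Sum>k\<le>d. coeff R k * x ^ k)" for x
    unfolding poly_altdef using R(1) by (intro sum.mono_neutral_left) (auto simp: coeff_eq_0)
  thus ?thesis using R(2) by (intro exI[of _ "coeff R"]) auto
qed

lemma upoly_eqI: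
  assumes "upoly d q" "upoly d r" "infinite S" "\<And>x. x \<in> S \<Longrightarrow> q x = r x"
  shows "q x = r x"
proof -
  obtain R where R: "\<And>x. q x - r x = poly R x" using upoly_diff[OF assms(1,2)] unfolding upoly_def by blast
  have "poly R x = 0" if "x \<in> S" for x using R[of x] assms(4)[OF that] by simp
  hence "S \<subseteq> {x. poly R x = 0}" by blast
  hence "infinite {x. poly R x = 0}" using assms(3) finite_subset by blast
  hence "R = 0" using poly_roots_finite by blast
  thus ?thesis using R[of x] by simp
qed

definition bipoly :: "nat \<Rightarrow> (point \<Rightarrow> real) \<Rightarrow> bool" where
  "bipoly d F \<longleftrightarrow> (\<exists>c. \<forall>p. F p = (\<Sum>i\<le>d. \<Sum>j\<le>d. c i j * fst p ^ i * snd p ^ j))"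

lemma bidegree_poly_on_iff: "bidegree_poly_on d f s \<longleftrightarrow> (\<exists>F. bipoly d F \<and> (\<forall>p\<in>f. s p = F p))"
proof
  assume "bidegree_poly_on d f s"
  then obtain c where c: "\<forall>(x, y)\<in>f. s (x, y) = (\<Sum>i\<le>d. \<Sum>j\<le>d. c i j * x ^ i * y ^ j)"
    unfolding bidegree_poly_on_def by blast
  thus "\<exists>F. bipoly d F \<and> (\<forall>p\<in>f. s p = F p)" unfolding bipoly_def
    by (intro exI[of _ "\<lambda>p. \<Sum>i\<le>d. \<Sum>j\<le>d. c i j * fst p ^ i * snd p ^ j"]) auto
next
  assume "\<exists>F. bipoly d F \<and> (\<forall>p\<in>f. s p = F p)"
  then obtain F c where "\<forall>p\<in>f. s p = F p" "\<forall>p. F p = (\<Sum>i\<le>d. \<Sum>j\<le>d. c i j * fst p ^ i * snd p ^ j)"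
    unfolding bipoly_def by blast
  thus "bidegree_poly_on d f s" unfolding bidegree_poly_on_def by (intro exI[of _ c]) auto
qed

lemma bipoly_add: "bipoly d F \<Longrightarrow> bipoly d G \<Longrightarrow> bipoly d (\<lambda>p. F p + G p)"
proof -
  assume "bipoly d F" "bipoly d G"
  then obtain c e where "\<forall>p. F p = (\<Sum>i\<le>d. \<Sum>j\<le>d. c i j * fst p ^ i * snd p ^ j)"
    "\<forall>p. G p = (\<Sum>i\<le>d. \<Sum>j\<le>d. e i j * fst p ^ i * snd p ^ j)" unfolding bipoly_def by blast
  thus ?thesis unfolding bipoly_def
    by (intro exI[of _ "\<lambda>i j. c i j + e i j"]) (auto simp: distrib_right sum.distrib)
qed

lemma bipoly_cmult: "bipoly d F \<Longrightarrow> bipoly d (\<lambda>p. a * F p)"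
proof -
  assume "bipoly d F"
  then obtain c where "\<forall>p. F p = (\<Sum>i\<le>d. \<Sum>j\<le>d. c i j * fst p ^ i * snd p ^ j)" unfolding bipoly_def by blast
  thus ?thesis unfolding bipoly_def
    by (intro exI[of _ "\<lambda>i j. a * c i j"]) (auto simp: sum_distrib_left mult.assoc)
qed

lemma bipoly_zero: "bipoly d (\<lambda>p. 0)"
  unfolding bipoly_def by (intro exI[of _ "\<lambda>_ _. 0"]) auto

lemma bipoly_diff: "bipoly d F \<Longrightarrow> bipoly d G \<Longrightarrow> bipoly d (\<lambda>p. F p - G p)"
  using bipoly_add[of d F "\<lambda>p. (-1) * G p"] bipoly_cmult[of d G "-1"] by simp

lemma bipoly_sum: "(\<And>i. i \<in> I \<Longrightarrow> bipoly d (F i)) \<Longrightarrow> bipoly d (\<lambda>p. \<Sum>i\<in>I. F i p)"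
  by (induction I rule: infinite_finite_induct) (auto intro: bipoly_add bipoly_zero)

lemma bipoly_monom:
  assumes "i \<le> d" "j \<le> d"
  shows "bipoly d (\<lambda>p. coord b p ^ i * coord (\<not> b) p ^ j)"
proof -
  have *: "bipoly d (\<lambda>p. fst p ^ i * snd p ^ j)" if "i \<le> d" "j \<le> d" for i j
  proof -
    have "(\<Sum>i'\<le>d. \<Sum>j'\<le>d. (if i' = i \<and> j' = j then 1 else 0) * x ^ i' * y ^ j') = x ^ i * y ^ j" for x y :: real
    proof -
      have "(\<Sum>i'\<le>d. \<Sum>j'\<le>d. (if i' = i \<and> j' = j then 1 else 0) * x ^ i' * y ^ j') =
          (\<Sum>i'\<le>d. if i' = i then (\<Sum>j'\<le>d. if j' = j then x ^ i' * y ^ j' else 0) else 0)"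
      proof (rule sum.cong[OF refl])
        fix i'
        show "(\<Sum>j'\<le>d. (if i' = i \<and> j' = j then 1 else 0) * x ^ i' * y ^ j') =
            (if i' = i then (\<Sum>j'\<le>d. if j' = j then x ^ i' * y ^ j' else 0) else 0)"
          by (cases "i' = i") (auto intro!: sum.cong simp del: sum.delta)
      qed
      also have "\<dots> = x ^ i * y ^ j"
        using that by (simp only: sum.delta[OF finite_atMost] atMost_iff if_True)
      finally show ?thesis .
    qed
    thus ?thesis unfolding bipoly_def by (intro exI[of _ "\<lambda>i' j'. if i' = i \<and> j' = j then 1 else 0"]) simp
  qed
  show ?thesis
  proof (cases b)
    case True thus ?thesis using *[OF assms] by (simp add: coord_def)
  next
    case False thus ?thesis using *[OF assms(2,1)] by (simp add: coord_def mult.commute)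
  qed
qed

lemma bipoly_coeffs:
  assumes "bipoly d F"
  shows "\<exists>c. \<forall>p. F p = (\<Sum>i\<le>d. \<Sum>j\<le>d. c i j * coord b p ^ i * coord (\<not> b) p ^ j)"
proof -
  obtain c where c: "\<And>p. F p = (\<Sum>i\<le>d. \<Sum>j\<le>d. c i j * fst p ^ i * snd p ^ j)"
    using assms unfolding bipoly_def by blast
  show ?thesis
  proof (cases b)
    case True thus ?thesis using c by (intro exI[of _ c]) (simp add: coord_def)
  next
    case False
    have "F p = (\<Sum>i\<le>d. \<Sum>j\<le>d. c j i * coord b p ^ i * coord (\<not> b) p ^ j)" for p
      unfolding c using False by (subst sum.swap) (simp add: coord_def mult_ac)
    thus ?thesis by (intro exI[of _ "\<lambda>i j. c j i"]) blast
  qed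
qed

lemma bipoly_slice:
  assumes "bipoly d F"
  shows "upoly d (\<lambda>x. F (point_at b x y))"
proof -
  obtain c where c: "\<And>p. F p = (\<Sum>i\<le>d. \<Sum>j\<le>d. c i j * coord b p ^ i * coord (\<not> b) p ^ j)"
    using bipoly_coeffs[OF assms, of b] by blast
  have "F (point_at b x y) = (\<Sum>i\<le>d. (\<Sum>j\<le>d. c i j * y ^ j) * x ^ i)" for x
    unfolding c by (simp add: sum_distrib_left sum_distrib_right mult_ac)
  moreover have "upoly d (\<lambda>x. \<Sum>i\<le>d. (\<Sum>j\<le>d. c i j * y ^ j) * x ^ i)"
    by (intro upoly_sum upoly_cmult upoly_monom) auto
  ultimately show ?thesis by simp
qed

lemma bipoly_product:
  assumes "upoly d q" "upoly d r"
  shows "bipoly d (\<lambda>p. r (coord (\<not> b) p) * q (coord b p))"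
proof -
  obtain a where a: "\<And>x. q x = (\<Sum>k\<le>d. a k * x ^ k)" using upoly_coeffs[OF assms(1)] by blast
  obtain c where c: "\<And>x. r x = (\<Sum>k\<le>d. c k * x ^ k)" using upoly_coeffs[OF assms(2)] by blast
  have "r (coord (\<not> b) p) * q (coord b p) = (\<Sum>i\<le>d. \<Sum>j\<le>d. (a i * c j) * (coord b p ^ i * coord (\<not> b) p ^ j))" for p
    unfolding a c by (subst mult.commute) (simp add: sum_product mult_ac)
  moreover have "bipoly d (\<lambda>p. \<Sum>i\<le>d. \<Sum>j\<le>d. (a i * c j) * (coord b p ^ i * coord (\<not> b) p ^ j))"
    by (intro bipoly_sum bipoly_cmult bipoly_monom) auto
  ultimately show ?thesis by simp
qed

lemma bipoly_zero_on_rectangle: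
  assumes F: "bipoly d F" and f: "rectangle f" and z: "\<And>p. p \<in> f \<Longrightarrow> F p = 0"
  shows "F p = 0"
proof -
  have inf: "infinite {rlo f b..rhi f b}" for b using rectangle_data(1)[OF f, of b] by (simp add: infinite_Icc)
  have moment_row: "F (point_at True x y) = 0" if y: "y \<in> {rlo f False..rhi f False}" for x y
    by (rule upoly_eqI[OF bipoly_slice[OF F] upoly_zero inf[of True]])
      (use y in \<open>auto intro!: z simp: mem_rectangle[OF f] all_bool_eq\<close>)
  have "F (point_at False y x) = 0" for x y
    by (rule upoly_eqI[OF bipoly_slice[OF F] upoly_zero inf[of False]]) (use moment_row in \<open>auto simp: point_at_def\<close>)
  from this[of "snd p" "fst p"] show ?thesis by (simp add: point_at_def)
qed

lemma bipoly_coeffs_zero: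
  assumes "\<And>p. (\<Sum>i\<le>d. \<Sum>j\<le>d. c i j * fst p ^ i * snd p ^ j) = (0::real)" "i \<le> d" "j \<le> d"
  shows "c i j = 0"
proof -
  have "\<forall>i\<le>d. (\<Sum>j\<le>d. c i j * y ^ j) = 0" for y
  proof (subst polyfun_eq_0[symmetric], intro allI)
    fix x
    show "(\<Sum>i\<le>d. (\<Sum>j\<le>d. c i j * y ^ j) * x ^ i) = 0"
      using assms(1)[of "(x, y)"] by (simp add: sum_distrib_left sum_distrib_right mult_ac)
  qed
  hence "\<forall>j\<le>d. c i j = 0" using assms(2) by (subst polyfun_eq_0[symmetric]) blast
  thus ?thesis using assms(3) by blast
qed

section \<open>Directional derivatives and smoothness across an edge\<close>

definition dir_deriv :: "bool \<Rightarrow> (point \<Rightarrow> real) \<Rightarrow> point \<Rightarrow> real" where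
  "dir_deriv b F p = deriv (\<lambda>t. F (point_at b t (coord (\<not> b) p))) (coord b p)"

lemma bipoly_dir_deriv:
  assumes "bipoly d F"
  shows "bipoly d (dir_deriv b F)"
    and "((\<lambda>t. F (point_at b t (coord (\<not> b) p))) has_real_derivative dir_deriv b F p) (at (coord b p))"
proof -
  obtain c where c: "\<And>p. F p = (\<Sum>i\<le>d. \<Sum>j\<le>d. c i j * coord b p ^ i * coord (\<not> b) p ^ j)"
    using bipoly_coeffs[OF assms, of b] by blast
  define G where "G p = (\<Sum>i\<le>d. \<Sum>j\<le>d. (c i j * real i) * (coord b p ^ (i - 1) * coord (\<not> b) p ^ j))" for p
  have G: "((\<lambda>t. F (point_at b t (coord (\<not> b) p))) has_real_derivative G p) (at (coord b p))" for p
    unfolding c G_def coord_point_at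
    by (intro DERIV_sum) (auto intro!: derivative_eq_intros)
  have eq: "dir_deriv b F = G" unfolding dir_deriv_def using DERIV_imp_deriv[OF G] by (intro ext)
  have "bipoly d G" unfolding G_def by (intro bipoly_sum bipoly_cmult bipoly_monom) auto
  thus "bipoly d (dir_deriv b F)" by (simp add: eq)
  show "((\<lambda>t. F (point_at b t (coord (\<not> b) p))) has_real_derivative dir_deriv b F p) (at (coord b p))"
    using G by (simp add: eq)
qed

lemma bipoly_dir_deriv_iter: "bipoly d F \<Longrightarrow> bipoly d ((dir_deriv b ^^ i) F)"
  by (induction i) (auto intro: bipoly_dir_deriv)

lemma add_unit_vector: "p + t *\<^sub>R point_at b 1 0 = point_at b (coord b p + t) (coord (\<not> b) p)"
  by (auto simp: point_at_def coord_def prod_eq_iff)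

lemma bipoly_DERIV:
  assumes "bipoly d F"
  shows "((\<lambda>t. F (p + t *\<^sub>R point_at b 1 0)) has_real_derivative dir_deriv b F p) (at 0)"
proof -
  have "((\<lambda>t. F (point_at b (t + coord b p) (coord (\<not> b) p))) has_real_derivative dir_deriv b F p) (at 0)"
    using bipoly_dir_deriv(2)[OF assms, of b p] DERIV_shift[of "\<lambda>t. F (point_at b t (coord (\<not> b) p))" _ 0 "coord b p"] by simp
  thus ?thesis by (simp add: add_unit_vector add.commute)
qed

lemma bipoly_continuous: "bipoly d F \<Longrightarrow> continuous_on S F"
proof -
  assume "bipoly d F"
  then obtain c where c: "\<And>p. F p = (\<Sum>i\<le>d. \<Sum>j\<le>d. c i j * fst p ^ i * snd p ^ j)" unfolding bipoly_def by blast
  have "continuous_on S (\<lambda>p. \<Sum>i\<le>d. \<Sum>j\<le>d. c i j * fst p ^ i * snd p ^ j)" by (intro continuous_intros)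
  moreover have "F = (\<lambda>p. \<Sum>i\<le>d. \<Sum>j\<le>d. c i j * fst p ^ i * snd p ^ j)" using c by (intro ext)
  ultimately show ?thesis by simp
qed

lemma dir_deriv_diff:
  assumes "bipoly d F" "bipoly d G"
  shows "dir_deriv b (\<lambda>p. F p - G p) = (\<lambda>p. dir_deriv b F p - dir_deriv b G p)"
  unfolding dir_deriv_def
  by (intro ext DERIV_imp_deriv DERIV_diff bipoly_dir_deriv(2)[OF assms(1), unfolded dir_deriv_def] bipoly_dir_deriv(2)[OF assms(2), unfolded dir_deriv_def])

lemma dir_deriv_iter_diff:
  assumes "bipoly d F" "bipoly d G"
  shows "(dir_deriv b ^^ i) (\<lambda>p. F p - G p) = (\<lambda>p. (dir_deriv b ^^ i) F p - (dir_deriv b ^^ i) G p)"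
proof (induction i)
  case (Suc i)
  show ?case using dir_deriv_diff[OF bipoly_dir_deriv_iter[OF assms(1)] bipoly_dir_deriv_iter[OF assms(2)]] Suc by simp
qed simp

lemma dir_deriv_iter_product:
  assumes "i \<le> d"
  shows "\<exists>\<kappa>. (dir_deriv c ^^ i) (\<lambda>p. (coord c p - y) ^ d * q (coord (\<not> c) p)) =
    (\<lambda>p. \<kappa> * ((coord c p - y) ^ (d - i) * q (coord (\<not> c) p)))"
  using assms
proof (induction i)
  case 0
  show ?case by (intro exI[of _ 1]) simp
next
  case (Suc i)
  then obtain \<kappa> where \<kappa>: "(dir_deriv c ^^ i) (\<lambda>p. (coord c p - y) ^ d * q (coord (\<not> c) p)) =
    (\<lambda>p. \<kappa> * ((coord c p - y) ^ (d - i) * q (coord (\<not> c) p)))" by auto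
  have "dir_deriv c (\<lambda>p. \<kappa> * ((coord c p - y) ^ (d - i) * q (coord (\<not> c) p))) =
      (\<lambda>p. (\<kappa> * real (d - i)) * ((coord c p - y) ^ (d - Suc i) * q (coord (\<not> c) p)))"
    unfolding dir_deriv_def coord_point_at
    by (intro ext DERIV_imp_deriv) (auto intro!: derivative_eq_intros)
  thus ?case using \<kappa> by (intro exI[of _ "\<kappa> * real (d - i)"]) simp
qed

lemma dir_deriv_iter_zero_on_line:
  assumes "\<And>p. coord (\<not> b) p = y \<Longrightarrow> F p = 0"
  shows "coord (\<not> b) p = y \<Longrightarrow> (dir_deriv b ^^ i) F p = 0"
proof (induction i arbitrary: p)
  case (Suc i)
  have "(\<lambda>t. (dir_deriv b ^^ i) F (point_at b t (coord (\<not> b) p))) = (\<lambda>t. 0)" using Suc by (intro ext) auto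
  thus ?case by (simp add: dir_deriv_def[of b "(dir_deriv b ^^ i) F"])
qed (use assms in auto)

text \<open>
  Derivatives across the line lower the power by one each, and derivatives along the line keep it.
\<close>

lemma dir_deriv_iter_jump_zero:
  assumes J: "\<And>p. J p = (coord (\<not> b) p - y) ^ d * q (coord b p)" and i: "i < d" and p: "coord (\<not> b) p = y"
  shows "(dir_deriv c ^^ i) J p = 0"
proof (cases "c = b")
  case True
  show ?thesis unfolding True by (rule dir_deriv_iter_zero_on_line[where y = y]) (use J i p in auto)
next
  case False
  hence c: "c = (\<not> b)" by auto
  have Jc: "J = (\<lambda>p. (coord c p - y) ^ d * q (coord (\<not> c) p))" using J c by (intro ext) simp
  obtain \<kappa> where \<kappa>: "(dir_deriv c ^^ i) J = (\<lambda>p. \<kappa> * ((coord c p - y) ^ (d - i) * q (coord (\<not> c) p)))"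
    unfolding Jc using dir_deriv_iter_product[of i d c y q] i by auto
  show ?thesis unfolding \<kappa> using p c i by simp
qed

lemma power_dvd_if_derivatives_zero:
  fixes R :: "real poly"
  assumes "\<And>i. i < n \<Longrightarrow> poly ((pderiv ^^ i) R) a = 0"
  shows "[:-a, 1:] ^ n dvd R"
  using assms
proof (induction n arbitrary: R)
  case (Suc n)
  have R0: "poly R a = 0" using Suc.prems[of 0] by simp
  have dvd: "[:-a, 1:] ^ n dvd pderiv R"
  proof (rule Suc.IH)
    fix i assume "i < n"
    thus "poly ((pderiv ^^ i) (pderiv R)) a = 0" using Suc.prems[of "Suc i"] by (simp add: funpow_swap1)
  qed
  show ?case
  proof (cases "pderiv R = 0")
    case True
    then obtain k where "R = [:k:]" using pderiv_eq_0_iff degree_eq_zeroE by metis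
    thus ?thesis using R0 by simp
  next
    case False
    hence nz: "R \<noteq> 0" by auto
    hence "order a R \<noteq> 0" using R0 order_root by blast
    hence "order a R = Suc (order a (pderiv R))" using order_pderiv[OF nz R0] by simp
    moreover have "n \<le> order a (pderiv R)" using dvd False by (simp add: order_divides)
    ultimately show ?thesis by (intro order_divides[THEN iffD2] disjI2) simp
  qed
qed simp

text \<open>
  On every line that crosses the segment, the polynomial has degree at most \<^term>\<open>d\<close> and a
  root of order \<^term>\<open>d\<close>, so its value at distance 1 determines it.  The identity extends
  from the segment to the whole line, as both sides are polynomials along the line.
\<close>

lemma jump_factor:
  assumes J: "bipoly d J" and x: "x1 < x2"
    and z: "\<And>i x. i < d \<Longrightarrow> x1 \<le> x \<Longrightarrow> x \<le> x2 \<Longrightarrow> (dir_deriv (\<not> b) ^^ i) J (point_at b x y) = 0"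
  shows "J p = (coord (\<not> b) p - y) ^ d * J (point_at b (coord b p) (y + 1))"
proof -
  let ?c = "\<not> b"
  have sw: "point_at ?c t x = point_at b x t" for t x by (simp add: point_at_def)
  have on: "J (point_at b x t) = (t - y) ^ d * J (point_at b x (y + 1))" if xr: "x \<in> {x1..x2}" for x t
  proof -
    obtain R where R: "degree R \<le> d" "\<And>t. J (point_at ?c t x) = poly R t"
      using bipoly_slice[OF J, of ?c x] unfolding upoly_def by blast
    have it: "(dir_deriv ?c ^^ i) J (point_at ?c t x) = poly ((pderiv ^^ i) R) t" for i t
    proof (induction i arbitrary: t)
      case (Suc i)
      have "coord (\<not> ?c) (point_at ?c t x) = x" "coord ?c (point_at ?c t x) = t" by (rule coord_point_at)+
      thus ?case using Suc DERIV_imp_deriv[OF poly_DERIV[of "(pderiv ^^ i) R" t]] by (simp add: dir_deriv_def[of "\<not> b" "(dir_deriv (\<not> b) ^^ i) J"])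
    qed (use R in simp)
    have "poly ((pderiv ^^ i) R) y = 0" if "i < d" for i
      using it[of i y] z[OF that, of x] xr by (simp add: sw)
    hence "[:-y, 1:] ^ d dvd R" by (rule power_dvd_if_derivatives_zero)
    then obtain Q where Q: "R = [:-y, 1:] ^ d * Q" by (auto simp: dvd_def)
    have "degree Q = 0"
    proof (cases "Q = 0")
      case False
      have "degree R = degree ([:-y, 1:] ^ d) + degree Q" unfolding Q using False by (intro degree_mult_eq) auto
      thus ?thesis using R(1) by (simp add: degree_linear_power)
    qed simp
    then obtain k where "Q = [:k:]" using degree_eq_zeroE by blast
    hence k: "poly R t = (t - y) ^ d * k" for t using Q by (simp add: poly_power)
    show ?thesis using R(2)[of t] R(2)[of "y + 1"] k[of t] k[of "y + 1"] by (simp add: sw)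
  qed
  have "J (point_at b x t) = (t - y) ^ d * J (point_at b x (y + 1))" for x t
    by (rule upoly_eqI[where S = "{x1..x2}", OF bipoly_slice[OF J] upoly_cmult[OF bipoly_slice[OF J]] _ on])
      (use x in \<open>simp_all add: infinite_Icc\<close>)
  from this[of "coord b p" "coord ?c p"] show ?thesis by simp
qed

lemma islimpt_interval:
  assumes "a < b" "a \<le> x" "x \<le> b"
  shows "x islimpt {a..b::real}"
proof (rule connected_imp_perfect)
  show "{a..b} \<noteq> {y}" for y
  proof
    assume "{a..b} = {y}"
    hence "a \<in> {y}" "b \<in> {y}" using assms(1) by (metis atLeastAtMost_iff less_imp_le order_refl)+
    thus False using assms(1) by simp
  qed
qed (use assms in auto)

lemma derivative_within_unique:
  assumes "(F has_real_derivative x) (at a within S)" "(F has_real_derivative y) (at a within S)" "a islimpt S"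
  shows "x = y"
  using assms tendsto_unique[of "at a within S"] by (auto simp: has_field_derivative_iff trivial_limit_within)

context T_mesh_geometry
begin

text \<open>
  A one-sided derivative along an interval determines its value, so on each cell the continuous
  derivatives of \<^term>\<open>s\<close> are those of the polynomial of the cell.
\<close>

lemma continuous_along_derivatives:
  assumes s: "continuous_along (point_at b 1 0) k \<Omega> s"
    and P: "\<And>f. f \<in> cells T \<Longrightarrow> bipoly d (P f)" "\<And>f p. f \<in> cells T \<Longrightarrow> p \<in> f \<Longrightarrow> s p = P f p"
    and fg: "f \<in> cells T" "g \<in> cells T" "p \<in> f" "p \<in> g" and i: "i \<le> k"
  shows "(dir_deriv b ^^ i) (P f) p = (dir_deriv b ^^ i) (P g) p"
proof -
  obtain D where D0: "\<And>p. p \<in> \<Omega> \<Longrightarrow> D 0 p = s p"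
    and D: "\<And>i p. i < k \<Longrightarrow> p \<in> \<Omega> \<Longrightarrow>
      ((\<lambda>t. D i (p + t *\<^sub>R point_at b 1 0)) has_real_derivative D (Suc i) p) (at 0 within {t. p + t *\<^sub>R point_at b 1 0 \<in> \<Omega>})"
    using s unfolding continuous_along_def by metis
  have key: "D i p = (dir_deriv b ^^ i) (P h) p" if h: "h \<in> cells T" "p \<in> h" and i: "i \<le> k" for i h p
    using h(2) i
  proof (induction i arbitrary: p)
    case 0
    have "p \<in> \<Omega>" using h(1) 0 by (auto simp: dom_of_def)
    thus ?case using D0 P(2)[OF h(1) 0(1)] by simp
  next
    case (Suc i)
    let ?S = "{t. p + t *\<^sub>R point_at b 1 0 \<in> h}"
    have rh: "rectangle h" using h rectangle_cell by auto
    have hs: "h \<subseteq> \<Omega>" using h by (auto simp: dom_of_def)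
    have S: "?S = {rlo h b - coord b p..rhi h b - coord b p}"
      using Suc.prems(1) by (auto simp: mem_rectangle[OF rh] add_unit_vector all_bool_split[where c=b])
    have lim: "0 islimpt ?S" unfolding S
      using Suc.prems(1) rectangle_data(1)[OF rh, of b] by (intro islimpt_interval) (auto simp: mem_rectangle[OF rh])
    have d1: "((\<lambda>t. D i (p + t *\<^sub>R point_at b 1 0)) has_real_derivative D (Suc i) p) (at 0 within ?S)"
    proof (rule DERIV_subset)
      show "((\<lambda>t. D i (p + t *\<^sub>R point_at b 1 0)) has_real_derivative D (Suc i) p) (at 0 within {t. p + t *\<^sub>R point_at b 1 0 \<in> \<Omega>})"
        using D[of i p] Suc.prems hs by auto
      show "?S \<subseteq> {t. p + t *\<^sub>R point_at b 1 0 \<in> \<Omega>}" using hs by auto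
    qed
    have d2: "((\<lambda>t. D i (p + t *\<^sub>R point_at b 1 0)) has_real_derivative dir_deriv b ((dir_deriv b ^^ i) (P h)) p) (at 0 within ?S)"
    proof (rule has_field_derivative_transform_within[of "\<lambda>t. (dir_deriv b ^^ i) (P h) (p + t *\<^sub>R point_at b 1 0)" _ _ _ 1])
      show "((\<lambda>t. (dir_deriv b ^^ i) (P h) (p + t *\<^sub>R point_at b 1 0)) has_real_derivative dir_deriv b ((dir_deriv b ^^ i) (P h)) p) (at 0 within ?S)"
        using bipoly_DERIV[OF bipoly_dir_deriv_iter[OF P(1)[OF h(1)]]] by (rule has_field_derivative_at_within)
      show "0 \<in> ?S" using Suc.prems(1) by simp
      fix t assume "t \<in> ?S"
      thus "(dir_deriv b ^^ i) (P h) (p + t *\<^sub>R point_at b 1 0) = D i (p + t *\<^sub>R point_at b 1 0)" using Suc.IH Suc.prems by simp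
    qed simp
    show ?case using derivative_within_unique[OF d1 d2 lim] by simp
  qed
  show ?thesis using key[OF fg(1,3) i] key[OF fg(2,4) i] by simp
qed

lemma closed_line_preimage: "closed h \<Longrightarrow> closed {t :: real. p + t *\<^sub>R u \<in> h}" for p u :: point
proof -
  assume "closed h"
  hence "closed ((\<lambda>t. p + t *\<^sub>R u) -` h)" by (intro closed_vimage continuous_intros)
  thus ?thesis by (simp add: vimage_def)
qed

text \<open>
  Near a point only the cells containing it matter; the limits of the difference quotients along
  these finitely many closed sets combine to the limit along the domain.
\<close>

lemma continuous_along_paste:
  assumes P: "\<And>f. f \<in> cells T \<Longrightarrow> bipoly d (P f)" "\<And>f p. f \<in> cells T \<Longrightarrow> p \<in> f \<Longrightarrow> s p = P f p"
    and agree: "\<And>f g p i. f \<in> cells T \<Longrightarrow> g \<in> cells T \<Longrightarrow> p \<in> f \<Longrightarrow> p \<in> g \<Longrightarrow> i \<le> k \<Longrightarrow>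
      (dir_deriv b ^^ i) (P f) p = (dir_deriv b ^^ i) (P g) p"
  shows "continuous_along (point_at b 1 0) k \<Omega> s"
  unfolding continuous_along_def
proof (intro exI conjI allI impI ballI)
  define D where "D i p = (dir_deriv b ^^ i) (P (SOME f. f \<in> cells T \<and> p \<in> f)) p" for i p
  have D: "D i p = (dir_deriv b ^^ i) (P f) p" if f: "f \<in> cells T" "p \<in> f" and i: "i \<le> k" for i f p
  proof -
    have "(SOME f. f \<in> cells T \<and> p \<in> f) \<in> cells T \<and> p \<in> (SOME f. f \<in> cells T \<and> p \<in> f)"
      by (rule someI[of _ f]) (use f in simp)
    thus ?thesis unfolding D_def using agree[OF _ f(1) _ f(2) i] by blast
  qed
  show "D 0 p = s p" if p: "p \<in> \<Omega>" for p
  proof -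
    obtain f where f: "f \<in> cells T" "p \<in> f" using p by (auto simp: dom_of_def)
    show ?thesis using D[OF f, of 0] P(2)[OF f] by simp
  qed
  show "continuous_on \<Omega> (D i)" if i: "i \<le> k" for i
  proof -
    have "continuous_on (\<Union>f\<in>cells T. f) (D i)"
    proof (rule continuous_on_closed_Union[OF finite_cells])
      fix f assume f: "f \<in> cells T"
      show "closed f" using rectangle_cell[OF f] rectangle_data(4) by blast
      show "continuous_on f (D i)"
        using D[OF f _ i] bipoly_continuous[OF bipoly_dir_deriv_iter[OF P(1)[OF f]]]
        by (subst continuous_on_cong[OF refl]) auto
    qed
    thus ?thesis by (simp add: dom_of_def)
  qed
  show "((\<lambda>t. D i (p + t *\<^sub>R point_at b 1 0)) has_real_derivative D (Suc i) p) (at 0 within {t. p + t *\<^sub>R point_at b 1 0 \<in> \<Omega>})"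
    if i: "i < k" and p: "p \<in> \<Omega>" for i p
  proof -
    let ?S = "\<lambda>f. {t. p + t *\<^sub>R point_at b 1 0 \<in> f}"
    have one: "((\<lambda>t. D i (p + t *\<^sub>R point_at b 1 0)) has_real_derivative D (Suc i) p) (at 0 within ?S f)" if f: "f \<in> cells T" for f
    proof (cases "p \<in> f")
      case True
      have "((\<lambda>t. D i (p + t *\<^sub>R point_at b 1 0)) has_real_derivative dir_deriv b ((dir_deriv b ^^ i) (P f)) p) (at 0 within ?S f)"
      proof (rule has_field_derivative_transform_within[of "\<lambda>t. (dir_deriv b ^^ i) (P f) (p + t *\<^sub>R point_at b 1 0)" _ _ _ 1])
        show "((\<lambda>t. (dir_deriv b ^^ i) (P f) (p + t *\<^sub>R point_at b 1 0)) has_real_derivative dir_deriv b ((dir_deriv b ^^ i) (P f)) p) (at 0 within ?S f)"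
          using bipoly_DERIV[OF bipoly_dir_deriv_iter[OF P(1)[OF f]]] by (rule has_field_derivative_at_within)
      qed (use True D[OF f] i in auto)
      thus ?thesis using D[OF f True, of "Suc i"] i by simp
    next
      case False
      have "closed (?S f)" using rectangle_cell[OF f] rectangle_data(4) closed_line_preimage by blast
      hence "\<not> 0 islimpt ?S f" using False closed_limpt by fastforce
      hence "at 0 within ?S f = bot" using trivial_limit_within by blast
      thus ?thesis by (simp add: has_field_derivative_iff)
    qed
    have "((\<lambda>t. (D i (p + t *\<^sub>R point_at b 1 0) - D i (p + 0 *\<^sub>R point_at b 1 0)) / (t - 0)) \<longlongrightarrow> D (Suc i) p) (at 0 within (\<Union>f\<in>C. ?S f))"
      if "finite C" "C \<subseteq> cells T" for C
      using that
    proof (induction C)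
      case (insert f C)
      thus ?case using one[of f] by (auto simp: has_field_derivative_iff intro: Lim_Un)
    qed simp
    from this[OF finite_cells order_refl]
    have "((\<lambda>t. D i (p + t *\<^sub>R point_at b 1 0)) has_real_derivative D (Suc i) p) (at 0 within (\<Union>f\<in>cells T. ?S f))"
      unfolding has_field_derivative_iff .
    moreover have "(\<Union>f\<in>cells T. ?S f) = {t. p + t *\<^sub>R point_at b 1 0 \<in> \<Omega>}" by (auto simp: dom_of_def)
    ultimately show ?thesis by simp
  qed
qed

lemma unit_vectors: "(1, 0) = point_at True 1 0" "(0, 1) = point_at False 1 0"
  by (simp_all add: point_at_def)

text \<open>
  The factor of the power of the distance is read off at distance 1 from the line of the edge.
\<close>
definition smooth_jumps :: "nat \<Rightarrow> (point set \<Rightarrow> point \<Rightarrow> real) \<Rightarrow> bool" where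
  "smooth_jumps d P \<longleftrightarrow> (\<forall>e\<in>interior_edges T. \<forall>f g p. side T True e f \<longrightarrow> side T False e g \<longrightarrow>
     P f p - P g p = (coord (\<not> dir e) p - lev e) ^ d *
       (P f (point_at (dir e) (coord (dir e) p) (lev e + 1)) - P g (point_at (dir e) (coord (dir e) p) (lev e + 1))))"

text \<open>
  The smoothness condition reduces to the interior edges, where it is divisibility of the jump.
\<close>
lemma spline_space_iff:
  assumes d: "1 \<le> d"
  shows "s \<in> spline_space d T \<longleftrightarrow> (\<forall>p. p \<notin> \<Omega> \<longrightarrow> s p = 0) \<and>
    (\<exists>P. (\<forall>f\<in>cells T. bipoly d (P f) \<and> (\<forall>p\<in>f. s p = P f p)) \<and> smooth_jumps d P)"
proof (intro iffI conjI; (elim conjE exE)?)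
  assume s: "s \<in> spline_space d T"
  show "\<forall>p. p \<notin> \<Omega> \<longrightarrow> s p = 0" using s by (simp add: spline_space_def)
  have "\<forall>f\<in>cells T. \<exists>F. bipoly d F \<and> (\<forall>p\<in>f. s p = F p)"
    using s by (simp add: spline_space_def bidegree_poly_on_iff)
  then obtain P where P: "\<And>f. f \<in> cells T \<Longrightarrow> bipoly d (P f)" "\<And>f p. f \<in> cells T \<Longrightarrow> p \<in> f \<Longrightarrow> s p = P f p"
    by metis
  have ca: "continuous_along (point_at b 1 0) (d - 1) \<Omega> s" for b
    using s by (cases b) (simp_all add: spline_space_def unit_vectors)
  have "smooth_jumps d P" unfolding smooth_jumps_def
  proof (intro ballI allI impI)
    fix e f g p assume e: "e \<in> interior_edges T" and f: "side T True e f" and g: "side T False e g"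
    have ee: "e \<in> edges T" using interior_edgeD(1)[OF e] .
    have se: "straight e" using straight_edge[OF ee] .
    have c: "f \<in> cells T" "g \<in> cells T" using f g sideD(1) by auto
    have J: "bipoly d (\<lambda>p. P f p - P g p)" using bipoly_diff P(1) c by blast
    have zero: "(dir_deriv (\<not> dir e) ^^ i) (\<lambda>p. P f p - P g p) (point_at (dir e) x (lev e)) = 0"
      if i: "i < d" and x: "lo e \<le> x" "x \<le> hi e" for i x
    proof -
      have m: "point_at (dir e) x (lev e) \<in> e" using x by (simp add: mem_straight[OF se])
      hence m': "point_at (dir e) x (lev e) \<in> f" "point_at (dir e) x (lev e) \<in> g"
        using side_subset[OF ee f] side_subset[OF ee g] by auto
      have "(dir_deriv (\<not> dir e) ^^ i) (P f) (point_at (dir e) x (lev e)) = (dir_deriv (\<not> dir e) ^^ i) (P g) (point_at (dir e) x (lev e))"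
        by (rule continuous_along_derivatives[where P = P, OF ca[of "\<not> dir e"]]) (use P c m' i in auto)
      thus ?thesis
        by (simp add: dir_deriv_iter_diff[OF P(1)[OF c(1)] P(1)[OF c(2)]])
    qed
    show "P f p - P g p = (coord (\<not> dir e) p - lev e) ^ d *
       (P f (point_at (dir e) (coord (dir e) p) (lev e + 1)) - P g (point_at (dir e) (coord (dir e) p) (lev e + 1)))"
      using jump_factor[OF J straight_lt[OF se] zero, of p] .
  qed
  thus "\<exists>P. (\<forall>f\<in>cells T. bipoly d (P f) \<and> (\<forall>p\<in>f. s p = P f p)) \<and> smooth_jumps d P" using P by blast
next
  fix P assume z: "\<forall>p. p \<notin> \<Omega> \<longrightarrow> s p = 0"
    and P: "\<forall>f\<in>cells T. bipoly d (P f) \<and> (\<forall>p\<in>f. s p = P f p)" and J: "smooth_jumps d P"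
  have agree: "(dir_deriv b ^^ i) (P f) p = (dir_deriv b ^^ i) (P g) p"
    if fg: "f \<in> cells T" "g \<in> cells T" "p \<in> f" "p \<in> g" and i: "i \<le> d - 1" for b f g p i
  proof (rule cells_agree_at_point[OF fg, where K = "\<lambda>f. (dir_deriv b ^^ i) (P f) p"])
    fix e f g assume e: "e \<in> interior_edges T" "p \<in> e" and f: "side T True e f" and g: "side T False e g"
    have c: "f \<in> cells T" "g \<in> cells T" using f g sideD(1) by auto
    have lev: "coord (\<not> dir e) p = lev e" using e(2) mem_straight straight_edge interior_edgeD(1)[OF e(1)] by blast
    have "(dir_deriv b ^^ i) (\<lambda>p. P f p - P g p) p = 0"
    proof (rule dir_deriv_iter_jump_zero[OF _ _ lev])
      fix q
      show "P f q - P g q = (coord (\<not> dir e) q - lev e) ^ d *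
        (\<lambda>x. P f (point_at (dir e) x (lev e + 1)) - P g (point_at (dir e) x (lev e + 1))) (coord (dir e) q)"
        using J e f g unfolding smooth_jumps_def by blast
    qed (use i d in simp)
    thus "(dir_deriv b ^^ i) (P f) p = (dir_deriv b ^^ i) (P g) p" using P c by (simp add: dir_deriv_iter_diff[of d])
  qed
  have "continuous_along (point_at b 1 0) (d - 1) \<Omega> s" for b
    by (rule continuous_along_paste[where P = P and d = d, OF _ _ agree]) (use P in blast)+
  moreover have "\<forall>f\<in>cells T. bidegree_poly_on d f s" using P bidegree_poly_on_iff by blast
  ultimately show "s \<in> spline_space d T" using z by (simp add: spline_space_def unit_vectors)
qed

end

section \<open>Jumps along l-edges\<close>

context T_mesh_geometry
begin

text \<open>
  At most one edge leaves \<^term>\<open>v\<close> in direction \<^term>\<open>b\<close> towards the side \<^term>\<open>s\<close>; it is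
  kept as a set, so that sums over it cover the case of a missing edge, with jump zero.
\<close>

definition arms :: "bool \<Rightarrow> bool \<Rightarrow> point \<Rightarrow> point set set" where
  "arms s b v = {e \<in> interior_edges T. dir e = b \<and> (if s then lower_end e else upper_end e) = v}"

lemma armsD:
  assumes "e \<in> arms s b v"
  shows "e \<in> interior_edges T" "e \<in> edges T" "dir e = b" "v \<in> e" "v \<in> vertices T" "lev e = coord (\<not> b) v"
    "if s then lo e = coord b v \<and> coord b v < hi e else hi e = coord b v \<and> lo e < coord b v"
proof -
  show e: "e \<in> interior_edges T" and d: "dir e = b" using assms by (auto simp: arms_def)
  show ee: "e \<in> edges T" using e interior_edges_subset by auto
  have se: "straight e" using straight_edge[OF ee] .
  have v: "v = (if s then lower_end e else upper_end e)" using assms by (auto simp: arms_def)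
  show "v \<in> e" unfolding v using ends_mem[OF se] by simp
  show "v \<in> vertices T" unfolding v using endpoint_vertex[OF ee] endpoints_straight[OF se] by simp
  show "lev e = coord (\<not> b) v" unfolding v d[symmetric] by simp
  show "if s then lo e = coord b v \<and> coord b v < hi e else hi e = coord b v \<and> lo e < coord b v"
    unfolding v d[symmetric] using straight_lt[OF se] by simp
qed

lemma arms_unique:
  assumes e: "e \<in> arms s b v" and e': "e' \<in> arms s b v"
  shows "e = e'"
proof -
  note a = armsD[OF e] and a' = armsD[OF e']
  define m where "m = (if s then min (hi e) (hi e') else max (lo e) (lo e'))"
  define q where "q = point_at b ((coord b v + m) / 2) (coord (\<not> b) v)"
  have "q \<in> open_edge e" using a a' by (cases s) (auto simp: open_edge_def q_def m_def)
  moreover have "q \<in> open_edge e'" using a a' by (cases s) (auto simp: open_edge_def q_def m_def)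
  hence "q \<in> e'" using open_edge_eq[OF straight_edge[OF a'(2)]] by blast
  ultimately show ?thesis using open_edge_unique[OF a(2) a'(2)] by blast
qed

lemma arms_cases: "arms s b v = {} \<or> (\<exists>e. arms s b v = {e})"
  using arms_unique by blast

lemma armI:
  assumes e: "e \<in> interior_edges T" and v: "v \<in> vertices T" "v \<in> e"
    and s: "if s then coord (dir e) v < hi e else lo e < coord (dir e) v"
  shows "e \<in> arms s (dir e) v"
proof -
  have ee: "e \<in> edges T" using e interior_edges_subset by auto
  have "v \<in> {lower_end e, upper_end e}" using vertex_on_edge_endpoint[OF v(1) ee v(2)] endpoints_straight[OF straight_edge[OF ee]] by simp
  thus ?thesis using e s by (cases s) (auto simp: arms_def)
qed

lemma arms_l_edge:
  assumes l: "l \<in> interior_l_edges T" and v: "v \<in> vertices T" "v \<in> l"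
  shows "if (if s then coord (dir l) v < hi l else lo l < coord (dir l) v)
    then \<exists>e. arms s (dir l) v = {e} \<and> e \<subseteq> l else arms s (dir l) v = {}"
proof -
  have sl: "straight l" using straight_interior_l_edge[OF l] .
  have l': "l \<in> max_segments (interior_edges T)" using l by (simp add: interior_l_edges_def)
  show ?thesis
  proof (cases "if s then coord (dir l) v < hi l else lo l < coord (dir l) v")
    case True
    then obtain e where e: "e \<in> interior_edges T" "e \<subseteq> l" "v \<in> e"
      "if s then coord (dir l) v < hi e else lo e < coord (dir l) v"
      using max_segment_arm[OF interior_edges_subset l' v(2)] by blast
    have "dir e = dir l"
      using straight_subset_parallel(1)[OF straight_edge sl e(2)] e(1) interior_edges_subset by auto
    hence "e \<in> arms s (dir l) v" using armI[OF e(1) v(1) e(3), of s] e(4) by simp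
    hence "arms s (dir l) v = {e}" using arms_unique by blast
    thus ?thesis using True e(2) by auto
  next
    case False
    have "e \<notin> arms s (dir l) v" for e
    proof
      assume e: "e \<in> arms s (dir l) v"
      note a = armsD[OF e]
      have "e \<subseteq> l" using edge_subset_max_segment[OF interior_edges_subset l' a(1) a(3) a(4) v(2)] .
      hence "lo l \<le> lo e" "hi e \<le> hi l" using straight_subset_parallel[OF straight_edge[OF a(2)] sl] by auto
      thus False using a(7) False by (cases s) auto
    qed
    thus ?thesis using False by auto
  qed
qed

lemma finite_interior_vertices: "finite (interior_vertices T)"
  using finite_vertices by (simp add: interior_vertices_def)

text \<open>
  \<^term>\<open>jump_upto d \<delta> l y\<close> collects the jumps that the vertices up to \<^term>\<open>y\<close> contribute
  along \<^term>\<open>l\<close>.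
\<close>

definition jump_upto :: "nat \<Rightarrow> (point \<Rightarrow> real) \<Rightarrow> point set \<Rightarrow> real \<Rightarrow> real \<Rightarrow> real" where
  "jump_upto d \<delta> l y x = (\<Sum>v\<in>{v \<in> interior_vertices T \<inter> l. coord (dir l) v \<le> y}. \<delta> v * (x - coord (dir l) v) ^ d)"

definition jump_total :: "nat \<Rightarrow> (point \<Rightarrow> real) \<Rightarrow> point set \<Rightarrow> real \<Rightarrow> real" where
  "jump_total d \<delta> l x = (\<Sum>v\<in>interior_vertices T \<inter> l. \<delta> v * (x - coord (dir l) v) ^ d)"

text \<open>
  Along both lines through an interior vertex the factor of the jump changes by the same multiple
  \<^term>\<open>\<delta> v\<close> of a power.
\<close>
definition balanced :: "nat \<Rightarrow> (point set \<Rightarrow> real \<Rightarrow> real) \<Rightarrow> (point \<Rightarrow> real) \<Rightarrow> bool" where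
  "balanced d A \<delta> \<longleftrightarrow> (\<forall>v\<in>interior_vertices T. \<forall>b x.
     (\<Sum>e\<in>arms True b v. A e x) - (\<Sum>e\<in>arms False b v. A e x) = \<delta> v * (x - coord b v) ^ d)"

text \<open>
  \<^term>\<open>a\<close> is the jump with which the l-edge \<^term>\<open>l\<close> begins.  It vanishes if the l-edge
  begins in the interior, and the jump has to disappear where the l-edge ends in the interior.
\<close>

definition chain :: "nat \<Rightarrow> (point set \<Rightarrow> real \<Rightarrow> real) \<Rightarrow> (point \<Rightarrow> real) \<Rightarrow> point set \<Rightarrow> (real \<Rightarrow> real) \<Rightarrow> bool" where
  "chain d A \<delta> l a \<longleftrightarrow>
     (\<forall>e\<in>interior_edges T. e \<subseteq> l \<longrightarrow> (\<forall>x. A e x = a x + jump_upto d \<delta> l (lo e) x)) \<and>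
     (lower_end l \<in> interior \<Omega> \<longrightarrow> (\<forall>x. a x = 0)) \<and>
     (upper_end l \<in> interior \<Omega> \<longrightarrow> (\<forall>x. a x + jump_total d \<delta> l x = 0))"

lemma jump_upto_step:
  assumes l: "l \<in> interior_l_edges T" and v: "v \<in> interior_vertices T" "v \<in> l"
    and e: "e \<in> arms False (dir l) v"
  shows "jump_upto d \<delta> l (coord (dir l) v) x = jump_upto d \<delta> l (lo e) x + \<delta> v * (x - coord (dir l) v) ^ d"
proof -
  have sl: "straight l" using straight_interior_l_edge[OF l] .
  note a = armsD[OF e]
  have lo: "lo e < coord (dir l) v" and hi: "hi e = coord (dir l) v" using a(7) by auto
  have lev: "lev e = lev l" using a(6) v mem_straight[OF sl] by auto
  let ?S = "\<lambda>y. {v \<in> interior_vertices T \<inter> l. coord (dir l) v \<le> y}"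
  have "?S (coord (dir l) v) = insert v (?S (lo e))"
  proof (intro equalityI subsetI)
    fix w assume w: "w \<in> ?S (coord (dir l) v)"
    have wv: "w \<in> vertices T" using w by (simp add: interior_vertices_def)
    show "w \<in> insert v (?S (lo e))"
    proof (rule ccontr)
      assume n: "w \<notin> insert v (?S (lo e))"
      hence "w \<noteq> v" "lo e < coord (dir l) w" using w by auto
      moreover have "coord (\<not> dir l) w = lev l" "coord (\<not> dir l) v = lev l" using w v mem_straight[OF sl] by auto
      ultimately have "coord (dir l) w < hi e" using w hi point_eqI[of "dir l" w v] by force
      hence "w \<in> open_edge e" using a(3) lev \<open>lo e < coord (dir l) w\<close> \<open>coord (\<not> dir l) w = lev l\<close>
        by (simp add: open_edge_def)
      thus False using vertex_not_open_edge[OF wv a(2)] by blast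
    qed
  qed (use v lo in auto)
  moreover have "v \<notin> ?S (lo e)" using lo by auto
  moreover have "finite (?S (lo e))" using finite_interior_vertices by auto
  ultimately show ?thesis unfolding jump_upto_def by simp
qed

lemma jump_upto_first:
  assumes l: "l \<in> interior_l_edges T" and v: "lower_end l \<in> interior \<Omega>"
  shows "jump_upto d \<delta> l (lo l) x = \<delta> (lower_end l) * (x - lo l) ^ d"
proof -
  have sl: "straight l" using straight_interior_l_edge[OF l] .
  have lv: "lower_end l \<in> interior_vertices T"
    using v max_segment_ends_vertices(1)[OF interior_edges_subset] l by (simp add: interior_vertices_def interior_l_edges_def)
  have "{v \<in> interior_vertices T \<inter> l. coord (dir l) v \<le> lo l} = {lower_end l}"
  proof (intro equalityI subsetI)
    fix w assume "w \<in> {v \<in> interior_vertices T \<inter> l. coord (dir l) v \<le> lo l}"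
    thus "w \<in> {lower_end l}" using mem_straight[OF sl, of w] by (auto intro!: point_eqI[of "dir l"])
  qed (use lv ends_mem[OF sl] in auto)
  thus ?thesis unfolding jump_upto_def by simp
qed

lemma jump_total_eq_jump_upto:
  assumes "l \<in> interior_l_edges T"
  shows "jump_total d \<delta> l x = jump_upto d \<delta> l (hi l) x"
proof -
  have "{v \<in> interior_vertices T \<inter> l. coord (dir l) v \<le> hi l} = interior_vertices T \<inter> l"
    using mem_straight[OF straight_interior_l_edge[OF assms]] by auto
  thus ?thesis by (simp add: jump_total_def jump_upto_def)
qed

lemma balanced_if_chains:
  assumes ch: "\<And>l. l \<in> interior_l_edges T \<Longrightarrow> \<exists>a. chain d A \<delta> l a"
  shows "balanced d A \<delta>"
  unfolding balanced_def
proof (intro ballI allI)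
  fix v b x assume v: "v \<in> interior_vertices T"
  obtain l where l: "l \<in> interior_l_edges T" "dir l = b" "v \<in> l" using interior_vertex_l_edge[OF v] by blast
  have vv: "v \<in> vertices T" "v \<in> interior \<Omega>" using v by (auto simp: interior_vertices_def)
  have sl: "straight l" using straight_interior_l_edge[OF l(1)] .
  have vl: "lo l \<le> coord b v" "coord b v \<le> hi l" "coord (\<not> b) v = lev l" using l mem_straight[OF sl] by auto
  obtain a where a: "chain d A \<delta> l a" using ch[OF l(1)] by blast
  have ex: "if coord b v < hi l then \<exists>e. arms True b v = {e} \<and> e \<subseteq> l else arms True b v = {}"
    "if lo l < coord b v then \<exists>e. arms False b v = {e} \<and> e \<subseteq> l else arms False b v = {}"
    using arms_l_edge[OF l(1) vv(1) l(3), of True] arms_l_edge[OF l(1) vv(1) l(3), of False] l(2) by auto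
  have right: "(\<Sum>e\<in>arms True b v. A e x) = a x + jump_upto d \<delta> l (coord b v) x"
  proof (cases "coord b v < hi l")
    case True
    then obtain e where e: "arms True b v = {e}" "e \<subseteq> l" using ex(1) by auto
    have em: "e \<in> arms True b v" using e by simp
    show ?thesis using a armsD(1,7)[OF em] e by (simp add: chain_def)
  next
    case False
    hence hv: "coord b v = hi l" using vl by simp
    hence "v = upper_end l" using vl l by (intro point_eqI[of b]) (auto simp: upper_end_def)
    hence "upper_end l \<in> interior \<Omega>" using vv by simp
    hence "a x + jump_total d \<delta> l x = 0" using a by (simp add: chain_def)
    thus ?thesis using False ex(1) hv jump_total_eq_jump_upto[OF l(1)] by simp
  qed
  have left: "(\<Sum>e\<in>arms False b v. A e x) + \<delta> v * (x - coord b v) ^ d = a x + jump_upto d \<delta> l (coord b v) x"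
  proof (cases "lo l < coord b v")
    case True
    then obtain e where e: "arms False b v = {e}" "e \<subseteq> l" using ex(2) by auto
    have em: "e \<in> arms False b v" using e by simp
    have "A e x = a x + jump_upto d \<delta> l (lo e) x" using a armsD(1)[OF em] e(2) by (simp add: chain_def)
    thus ?thesis using jump_upto_step[OF l(1) v l(3), of e] em e(1) l(2) by simp
  next
    case False
    hence lv: "coord b v = lo l" using vl by simp
    hence vl': "v = lower_end l" using vl l by (intro point_eqI[of b]) (auto simp: lower_end_def)
    hence li: "lower_end l \<in> interior \<Omega>" using vv by simp
    hence "a x = 0" using a by (simp add: chain_def)
    thus ?thesis using False ex(2) lv jump_upto_first[OF l(1) li, of d \<delta> x] vl' by simp
  qed
  show "(\<Sum>e\<in>arms True b v. A e x) - (\<Sum>e\<in>arms False b v. A e x) = \<delta> v * (x - coord b v) ^ d"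
    using left right by simp
qed

text \<open>
  From one edge of an l-edge to the next the factor changes by the contribution of the vertex
  between them, so the factor on the first edge determines all others.
\<close>

lemma chain_if_balanced:
  assumes bal: "balanced d A \<delta>" and l: "l \<in> interior_l_edges T"
  shows "\<exists>a. chain d A \<delta> l a"
proof -
  let ?b = "dir l"
  have sl: "straight l" using straight_interior_l_edge[OF l] .
  have ends: "lower_end l \<in> vertices T" "upper_end l \<in> vertices T"
    using max_segment_ends_vertices[OF interior_edges_subset] l by (auto simp: interior_l_edges_def)
  have lt: "lo l < hi l" using straight_lt[OF sl] .
  obtain e1 where e1: "arms True ?b (lower_end l) = {e1}" "e1 \<subseteq> l"
    using arms_l_edge[OF l ends(1) ends_mem(1)[OF sl], of True] lt by auto
  define a where "a x = A e1 x - jump_upto d \<delta> l (lo l) x" for x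
  have b: "(\<Sum>e\<in>arms True ?b v. A e x) - (\<Sum>e\<in>arms False ?b v. A e x) = \<delta> v * (x - coord ?b v) ^ d"
    if "v \<in> interior_vertices T" for v x using bal that by (simp add: balanced_def)
  \<comment> \<open>The lower end of an edge that is not the first is an interior vertex, where the balance
    leads back to the edge before.\<close>
  have main: "A e x = a x + jump_upto d \<delta> l (lo e) x" if "e \<in> interior_edges T" "e \<subseteq> l" for e x
    using that
  proof (induction "card {e' \<in> interior_edges T. lo e' < lo e}" arbitrary: e rule: less_induct)
    case less
    have ee: "e \<in> edges T" using less.prems interior_edges_subset by auto
    have se: "straight e" using straight_edge[OF ee] .
    note par = straight_subset_parallel[OF se sl less.prems(2)]
    have v: "lower_end e \<in> vertices T" using endpoint_vertex[OF ee] endpoints_straight[OF se] by simp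
    have vl: "lower_end e \<in> l" using less.prems(2) ends_mem[OF se] by auto
    have em: "e \<in> arms True ?b (lower_end e)" using less.prems(1) par(1) by (simp add: arms_def)
    have ce: "coord ?b (lower_end e) = lo e" using par(1) coord_ends(1)[of e] by simp
    show ?case
    proof (cases "lo e = lo l")
      case True
      hence "lower_end e = lower_end l" using par by (simp add: lower_end_def)
      hence "e = e1" using em e1 by auto
      thus ?thesis using True by (simp add: a_def)
    next
      case False
      hence lt: "lo l < lo e" using par by simp
      have "lo e < hi l" using par straight_lt[OF se] by simp
      hence vi: "lower_end e \<in> interior_vertices T"
        using interior_l_edge_point[OF l vl] lt v by (simp add: interior_vertices_def ce)
      obtain e' where e': "arms False ?b (lower_end e) = {e'}" "e' \<subseteq> l"
        using arms_l_edge[OF l v vl, of False] lt by (auto simp: ce)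
      have em': "e' \<in> arms False ?b (lower_end e)" using e' by simp
      have lo': "lo e' < lo e" using armsD(7)[OF em'] ce by simp
      have "arms True ?b (lower_end e) = {e}" using em arms_unique by blast
      hence "A e x - A e' x = \<delta> (lower_end e) * (x - lo e) ^ d" using b[OF vi, of x] e' ce by simp
      moreover have "A e' x = a x + jump_upto d \<delta> l (lo e') x"
      proof (rule less.hyps)
        have "finite (interior_edges T)" using finite_edges interior_edges_subset finite_subset by blast
        moreover have "e' \<in> interior_edges T" using armsD(1)[OF em'] .
        ultimately show "card {e'' \<in> interior_edges T. lo e'' < lo e'} < card {e' \<in> interior_edges T. lo e' < lo e}"
          using lo' by (intro psubset_card_mono) auto
        show "e' \<in> interior_edges T" using armsD(1)[OF em'] .
      qed (rule e'(2))
      moreover have "jump_upto d \<delta> l (lo e) x = jump_upto d \<delta> l (lo e') x + \<delta> (lower_end e) * (x - lo e) ^ d"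
        using jump_upto_step[OF l vi vl em', of d \<delta> x] by (simp add: ce)
      ultimately show ?thesis by simp
    qed
  qed
  have first: "a x = 0" if i: "lower_end l \<in> interior \<Omega>" for x
  proof -
    have vi: "lower_end l \<in> interior_vertices T" using i ends by (simp add: interior_vertices_def)
    have "arms False ?b (lower_end l) = {}" using arms_l_edge[OF l ends(1) ends_mem(1)[OF sl], of False] by simp
    hence "A e1 x = \<delta> (lower_end l) * (x - lo l) ^ d" using b[OF vi, of x] e1 by simp
    thus ?thesis using jump_upto_first[OF l i, of d \<delta> x] by (simp add: a_def)
  qed
  have last: "a x + jump_total d \<delta> l x = 0" if i: "upper_end l \<in> interior \<Omega>" for x
  proof -
    have vi: "upper_end l \<in> interior_vertices T" using i ends by (simp add: interior_vertices_def)
    have r: "arms True ?b (upper_end l) = {}" using arms_l_edge[OF l ends(2) ends_mem(2)[OF sl], of True] by simp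
    obtain e where e: "arms False ?b (upper_end l) = {e}" "e \<subseteq> l"
      using arms_l_edge[OF l ends(2) ends_mem(2)[OF sl], of False] lt by auto
    have em: "e \<in> arms False ?b (upper_end l)" using e by simp
    have "A e x = - (\<delta> (upper_end l) * (x - hi l) ^ d)" using b[OF vi, of x] e r by simp
    moreover have "jump_upto d \<delta> l (hi l) x = jump_upto d \<delta> l (lo e) x + \<delta> (upper_end l) * (x - hi l) ^ d"
      using jump_upto_step[OF l vi ends_mem(2)[OF sl] em, of d \<delta> x] by simp
    ultimately show ?thesis using main[OF armsD(1)[OF em] e(2), of x] jump_total_eq_jump_upto[OF l, of d \<delta> x] by simp
  qed
  show ?thesis unfolding chain_def using main first last by blast
qed

lemma upoly_jump_upto: "upoly d (jump_upto d \<delta> l y)"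
  unfolding jump_upto_def[abs_def] by (intro upoly_sum upoly_cmult upoly_power)

lemma upoly_jump_total: "upoly d (jump_total d \<delta> l)"
  unfolding jump_total_def[abs_def] by (intro upoly_sum upoly_cmult upoly_power)

definition jump :: "(point set \<Rightarrow> point \<Rightarrow> real) \<Rightarrow> point set \<Rightarrow> point \<Rightarrow> real" where
  "jump P e p = P (SOME f. side T True e f) p - P (SOME f. side T False e f) p"

lemma jump_eq:
  assumes "e \<in> edges T" "side T True e f" "side T False e g"
  shows "jump P e p = P f p - P g p"
proof -
  have "(SOME f. side T True e f) = f" "(SOME f. side T False e f) = g"
    using side_unique[OF assms(1)] assms by (auto intro!: some_equality)
  thus ?thesis by (simp add: jump_def)
qed

text \<open>
  If there is no arm, both quadrants belong to one cell and both sides are 0.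
\<close>

lemma sum_arms_jump:
  assumes g: "isolating v r" and v: "v \<in> vertices T"
    and f: "f \<in> cells T" "quadrant v r \<sigma> \<subseteq> interior f" and f': "f' \<in> cells T" "quadrant v r \<tau> \<subseteq> interior f'"
    and s: "\<sigma> b = s" "\<sigma> (\<not> b) = True" "\<tau> b = s" "\<tau> (\<not> b) = False"
  shows "(\<Sum>e\<in>arms s b v. jump P e p) = P f p - P f' p"
proof (cases "arms s b v = {}")
  case True
  have "f = f'"
  proof (rule ccontr)
    assume ne: "f \<noteq> f'"
    have q: "quadrant v r \<sigma> \<subseteq> f" "quadrant v r \<tau> \<subseteq> f'" using f(2) f'(2) interior_subset by blast+
    have t: "\<tau> b = \<sigma> b" "\<tau> (\<not> b) = (\<not> \<sigma> (\<not> b))" using s by auto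
    from quadrants_adjacent[OF g f(1) f'(1) ne q t] s obtain e where e: "e \<in> edges T" "dir e = b" "v \<in> e"
      "side T True e f" "side T False e f'" "point_at b (coord b v + sg s * (r/2)) (coord (\<not> b) v) \<in> open_edge e" by auto
    have "if s then coord (dir e) v < hi e else lo e < coord (dir e) v"
      using e(6) e(2) isolating_pos[OF g] by (auto simp: open_edge_def sg_def)
    hence "e \<in> arms s (dir e) v" using armI[OF interior_edgeI[OF e(1,4,5)] v e(3)] by blast
    thus False using True e(2) by auto
  qed
  thus ?thesis using True by simp
next
  case False
  then obtain e where e: "arms s b v = {e}" using arms_cases[of s b v] by blast
  have em: "e \<in> arms s b v" using e by simp
  note a = armsD[OF em]
  have rp: "0 < r" using g isolating_pos by auto
  obtain h where h: "side T True e h" using interior_edgeD(2)[OF a(1)] by blast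
  obtain h' where h': "side T False e h'" using interior_edgeD(2)[OF a(1)] by blast
  have arm: "if \<sigma> (dir e) then coord (dir e) v < hi e else lo e < coord (dir e) v"
    "if \<tau> (dir e) then coord (dir e) v < hi e else lo e < coord (dir e) v" using a(3,7) s by (auto split: if_splits)
  have "quadrant v r \<sigma> \<subseteq> interior h"
    by (rule side_contains_quadrant[where \<sigma> = \<sigma>, OF g a(2,4) _ arm(1)]) (use h s a(3) in simp)
  hence "h = f" using quadrant_cell_unique[OF rp f(1) sideD(1)[OF h] f(2)] interior_subset by blast
  moreover have "quadrant v r \<tau> \<subseteq> interior h'"
    by (rule side_contains_quadrant[where \<sigma> = \<tau>, OF g a(2,4) _ arm(2)]) (use h' s a(3) in simp)
  hence "h' = f'" using quadrant_cell_unique[OF rp f'(1) sideD(1)[OF h'] f'(2)] interior_subset by blast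
  ultimately show ?thesis using e jump_eq[OF a(2) h h'] by simp
qed

text \<open>
  Both sides are the alternating sum of the polynomials in the four quadrants.
\<close>
lemma conformality_at_vertex:
  assumes v: "v \<in> interior_vertices T"
  shows "(\<Sum>e\<in>arms True True v. jump P e p) - (\<Sum>e\<in>arms False True v. jump P e p) =
    (\<Sum>e\<in>arms True False v. jump P e p) - (\<Sum>e\<in>arms False False v. jump P e p)"
proof -
  have vv: "v \<in> vertices T" "v \<in> interior \<Omega>" using v by (auto simp: interior_vertices_def)
  obtain r where g: "isolating v r" using isolating_exists by blast
  define \<sigma> where "\<sigma> h w b = (if b then h else w)" for h w b :: bool
  have "\<exists>f. f \<in> cells T \<and> quadrant v r (\<sigma> h w) \<subseteq> interior f" for h w
    using quadrant_cell_exists_interior[OF g vv(2)] by blast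
  then obtain c where c: "\<And>h w. c h w \<in> cells T" "\<And>h w. quadrant v r (\<sigma> h w) \<subseteq> interior (c h w)" by metis
  have 1: "(\<Sum>e\<in>arms s True v. jump P e p) = P (c s True) p - P (c s False) p" for s
    by (rule sum_arms_jump[OF g vv(1) c(1) c(2) c(1) c(2)]) (simp_all add: \<sigma>_def)
  have 2: "(\<Sum>e\<in>arms s False v. jump P e p) = P (c True s) p - P (c False s) p" for s
    by (rule sum_arms_jump[OF g vv(1) c(1) c(2) c(1) c(2)]) (simp_all add: \<sigma>_def)
  show ?thesis by (simp add: 1 2)
qed

lemma sum_arms_factored:
  assumes J: "\<And>e p. e \<in> interior_edges T \<Longrightarrow> J e p = (coord (\<not> dir e) p - lev e) ^ d * A e (coord (dir e) p)"
  shows "(\<Sum>e\<in>arms s b v. J e p) = (coord (\<not> b) p - coord (\<not> b) v) ^ d * (\<Sum>e\<in>arms s b v. A e (coord b p))"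
  unfolding sum_distrib_left using J armsD(1,3,6) by (intro sum.cong) auto

text \<open>
  At an interior vertex a power in \<open>y\<close> times a function of \<open>x\<close> equals a power in \<open>x\<close> times a
  function of \<open>y\<close>, so each of the two functions is a constant multiple of the power in its variable.
\<close>

lemma balanced_if_jumps:
  assumes J: "\<And>e p. e \<in> interior_edges T \<Longrightarrow> jump P e p = (coord (\<not> dir e) p - lev e) ^ d * A e (coord (dir e) p)"
  shows "\<exists>\<delta>. balanced d A \<delta>"
proof -
  have "\<exists>k. \<forall>b x. (\<Sum>e\<in>arms True b v. A e x) - (\<Sum>e\<in>arms False b v. A e x) = k * (x - coord b v) ^ d"
    if v: "v \<in> interior_vertices T" for v
  proof -
    define X where "X x = (\<Sum>e\<in>arms True True v. A e x) - (\<Sum>e\<in>arms False True v. A e x)" for x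
    define Y where "Y y = (\<Sum>e\<in>arms True False v. A e y) - (\<Sum>e\<in>arms False False v. A e y)" for y
    let ?x = "coord True v" and ?y = "coord False v"
    have XY: "(y - ?y) ^ d * X x = (x - ?x) ^ d * Y y" for x y
    proof -
      have S: "(\<Sum>e\<in>arms s b v. jump P e p) = (coord (\<not> b) p - coord (\<not> b) v) ^ d * (\<Sum>e\<in>arms s b v. A e (coord b p))" for s b p
        by (rule sum_arms_factored) (rule J)
      show ?thesis using conformality_at_vertex[OF v, of P "point_at True x y"]
        unfolding S X_def Y_def
        by (simp add: right_diff_distrib)
    qed
    \<comment> \<open>At distance 1 from the vertex one of the powers is 1, which separates the variables.\<close>
    have X: "X x = Y (?y + 1) * (x - ?x) ^ d" for x using XY[of "?y + 1" x] by simp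
    have Y: "Y y = Y (?y + 1) * (y - ?y) ^ d" for y using XY[of y "?x + 1"] X[of "?x + 1"] by (simp add: mult.commute)
    show ?thesis
    proof (intro exI allI)
      fix b x
      show "(\<Sum>e\<in>arms True b v. A e x) - (\<Sum>e\<in>arms False b v. A e x) = Y (?y + 1) * (x - coord b v) ^ d"
        using X[of x] Y[of x] by (cases b) (simp_all add: X_def Y_def[abs_def])
    qed
  qed
  then obtain \<delta> where "\<And>v b x. v \<in> interior_vertices T \<Longrightarrow>
    (\<Sum>e\<in>arms True b v. A e x) - (\<Sum>e\<in>arms False b v. A e x) = \<delta> v * (x - coord b v) ^ d" by metis
  thus ?thesis unfolding balanced_def by blast
qed

text \<open>
  At a fixed point \<^term>\<open>q\<close> the jumps are numbers.  In the balance at a vertex the two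
  directions contribute the same number with opposite signs.
\<close>
lemma potential_of_balanced:
  assumes bal: "balanced d A \<delta>"
  shows "\<exists>u. \<forall>e\<in>interior_edges T. \<forall>f g. side T True e f \<longrightarrow> side T False e g \<longrightarrow>
    u f - u g = (coord (\<not> dir e) q - lev e) ^ d * A e (coord (dir e) q)"
proof (rule potential_exists)
  fix v assume v: "v \<in> interior_vertices T"
  define j where "j e = (coord (\<not> dir e) q - lev e) ^ d * A e (coord (dir e) q)" for e
  let ?I = "interior_edges T"
  have fin: "finite ?I" using finite_edges interior_edges_subset finite_subset by blast
  have arms: "(\<Sum>e\<in>arms s b v. j e) = (\<Sum>e\<in>?I. if dir e = b \<and> (if s then lower_end e else upper_end e) = v then j e else 0)" for s b
    unfolding arms_def using fin by (simp add: sum.inter_filter)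
  have diff: "(\<Sum>e\<in>arms True b v. j e) - (\<Sum>e\<in>arms False b v. j e) =
      (coord (\<not> b) q - coord (\<not> b) v) ^ d * (\<delta> v * (coord b q - coord b v) ^ d)" for b
  proof -
    have S: "(\<Sum>e\<in>arms s b v. j e) = (coord (\<not> b) q - coord (\<not> b) v) ^ d * (\<Sum>e\<in>arms s b v. A e (coord b q))" for s
      unfolding j_def by (rule sum_arms_factored) (rule refl)
    show ?thesis unfolding S using bal v by (simp add: balanced_def right_diff_distrib[symmetric])
  qed
  have "(\<Sum>e\<in>?I. sg (dir e) * j e * (of_bool (v = upper_end e) - of_bool (v = lower_end e))) =
      (\<Sum>e\<in>?I. ((if dir e = False \<and> lower_end e = v then j e else 0) - (if dir e = False \<and> upper_end e = v then j e else 0)) -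
        ((if dir e = True \<and> lower_end e = v then j e else 0) - (if dir e = True \<and> upper_end e = v then j e else 0)))"
    by (intro sum.cong) (auto simp: sg_def)
  also have "\<dots> = ((\<Sum>e\<in>arms True False v. j e) - (\<Sum>e\<in>arms False False v. j e)) -
      ((\<Sum>e\<in>arms True True v. j e) - (\<Sum>e\<in>arms False True v. j e))"
    unfolding arms sum_subtractf by simp
  also have "\<dots> = 0" unfolding diff by (simp add: mult_ac)
  finally show "(\<Sum>e\<in>?I. sg (dir e) * ((coord (\<not> dir e) q - lev e) ^ d * A e (coord (dir e) q)) *
      (of_bool (v = upper_end e) - of_bool (v = lower_end e))) = 0" by (simp add: j_def)
qed

end

section \<open>The dimension of the spline space\<close>

type_synonym index = "(nat \<times> nat) + (point set \<times> nat) + point"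

abbreviation (input) vidx :: "point \<Rightarrow> index" where "vidx v \<equiv> Inr (Inr v)"

text \<open>
  Expanding the powers turns the vanishing of a function along an l-edge into the conformality
  equations; the binomial coefficients are not zero.
\<close>
lemma moments:
  fixes \<delta> c :: "'a \<Rightarrow> real"
  shows "(\<forall>x. (\<Sum>v\<in>S. \<delta> v * (x - c v) ^ d) = 0) \<longleftrightarrow> (\<forall>k\<le>d. (\<Sum>v\<in>S. \<delta> v * c v ^ k) = 0)"
proof -
  define m where "m k = (\<Sum>v\<in>S. \<delta> v * c v ^ k)" for k
  have "(\<Sum>v\<in>S. \<delta> v * (x - c v) ^ d) = (\<Sum>k\<le>d. (real (d choose k) * (-1) ^ (d - k) * m (d - k)) * x ^ k)" for x
  proof -
    have "(x - c v) ^ d = (\<Sum>k\<le>d. real (d choose k) * x ^ k * (- c v) ^ (d - k))" for v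
      using binomial_ring[of x "- c v" d] by simp
    hence "(\<Sum>v\<in>S. \<delta> v * (x - c v) ^ d) =
        (\<Sum>v\<in>S. \<Sum>k\<le>d. \<delta> v * (real (d choose k) * x ^ k * (- c v) ^ (d - k)))"
      by (simp add: sum_distrib_left)
    also have "\<dots> = (\<Sum>k\<le>d. \<Sum>v\<in>S. \<delta> v * (real (d choose k) * x ^ k * (- c v) ^ (d - k)))"
      by (rule sum.swap)
    also have "\<dots> = (\<Sum>k\<le>d. (real (d choose k) * (-1) ^ (d - k) * m (d - k)) * x ^ k)"
    proof (rule sum.cong[OF refl])
      fix k
      have "\<delta> v * (real (d choose k) * x ^ k * (- c v) ^ (d - k)) =
          (real (d choose k) * (-1) ^ (d - k) * x ^ k) * (\<delta> v * c v ^ (d - k))" for v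
        by (subst power_minus) (simp add: mult_ac)
      hence "(\<Sum>v\<in>S. \<delta> v * (real (d choose k) * x ^ k * (- c v) ^ (d - k))) =
          (real (d choose k) * (-1) ^ (d - k) * x ^ k) * m (d - k)"
        unfolding m_def sum_distrib_left by (intro sum.cong) auto
      thus "(\<Sum>v\<in>S. \<delta> v * (real (d choose k) * x ^ k * (- c v) ^ (d - k))) =
          (real (d choose k) * (-1) ^ (d - k) * m (d - k)) * x ^ k" by (simp add: mult_ac)
    qed
    finally show ?thesis .
  qed
  hence "(\<forall>x. (\<Sum>v\<in>S. \<delta> v * (x - c v) ^ d) = 0) \<longleftrightarrow>
      (\<forall>k\<le>d. real (d choose k) * (-1) ^ (d - k) * m (d - k) = 0)"
    by (simp only: polyfun_eq_0)
  also have "\<dots> \<longleftrightarrow> (\<forall>k\<le>d. m (d - k) = 0)" by auto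
  also have "\<dots> \<longleftrightarrow> (\<forall>k\<le>d. m k = 0)"
    by (metis diff_diff_cancel diff_le_self)
  finally show ?thesis by (simp add: m_def)
qed

context T_mesh_geometry
begin

lemma jump_upto_add: "jump_upto d (\<lambda>v. \<delta> v + \<epsilon> v) l y x = jump_upto d \<delta> l y x + jump_upto d \<epsilon> l y x"
  unfolding jump_upto_def distrib_right sum.distrib ..

lemma jump_upto_cmult: "jump_upto d (\<lambda>v. c * \<delta> v) l y x = c * jump_upto d \<delta> l y x"
  unfolding jump_upto_def sum_distrib_left mult.assoc ..

lemma jump_total_add: "jump_total d (\<lambda>v. \<delta> v + \<epsilon> v) l x = jump_total d \<delta> l x + jump_total d \<epsilon> l x"
  unfolding jump_total_def distrib_right sum.distrib ..

lemma jump_total_cmult: "jump_total d (\<lambda>v. c * \<delta> v) l x = c * jump_total d \<delta> l x"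
  unfolding jump_total_def sum_distrib_left mult.assoc ..

text \<open>
  A spline is described by its polynomial on one cell, the jump polynomials with which the
  cross-cuts begin, and one number for every interior vertex.
\<close>

definition base_poly :: "nat \<Rightarrow> (index \<Rightarrow> real) \<Rightarrow> point \<Rightarrow> real" where
  "base_poly d \<phi> p = (\<Sum>i\<le>d. \<Sum>j\<le>d. \<phi> (Inl (i, j)) * fst p ^ i * snd p ^ j)"

text \<open>
  The factor of the jump at the lower end of an l-edge.  On a ray that ends in the interior at its
  upper end only, it is chosen such that the jump disappears there.
\<close>
definition start :: "nat \<Rightarrow> (index \<Rightarrow> real) \<Rightarrow> point set \<Rightarrow> real \<Rightarrow> real" where
  "start d \<phi> l x = (if lower_end l \<in> interior \<Omega> then 0
     else if upper_end l \<in> interior \<Omega> then - jump_total d (\<lambda>v. \<phi> (vidx v)) l x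
     else (\<Sum>k\<le>d. \<phi> (Inr (Inl (l, k))) * x ^ k))"

definition host :: "point set \<Rightarrow> point set" where
  "host e = (SOME l. l \<in> interior_l_edges T \<and> e \<subseteq> l)"

text \<open>
  The jump across \<^term>\<open>e\<close> is this polynomial times the power of the distance to the line of
  \<^term>\<open>e\<close>.
\<close>
definition factor :: "nat \<Rightarrow> (index \<Rightarrow> real) \<Rightarrow> point set \<Rightarrow> real \<Rightarrow> real" where
  "factor d \<phi> e x = start d \<phi> (host e) x + jump_upto d (\<lambda>v. \<phi> (vidx v)) (host e) (lo e) x"

lemma host: "e \<in> interior_edges T \<Longrightarrow> host e \<in> interior_l_edges T \<and> e \<subseteq> host e"
proof -
  assume "e \<in> interior_edges T"
  then obtain l where "l \<in> interior_l_edges T \<and> e \<subseteq> l"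
    using edge_in_max_segment[OF interior_edges_subset, of e] unfolding interior_l_edges_def by blast
  thus ?thesis unfolding host_def by (rule someI)
qed

lemma host_eq:
  assumes e: "e \<in> interior_edges T" and l: "l \<in> interior_l_edges T" "e \<subseteq> l"
  shows "host e = l"
proof -
  have se: "straight e" using e interior_edges_subset straight_edge by auto
  note h = host[OF e]
  have "dir (host e) = dir l"
    using straight_subset_parallel(1)[OF se straight_interior_l_edge, of l]
      straight_subset_parallel(1)[OF se straight_interior_l_edge, of "host e"] l h by simp
  moreover have "lower_end e \<in> host e" "lower_end e \<in> l" using ends_mem(1)[OF se] h l by auto
  ultimately show ?thesis using interior_l_edge_unique h l(1) by blast
qed

lemma base_poly_add: "base_poly d (\<phi> + \<psi>) p = base_poly d \<phi> p + base_poly d \<psi> p"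
  unfolding base_poly_def plus_fun_apply distrib_right sum.distrib ..

lemma base_poly_cmult: "base_poly d (scale_fun c \<phi>) p = c * base_poly d \<phi> p"
  unfolding base_poly_def sum_distrib_left mult.assoc ..

lemma start_add: "start d (\<phi> + \<psi>) l x = start d \<phi> l x + start d \<psi> l x"
  by (cases "lower_end l \<in> interior \<Omega>"; cases "upper_end l \<in> interior \<Omega>")
    (simp_all add: start_def jump_total_add sum.distrib distrib_right)

lemma start_cmult: "start d (scale_fun c \<phi>) l x = c * start d \<phi> l x"
  by (cases "lower_end l \<in> interior \<Omega>"; cases "upper_end l \<in> interior \<Omega>")
    (simp_all add: start_def jump_total_cmult sum_distrib_left mult.assoc)

lemma factor_add: "factor d (\<phi> + \<psi>) e x = factor d \<phi> e x + factor d \<psi> e x"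
  by (simp add: factor_def start_add jump_upto_add)

lemma factor_cmult: "factor d (scale_fun c \<phi>) e x = c * factor d \<phi> e x"
  by (simp add: factor_def start_cmult jump_upto_cmult distrib_left)

lemma upoly_factor: "upoly d (factor d \<phi> e)"
proof -
  have st: "upoly d (start d \<phi> l)" for l
  proof -
    have t: "upoly d (\<lambda>x. - jump_total d (\<lambda>v. \<phi> (vidx v)) l x)"
      using upoly_cmult[OF upoly_jump_total[of d "\<lambda>v. \<phi> (vidx v)" l], of "-1"] by simp
    have k: "upoly d (\<lambda>x. \<Sum>k\<le>d. \<phi> (Inr (Inl (l, k))) * x ^ k)"
      by (intro upoly_sum upoly_cmult upoly_monom) auto
    show ?thesis
    proof (cases "lower_end l \<in> interior \<Omega>"; cases "upper_end l \<in> interior \<Omega>")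
      assume "lower_end l \<notin> interior \<Omega>" "upper_end l \<in> interior \<Omega>"
      thus ?thesis using t by (simp add: start_def[abs_def])
    next
      assume "lower_end l \<notin> interior \<Omega>" "upper_end l \<notin> interior \<Omega>"
      thus ?thesis using k by (simp add: start_def[abs_def])
    qed (simp_all add: start_def[abs_def] upoly_zero)
  qed
  thus ?thesis unfolding factor_def[abs_def] by (intro upoly_add st upoly_jump_upto)
qed

lemma bipoly_base_poly: "bipoly d (base_poly d \<phi>)"
  unfolding bipoly_def base_poly_def by (intro exI[of _ "\<lambda>i j. \<phi> (Inl (i, j))"] allI refl)

definition index_set :: "nat \<Rightarrow> index set" where
  "index_set d = Inl ` ({..d} \<times> {..d}) \<union> (\<lambda>x. Inr (Inl x)) ` (cross_cuts T \<times> {..d}) \<union> vidx ` interior_vertices T"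

text \<open>
  The conformality equations of all T l-edges are the only constraints.
\<close>
definition parameters :: "nat \<Rightarrow> (index \<Rightarrow> real) set" where
  "parameters d = {\<phi> \<in> supported_on (index_set d).
     \<forall>l\<in>T_l_edges T. \<forall>k\<le>d. (\<Sum>v\<in>interior_vertices T \<inter> l. \<phi> (vidx v) * coord (dir l) v ^ k) = 0}"

lemma finite_cross_cuts: "finite (cross_cuts T)"
  using finite_l_edges by (rule finite_subset[rotated]) (auto simp: cross_cuts_def l_edges_def)

lemma finite_index_set: "finite (index_set d)"
  using finite_cross_cuts finite_interior_vertices by (simp add: index_set_def)

lemma card_index_set:
  "card (index_set d) = (d + 1)\<^sup>2 + (d + 1) * card (cross_cuts T) + card (interior_vertices T)"
proof -
  have "card (index_set d) = card (Inl ` ({..d} \<times> {..d}) :: index set) +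
      card ((\<lambda>x. Inr (Inl x)) ` (cross_cuts T \<times> {..d}) :: index set) + card (vidx ` interior_vertices T :: index set)"
    unfolding index_set_def using finite_cross_cuts finite_interior_vertices
    by (subst card_Un_disjoint, simp, simp, blast, subst card_Un_disjoint) auto
  also have "\<dots> = card ({..d} \<times> {..d}) + card (cross_cuts T \<times> {..d}) + card (interior_vertices T)"
    by (simp add: card_image inj_on_def)
  finally show ?thesis by (simp add: card_cartesian_product power2_eq_square mult.commute)
qed

lemma dim_parameters:
  "fun_space.subspace (parameters d)"
  "fun_space.dim (parameters d) + conformality_rank d (part1 T (T_l_edges T)) =
    (d + 1)\<^sup>2 + (d + 1) * card (cross_cuts T) + card (interior_vertices T)"
proof -
  \<comment> \<open>Vertices outside \<open>interior_vertices T\<close> do not lie on T l-edges, so the rows vanish there.\<close>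
  define h where "h = (\<lambda>v. vidx v)"
  have h: "inj h" by (simp add: h_def inj_def)
  define E where "E f j = (if j \<in> range h then f (inv h j) else 0)" for f :: "point \<Rightarrow> real" and j :: index
  define R where "R = (\<Union>l\<in>T_l_edges T. moment_row l ` {..d})"
  have Eh: "E f (vidx v) = f v" for f v
    using inv_f_f[OF h, of v] by (auto simp: E_def h_def)
  have Vi: "vertices T \<inter> l = interior_vertices T \<inter> l" if "l \<in> T_l_edges T" for l
    using T_l_edge_subset_interior[OF that] by (auto simp: interior_vertices_def)
  have rowsupp: "E f \<in> supported_on (index_set d)" if f: "f \<in> R" for f
  proof -
    obtain l k where l: "l \<in> T_l_edges T" "f = moment_row l k" using f by (auto simp: R_def)
    have "E f j = 0" if j: "j \<notin> index_set d" for j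
    proof (cases "j \<in> range h")
      case True
      then obtain v where v: "j = vidx v" by (auto simp: h_def)
      hence "v \<notin> interior_vertices T" using j by (auto simp: index_set_def)
      hence "v \<notin> vertices T \<inter> l" using Vi[OF l(1)] by auto
      hence "f v = 0" unfolding l(2) moment_row_def by (rule if_not_P)
      thus ?thesis using v Eh by simp
    qed (simp add: E_def)
    thus ?thesis by (simp add: supported_on_def)
  qed
  have pair: "(\<Sum>i\<in>index_set d. E (moment_row l k) i * \<phi> i) = (\<Sum>v\<in>interior_vertices T \<inter> l. \<phi> (vidx v) * coord (dir l) v ^ k)"
    if l: "l \<in> T_l_edges T" for l k \<phi>
  proof -
    have "(\<Sum>i\<in>index_set d. E (moment_row l k) i * \<phi> i) = (\<Sum>i\<in>h ` interior_vertices T. E (moment_row l k) i * \<phi> i)"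
    proof (rule sum.mono_neutral_right[OF finite_index_set])
      show "h ` interior_vertices T \<subseteq> index_set d" by (auto simp: h_def index_set_def)
      show "\<forall>i\<in>index_set d - h ` interior_vertices T. E (moment_row l k) i * \<phi> i = 0"
      proof
        fix i assume "i \<in> index_set d - h ` interior_vertices T"
        hence "i \<notin> range h" by (auto simp: h_def index_set_def)
        thus "E (moment_row l k) i * \<phi> i = 0" by (simp add: E_def)
      qed
    qed
    also have "\<dots> = (\<Sum>v\<in>interior_vertices T. moment_row l k v * \<phi> (vidx v))"
      using h by (subst sum.reindex) (auto simp: h_def Eh inj_on_def)
    also have "\<dots> = (\<Sum>v\<in>interior_vertices T \<inter> l. moment_row l k v * \<phi> (vidx v))"
      using finite_interior_vertices by (intro sum.mono_neutral_right) (auto simp: moment_row_def)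
    also have "\<dots> = (\<Sum>v\<in>interior_vertices T \<inter> l. \<phi> (vidx v) * coord (dir l) v ^ k)"
      using Vi[OF l] by (intro sum.cong) (auto simp: moment_row_def mult.commute)
    finally show ?thesis .
  qed
  have eq: "parameters d = annihilator_on (index_set d) (E ` R)"
    unfolding parameters_def annihilator_on_def using pair by (auto simp: R_def)
  show "fun_space.subspace (parameters d)" unfolding eq by (rule subspace_annihilator_on)
  have "finite (E ` R)" unfolding R_def using finite_T_l_edges by auto
  moreover have "E ` R \<subseteq> supported_on (index_set d)" using rowsupp by auto
  ultimately have "fun_space.dim (parameters d) + fun_space.dim (E ` R) = card (index_set d)"
    unfolding eq using dim_annihilator_on[OF finite_index_set] by blast
  moreover have "fun_space.dim (E ` R) = fun_space.dim R"
    unfolding E_def[abs_def] by (rule dim_image_column_embedding[OF h])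
  moreover have "fun_space.dim R = conformality_rank d (part1 T (T_l_edges T))"
    unfolding conformality_rank_def matrix_rank_def rows_part1 R_def ..
  ultimately show "fun_space.dim (parameters d) + conformality_rank d (part1 T (T_l_edges T)) =
    (d + 1)\<^sup>2 + (d + 1) * card (cross_cuts T) + card (interior_vertices T)"
    using card_index_set by simp
qed

lemma chain_factor:
  assumes \<phi>: "\<phi> \<in> parameters d" and l: "l \<in> interior_l_edges T"
  shows "chain d (factor d \<phi>) (\<lambda>v. \<phi> (vidx v)) l (start d \<phi> l)"
  unfolding chain_def
proof (intro conjI ballI impI allI)
  fix e x assume "e \<in> interior_edges T" "e \<subseteq> l"
  thus "factor d \<phi> e x = start d \<phi> l x + jump_upto d (\<lambda>v. \<phi> (vidx v)) l (lo e) x"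
    using host_eq[OF _ l] by (simp add: factor_def)
next
  fix x assume "lower_end l \<in> interior \<Omega>"
  thus "start d \<phi> l x = 0" by (simp add: start_def)
next
  fix x assume u: "upper_end l \<in> interior \<Omega>"
  show "start d \<phi> l x + jump_total d (\<lambda>v. \<phi> (vidx v)) l x = 0"
  proof (cases "lower_end l \<in> interior \<Omega>")
    case True
    have "endpoints l \<subseteq> interior_vertices T"
      using True u max_segment_ends_vertices[OF interior_edges_subset] l endpoints_straight[OF straight_interior_l_edge[OF l]]
      by (auto simp: interior_vertices_def interior_l_edges_def)
    hence "l \<in> T_l_edges T" using l by (simp add: T_l_edges_def)
    hence "\<forall>k\<le>d. (\<Sum>v\<in>interior_vertices T \<inter> l. \<phi> (vidx v) * coord (dir l) v ^ k) = 0"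
      using \<phi> by (simp add: parameters_def)
    hence "jump_total d (\<lambda>v. \<phi> (vidx v)) l x = 0" unfolding jump_total_def
      using moments[where d = d and \<delta> = "\<lambda>v. \<phi> (vidx v)" and c = "coord (dir l)" and S = "interior_vertices T \<inter> l"] by simp
    thus ?thesis using True by (simp add: start_def)
  next
    case False
    thus ?thesis using u by (simp add: start_def)
  qed
qed

lemma balanced_factor: "\<phi> \<in> parameters d \<Longrightarrow> balanced d (factor d \<phi>) (\<lambda>v. \<phi> (vidx v))"
  using chain_factor by (intro balanced_if_chains) blast

definition describes :: "nat \<Rightarrow> point set \<Rightarrow> (point \<Rightarrow> real) \<Rightarrow> (index \<Rightarrow> real) \<Rightarrow> bool" where
  "describes d f0 s \<phi> \<longleftrightarrow> (\<forall>p. p \<notin> \<Omega> \<longrightarrow> s p = 0) \<and>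
     (\<exists>P. (\<forall>f\<in>cells T. \<forall>p\<in>f. s p = P f p) \<and> P f0 = base_poly d \<phi> \<and>
       (\<forall>e\<in>interior_edges T. \<forall>f g p. side T True e f \<longrightarrow> side T False e g \<longrightarrow>
          P f p - P g p = (coord (\<not> dir e) p - lev e) ^ d * factor d \<phi> e (coord (dir e) p)))"

lemma describesE:
  assumes "describes d f0 s \<phi>"
  obtains P where "\<And>p. p \<notin> \<Omega> \<Longrightarrow> s p = 0" "\<And>f p. f \<in> cells T \<Longrightarrow> p \<in> f \<Longrightarrow> s p = P f p" "P f0 = base_poly d \<phi>"
    "\<And>e f g p. e \<in> interior_edges T \<Longrightarrow> side T True e f \<Longrightarrow> side T False e g \<Longrightarrow>
      P f p - P g p = (coord (\<not> dir e) p - lev e) ^ d * factor d \<phi> e (coord (dir e) p)"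
proof -
  from assms obtain P where P: "\<forall>f\<in>cells T. \<forall>p\<in>f. s p = P f p" "P f0 = base_poly d \<phi>"
    "\<forall>e\<in>interior_edges T. \<forall>f g p. side T True e f \<longrightarrow> side T False e g \<longrightarrow>
      P f p - P g p = (coord (\<not> dir e) p - lev e) ^ d * factor d \<phi> e (coord (dir e) p)"
    unfolding describes_def by (elim conjE exE)
  show thesis
  proof (rule that[of P])
    show "s p = 0" if "p \<notin> \<Omega>" for p using assms[unfolded describes_def, THEN conjunct1] that by blast
    show "s p = P f p" if "f \<in> cells T" "p \<in> f" for f p using P(1) that by blast
    show "P f0 = base_poly d \<phi>" by (rule P(2))
    show "P f p - P g p = (coord (\<not> dir e) p - lev e) ^ d * factor d \<phi> e (coord (dir e) p)"
      if "e \<in> interior_edges T" "side T True e f" "side T False e g" for e f g p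
      using P(3) that by blast
  qed
qed

lemma describesI:
  assumes "\<And>p. p \<notin> \<Omega> \<Longrightarrow> s p = 0" "\<And>f p. f \<in> cells T \<Longrightarrow> p \<in> f \<Longrightarrow> s p = P f p" "P f0 = base_poly d \<phi>"
    "\<And>e f g p. e \<in> interior_edges T \<Longrightarrow> side T True e f \<Longrightarrow> side T False e g \<Longrightarrow>
      P f p - P g p = (coord (\<not> dir e) p - lev e) ^ d * factor d \<phi> e (coord (dir e) p)"
  shows "describes d f0 s \<phi>"
  unfolding describes_def using assms(1-3) by (intro conjI exI[of _ P] ballI allI impI assms(4)) auto

lemma describes_add:
  assumes "describes d f0 s \<phi>" "describes d f0 s' \<phi>'"
  shows "describes d f0 (s + s') (\<phi> + \<phi>')"
proof -
  from assms(1) obtain P where P: "\<And>p. p \<notin> \<Omega> \<Longrightarrow> s p = 0" "\<And>f p. f \<in> cells T \<Longrightarrow> p \<in> f \<Longrightarrow> s p = P f p" "P f0 = base_poly d \<phi>"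
    "\<And>e f g p. e \<in> interior_edges T \<Longrightarrow> side T True e f \<Longrightarrow> side T False e g \<Longrightarrow>
      P f p - P g p = (coord (\<not> dir e) p - lev e) ^ d * factor d \<phi> e (coord (dir e) p)"
    by (rule describesE) blast
  from assms(2) obtain Q where Q: "\<And>p. p \<notin> \<Omega> \<Longrightarrow> s' p = 0" "\<And>f p. f \<in> cells T \<Longrightarrow> p \<in> f \<Longrightarrow> s' p = Q f p" "Q f0 = base_poly d \<phi>'"
    "\<And>e f g p. e \<in> interior_edges T \<Longrightarrow> side T True e f \<Longrightarrow> side T False e g \<Longrightarrow>
      Q f p - Q g p = (coord (\<not> dir e) p - lev e) ^ d * factor d \<phi>' e (coord (dir e) p)"
    by (rule describesE) blast
  show ?thesis
  proof (rule describesI[where P = "\<lambda>f p. P f p + Q f p"])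
    show "(s + s') p = 0" if "p \<notin> \<Omega>" for p using P(1) Q(1) that by simp
    show "(s + s') p = P f p + Q f p" if "f \<in> cells T" "p \<in> f" for f p using P(2)[OF that] Q(2)[OF that] by simp
    show "(\<lambda>p. P f0 p + Q f0 p) = base_poly d (\<phi> + \<phi>')" by (intro ext) (simp add: P(3) Q(3) base_poly_add)
    show "P f p + Q f p - (P g p + Q g p) = (coord (\<not> dir e) p - lev e) ^ d * factor d (\<phi> + \<phi>') e (coord (dir e) p)"
      if "e \<in> interior_edges T" "side T True e f" "side T False e g" for e f g p
      using P(4)[OF that, of p] Q(4)[OF that, of p] by (simp add: factor_add distrib_left)
  qed
qed

lemma describes_scale:
  assumes "describes d f0 s \<phi>"
  shows "describes d f0 (scale_fun c s) (scale_fun c \<phi>)"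
proof -
  from assms obtain P where P: "\<And>p. p \<notin> \<Omega> \<Longrightarrow> s p = 0" "\<And>f p. f \<in> cells T \<Longrightarrow> p \<in> f \<Longrightarrow> s p = P f p" "P f0 = base_poly d \<phi>"
    "\<And>e f g p. e \<in> interior_edges T \<Longrightarrow> side T True e f \<Longrightarrow> side T False e g \<Longrightarrow>
      P f p - P g p = (coord (\<not> dir e) p - lev e) ^ d * factor d \<phi> e (coord (dir e) p)"
    by (rule describesE) blast
  show ?thesis
  proof (rule describesI[where P = "\<lambda>f p. c * P f p"])
    show "c * s p = 0" if "p \<notin> \<Omega>" for p using P(1)[OF that] by simp
    show "c * s p = c * P f p" if "f \<in> cells T" "p \<in> f" for f p using P(2)[OF that] by simp
    show "(\<lambda>p. c * P f0 p) = base_poly d (scale_fun c \<phi>)" by (intro ext) (simp add: P(3) base_poly_cmult)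
    show "c * P f p - c * P g p = (coord (\<not> dir e) p - lev e) ^ d * factor d (scale_fun c \<phi>) e (coord (dir e) p)"
      if "e \<in> interior_edges T" "side T True e f" "side T False e g" for e f g p
      unfolding right_diff_distrib[symmetric] P(4)[OF that] factor_cmult by (rule mult.left_commute)
  qed
qed

lemma describes_total:
  assumes d: "1 \<le> d" and f0: "f0 \<in> cells T" and s: "s \<in> spline_space d T"
  shows "\<exists>\<phi>\<in>parameters d. describes d f0 s \<phi>"
proof -
  from s obtain P where z: "\<And>p. p \<notin> \<Omega> \<Longrightarrow> s p = 0" and P: "\<And>f. f \<in> cells T \<Longrightarrow> bipoly d (P f)"
    "\<And>f p. f \<in> cells T \<Longrightarrow> p \<in> f \<Longrightarrow> s p = P f p" and sm: "smooth_jumps d P"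
    unfolding spline_space_iff[OF d] by blast
  define A where "A e x = jump P e (point_at (dir e) x (lev e + 1))" for e x
  have J: "jump P e p = (coord (\<not> dir e) p - lev e) ^ d * A e (coord (dir e) p)" if e: "e \<in> interior_edges T" for e p
  proof -
    obtain f where f: "side T True e f" using interior_edgeD(2)[OF e] by blast
    obtain g where g: "side T False e g" using interior_edgeD(2)[OF e] by blast
    note j = jump_eq[OF interior_edgeD(1)[OF e] f g]
    show ?thesis unfolding A_def j using sm e f g unfolding smooth_jumps_def by blast
  qed
  have uA: "upoly d (A e)" if e: "e \<in> interior_edges T" for e
  proof -
    obtain f where f: "side T True e f" using interior_edgeD(2)[OF e] by blast
    obtain g where g: "side T False e g" using interior_edgeD(2)[OF e] by blast
    have "upoly d (\<lambda>x. P f (point_at (dir e) x (lev e + 1)) - P g (point_at (dir e) x (lev e + 1)))"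
      by (intro upoly_diff bipoly_slice P sideD(1)[OF f] sideD(1)[OF g])
    thus ?thesis unfolding A_def[abs_def] jump_eq[OF interior_edgeD(1)[OF e] f g] .
  qed
  obtain \<delta> where \<delta>: "balanced d A \<delta>" using balanced_if_jumps[of P d A] J by blast
  have "\<forall>l\<in>interior_l_edges T. \<exists>a. chain d A \<delta> l a" using chain_if_balanced[OF \<delta>] by blast
  then obtain a where a: "\<And>l. l \<in> interior_l_edges T \<Longrightarrow> chain d A \<delta> l (a l)" by metis
  have ua: "upoly d (a l)" if l: "l \<in> interior_l_edges T" for l
  proof -
    have sl: "straight l" using straight_interior_l_edge[OF l] .
    obtain e where e: "e \<in> interior_edges T" "e \<subseteq> l"
      using max_segment_covered[OF interior_edges_subset _ ends_mem(1)[OF sl]] l by (auto simp: interior_l_edges_def)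
    have "a l x = A e x - jump_upto d \<delta> l (lo e) x" for x using a[OF l] e by (simp add: chain_def)
    hence "a l = (\<lambda>x. A e x - jump_upto d \<delta> l (lo e) x)" by (intro ext)
    thus ?thesis using upoly_diff[OF uA[OF e(1)] upoly_jump_upto] by metis
  qed
  have "\<forall>l\<in>interior_l_edges T. \<exists>c. \<forall>x. a l x = (\<Sum>k\<le>d. c k * x ^ k)" using upoly_coeffs[OF ua] by blast
  then obtain c where c: "\<And>l x. l \<in> interior_l_edges T \<Longrightarrow> a l x = (\<Sum>k\<le>d. c l k * x ^ k)" by metis
  obtain m where m: "\<And>p. P f0 p = (\<Sum>i\<le>d. \<Sum>j\<le>d. m i j * fst p ^ i * snd p ^ j)"
    using P(1)[OF f0] unfolding bipoly_def by blast
  define \<phi> where "\<phi> i = (case i of Inl (i, j) \<Rightarrow> if i \<le> d \<and> j \<le> d then m i j else 0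
    | Inr (Inl (l, k)) \<Rightarrow> if l \<in> cross_cuts T \<and> k \<le> d then c l k else 0
    | Inr (Inr v) \<Rightarrow> if v \<in> interior_vertices T then \<delta> v else 0)" for i :: index
  have hs: "jump_upto d (\<lambda>v. \<phi> (vidx v)) l y x = jump_upto d \<delta> l y x" for l y x
    unfolding jump_upto_def by (intro sum.cong) (auto simp: \<phi>_def)
  have tt: "jump_total d (\<lambda>v. \<phi> (vidx v)) l x = jump_total d \<delta> l x" for l x
    unfolding jump_total_def by (intro sum.cong) (auto simp: \<phi>_def)
  have st: "start d \<phi> l x = a l x" if l: "l \<in> interior_l_edges T" for l x
  proof -
    have ch: "chain d A \<delta> l (a l)" using a[OF l] .
    consider "lower_end l \<in> interior \<Omega>" | "lower_end l \<notin> interior \<Omega>" "upper_end l \<in> interior \<Omega>"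
      | "lower_end l \<notin> interior \<Omega>" "upper_end l \<notin> interior \<Omega>" by blast
    thus ?thesis
    proof cases
      case 1 thus ?thesis using ch by (simp add: start_def chain_def)
    next
      case 2
      hence "a l x + jump_total d \<delta> l x = 0" using ch by (simp add: chain_def)
      thus ?thesis using 2 by (simp add: start_def tt)
    next
      case 3
      have "l \<in> cross_cuts T"
        using 3 l max_segment_ends_vertices[OF interior_edges_subset] endpoints_straight[OF straight_interior_l_edge[OF l]]
        by (auto simp: cross_cuts_def boundary_vertices_def interior_l_edges_def)
      thus ?thesis using 3 c[OF l] by (simp add: start_def \<phi>_def)
    qed
  qed
  have fa: "factor d \<phi> e x = A e x" if e: "e \<in> interior_edges T" for e x
    using a[of "host e"] host[OF e] st[of "host e" x] e by (simp add: factor_def hs chain_def)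
  have "\<phi> \<in> parameters d"
  proof -
    have "\<phi> i = 0" if "i \<notin> index_set d" for i
      using that by (auto simp: \<phi>_def index_set_def split: sum.splits)
    moreover have "(\<Sum>v\<in>interior_vertices T \<inter> l. \<phi> (vidx v) * coord (dir l) v ^ k) = 0" if l: "l \<in> T_l_edges T" and k: "k \<le> d" for l k
    proof -
      have li: "l \<in> interior_l_edges T" using l by (simp add: T_l_edges_def)
      have "lower_end l \<in> interior \<Omega>" "upper_end l \<in> interior \<Omega>"
        using T_l_edge_subset_interior[OF l] ends_mem[OF straight_interior_l_edge[OF li]] by auto
      hence "a l x = 0" "a l x + jump_total d \<delta> l x = 0" for x using a[OF li] unfolding chain_def by blast+
      hence "jump_total d \<delta> l x = 0" for x by (metis add_0)
      hence "\<forall>x. (\<Sum>v\<in>interior_vertices T \<inter> l. \<phi> (vidx v) * (x - coord (dir l) v) ^ d) = 0"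
        using tt by (simp add: jump_total_def)
      thus ?thesis using k moments[where d = d and \<delta> = "\<lambda>v. \<phi> (vidx v)" and c = "coord (dir l)" and S = "interior_vertices T \<inter> l"] by simp
    qed
    ultimately show ?thesis by (simp add: parameters_def supported_on_def)
  qed
  moreover have "describes d f0 s \<phi>"
  proof (rule describesI[OF z P(2)])
    show "P f0 = base_poly d \<phi>" by (intro ext) (simp add: m base_poly_def \<phi>_def)
    show "P f p - P g p = (coord (\<not> dir e) p - lev e) ^ d * factor d \<phi> e (coord (dir e) p)"
      if e: "e \<in> interior_edges T" and fg: "side T True e f" "side T False e g" for e f g p
      using J[OF e, of p] jump_eq[OF interior_edgeD(1)[OF e] fg, of P p] fa[OF e] by simp
  qed
  ultimately show ?thesis by blast
qed

text \<open>
  Starting from one cell, every jump adds a polynomial of bidegree at most \<^term>\<open>(d, d)\<close>.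
\<close>
lemma bipoly_cells:
  assumes f0: "f0 \<in> cells T" "bipoly d (P f0)" and f: "f \<in> cells T"
    and J: "\<And>e f g p. e \<in> interior_edges T \<Longrightarrow> side T True e f \<Longrightarrow> side T False e g \<Longrightarrow>
      P f p - P g p = (coord (\<not> dir e) p - lev e) ^ d * factor d \<phi> e (coord (dir e) p)"
  shows "bipoly d (P f)"
proof -
  have "bipoly d (P f) = bipoly d (P f0)"
  proof (rule cells_agree[OF f f0(1), where K = "\<lambda>f. bipoly d (P f)"])
    fix e f g assume e: "e \<in> interior_edges T" "side T True e f" "side T False e g"
    have j: "bipoly d (\<lambda>p. P f p - P g p)"
      unfolding J[OF e] by (rule bipoly_product[OF upoly_factor upoly_power])
    have "P f = (\<lambda>p. P g p + (P f p - P g p))" "P g = (\<lambda>p. P f p - (P f p - P g p))" by auto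
    thus "bipoly d (P f) = bipoly d (P g)" using bipoly_add[OF _ j] bipoly_diff[OF _ j] by metis
  qed
  thus ?thesis using f0 by simp
qed

text \<open>
  Applied at every point \<^term>\<open>q\<close> separately, the potential yields the values at \<^term>\<open>q\<close> of the
  polynomials of all cells.
\<close>
lemma describes_onto:
  assumes d: "1 \<le> d" and f0: "f0 \<in> cells T" and \<phi>: "\<phi> \<in> parameters d"
  shows "\<exists>s\<in>spline_space d T. describes d f0 s \<phi>"
proof -
  have "\<forall>q. \<exists>u. \<forall>e\<in>interior_edges T. \<forall>f g. side T True e f \<longrightarrow> side T False e g \<longrightarrow>
      u f - u g = (coord (\<not> dir e) q - lev e) ^ d * factor d \<phi> e (coord (dir e) q)"
    using potential_of_balanced[OF balanced_factor[OF \<phi>]] by blast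
  then obtain u where u: "\<And>q e f g. e \<in> interior_edges T \<Longrightarrow> side T True e f \<Longrightarrow> side T False e g \<Longrightarrow>
      u q f - u q g = (coord (\<not> dir e) q - lev e) ^ d * factor d \<phi> e (coord (dir e) q)" by metis
  define P where "P f q = u q f - u q f0 + base_poly d \<phi> q" for f q
  have J: "P f p - P g p = (coord (\<not> dir e) p - lev e) ^ d * factor d \<phi> e (coord (dir e) p)"
    if "e \<in> interior_edges T" "side T True e f" "side T False e g" for e f g p
    using u[OF that, of p] by (simp add: P_def)
  have P0: "P f0 = base_poly d \<phi>" by (intro ext) (simp add: P_def)
  have bP: "bipoly d (P f)" if "f \<in> cells T" for f
    using bipoly_cells[where P = P, OF f0 _ that J] bipoly_base_poly P0 by simp
  have agree: "P f p = P g p" if fg: "f \<in> cells T" "g \<in> cells T" "p \<in> f" "p \<in> g" for f g p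
  proof (rule cells_agree_at_point[OF fg, where K = "\<lambda>f. P f p"])
    fix e f g assume e: "e \<in> interior_edges T" "p \<in> e" "side T True e f" "side T False e g"
    have "coord (\<not> dir e) p = lev e" using e(2) mem_straight straight_edge interior_edgeD(1)[OF e(1)] by blast
    thus "P f p = P g p" using J[OF e(1,3,4), of p] d by (simp add: power_0_left)
  qed
  define s where "s p = (if p \<in> \<Omega> then P (SOME f. f \<in> cells T \<and> p \<in> f) p else 0)" for p
  have sP: "s p = P f p" if f: "f \<in> cells T" "p \<in> f" for f p
  proof -
    have "(SOME f. f \<in> cells T \<and> p \<in> f) \<in> cells T \<and> p \<in> (SOME f. f \<in> cells T \<and> p \<in> f)"
      by (rule someI[of _ f]) (use f in simp)
    moreover have "p \<in> \<Omega>" using f by (auto simp: dom_of_def)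
    ultimately show ?thesis unfolding s_def using agree[OF _ f(1) _ f(2)] by simp
  qed
  have "smooth_jumps d P" unfolding smooth_jumps_def
  proof (intro ballI allI impI)
    fix e f g p assume e: "e \<in> interior_edges T" "side T True e f" "side T False e g"
    show "P f p - P g p = (coord (\<not> dir e) p - lev e) ^ d *
       (P f (point_at (dir e) (coord (dir e) p) (lev e + 1)) - P g (point_at (dir e) (coord (dir e) p) (lev e + 1)))"
      unfolding J[OF e] by simp
  qed
  hence "s \<in> spline_space d T" unfolding spline_space_iff[OF d] using bP sP
    by (intro conjI exI[of _ P]) (auto simp: s_def)
  moreover have "describes d f0 s \<phi>"
    by (rule describesI[where P = P, OF _ sP P0 J]) (simp_all add: s_def)
  ultimately show ?thesis by blast
qed

lemma describes_zero_right:
  assumes f0: "f0 \<in> cells T" and s: "describes d f0 s 0"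
  shows "s = 0"
proof -
  obtain P where z: "\<And>p. p \<notin> \<Omega> \<Longrightarrow> s p = 0"
    and P: "\<And>f p. f \<in> cells T \<Longrightarrow> p \<in> f \<Longrightarrow> s p = P f p" "P f0 = base_poly d 0"
    "\<And>e f g p. e \<in> interior_edges T \<Longrightarrow> side T True e f \<Longrightarrow> side T False e g \<Longrightarrow>
      P f p - P g p = (coord (\<not> dir e) p - lev e) ^ d * factor d 0 e (coord (dir e) p)"
    using s by (rule describesE) blast
  have f0z: "factor d 0 e x = 0" for e x
    using factor_cmult[of d 0 0 e x] by (simp add: zero_fun_def)
  have b0: "base_poly d 0 p = 0" for p by (simp add: base_poly_def)
  have "P f = P f0" if f: "f \<in> cells T" for f
  proof (rule cells_agree[OF f f0, where K = P])
    fix e f g assume "e \<in> interior_edges T" "side T True e f" "side T False e g"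
    thus "P f = P g" using P(3)[of e f g] by (intro ext) (simp add: f0z)
  qed
  hence "s p = 0" if "f \<in> cells T" "p \<in> f" for f p using P(1)[OF that] P(2) b0 that by simp
  hence on: "s p = 0" if "f \<in> cells T" "p \<in> f" for f p using that by blast
  have "s p = 0" for p
  proof (cases "p \<in> \<Omega>")
    case True
    then obtain f where "f \<in> cells T" "p \<in> f" by (auto simp: dom_of_def)
    thus ?thesis by (rule on)
  qed (rule z)
  thus ?thesis by (intro ext) simp
qed

lemma describes_zero_left:
  assumes f0: "f0 \<in> cells T" and \<phi>: "\<phi> \<in> parameters d" and s: "describes d f0 0 \<phi>"
  shows "\<phi> = 0"
proof -
  obtain P where P: "\<And>f p. f \<in> cells T \<Longrightarrow> p \<in> f \<Longrightarrow> P f p = 0" "P f0 = base_poly d \<phi>"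
    and J: "\<And>e f g p. e \<in> interior_edges T \<Longrightarrow> side T True e f \<Longrightarrow> side T False e g \<Longrightarrow>
      P f p - P g p = (coord (\<not> dir e) p - lev e) ^ d * factor d \<phi> e (coord (dir e) p)"
  proof -
    from s obtain P where "\<And>f p. f \<in> cells T \<Longrightarrow> p \<in> f \<Longrightarrow> (0 :: point \<Rightarrow> real) p = P f p" "P f0 = base_poly d \<phi>"
      "\<And>e f g p. e \<in> interior_edges T \<Longrightarrow> side T True e f \<Longrightarrow> side T False e g \<Longrightarrow>
        P f p - P g p = (coord (\<not> dir e) p - lev e) ^ d * factor d \<phi> e (coord (dir e) p)"
      by (rule describesE) blast
    thus thesis by (intro that[of P]) auto
  qed
  have Pz: "P f p = 0" if f: "f \<in> cells T" for f p
    using bipoly_zero_on_rectangle[OF bipoly_cells[where P = P, OF f0 _ f J] rectangle_cell[OF f] P(1)[OF f]] P(2) bipoly_base_poly by simp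
  have base0: "\<phi> (Inl (i, j)) = 0" if "i \<le> d" "j \<le> d" for i j
    by (rule bipoly_coeffs_zero[where c = "\<lambda>i j. \<phi> (Inl (i, j))", OF _ that])
      (use Pz[OF f0] P(2) in \<open>simp add: base_poly_def[symmetric]\<close>)
  have fz: "factor d \<phi> e x = 0" if e: "e \<in> interior_edges T" for e x
  proof -
    obtain f where f: "side T True e f" using interior_edgeD(2)[OF e] by blast
    obtain g where g: "side T False e g" using interior_edgeD(2)[OF e] by blast
    show ?thesis using J[OF e f g, of "point_at (dir e) x (lev e + 1)"] Pz sideD(1)[OF f] sideD(1)[OF g] by simp
  qed
  have vz: "\<phi> (vidx v) = 0" if v: "v \<in> interior_vertices T" for v
  proof -
    have "(\<Sum>e\<in>arms s True v. factor d \<phi> e x) = 0" for s x using fz armsD(1) by (intro sum.neutral) blast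
    moreover have "(\<Sum>e\<in>arms True True v. factor d \<phi> e x) - (\<Sum>e\<in>arms False True v. factor d \<phi> e x) =
        \<phi> (vidx v) * (x - coord True v) ^ d" for x
      using balanced_factor[OF \<phi>] v unfolding balanced_def by blast
    ultimately show ?thesis by (metis diff_self add_diff_cancel_left' mult.right_neutral power_one)
  qed
  have cz: "\<phi> (Inr (Inl (l, k))) = 0" if l: "l \<in> cross_cuts T" and k: "k \<le> d" for l k
  proof -
    have li: "l \<in> interior_l_edges T" using l by (simp add: cross_cuts_def)
    have sl: "straight l" using straight_interior_l_edge[OF li] .
    obtain e where e: "e \<in> interior_edges T" "e \<subseteq> l"
      using max_segment_covered[OF interior_edges_subset _ ends_mem(1)[OF sl]] li by (auto simp: interior_l_edges_def)
    have "lower_end l \<notin> interior \<Omega>" "upper_end l \<notin> interior \<Omega>"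
      using l endpoints_straight[OF sl] by (auto simp: cross_cuts_def boundary_vertices_def)
    hence "factor d \<phi> e x = (\<Sum>k\<le>d. \<phi> (Inr (Inl (l, k))) * x ^ k)" for x
      using vz by (simp add: factor_def start_def host_eq[OF e(1) li e(2)] jump_upto_def)
    hence "\<forall>x. (\<Sum>k\<le>d. \<phi> (Inr (Inl (l, k))) * x ^ k) = 0" using fz[OF e(1)] by simp
    hence "\<forall>k\<le>d. \<phi> (Inr (Inl (l, k))) = 0" by (simp only: polyfun_eq_0)
    thus ?thesis using k by blast
  qed
  have "\<phi> i = 0" for i
  proof (cases "i \<in> index_set d")
    case True
    thus ?thesis using base0 cz vz by (auto simp: index_set_def)
  next
    case False
    thus ?thesis using \<phi> by (simp add: parameters_def supported_on_def)
  qed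
  thus ?thesis by (intro ext) simp
qed

lemma subspace_spline_space:
  assumes d: "1 \<le> d" and f0: "f0 \<in> cells T"
  shows "fun_space.subspace (spline_space d T)"
proof -
  have mem: "s \<in> spline_space d T \<longleftrightarrow> (\<exists>\<phi>\<in>parameters d. describes d f0 s \<phi>)" for s
  proof
    assume "\<exists>\<phi>\<in>parameters d. describes d f0 s \<phi>"
    then obtain \<phi> where \<phi>: "\<phi> \<in> parameters d" "describes d f0 s \<phi>" by blast
    then obtain s' where s': "s' \<in> spline_space d T" "describes d f0 s' \<phi>" using describes_onto[OF d f0] by blast
    have "describes d f0 (s + scale_fun (-1) s') (\<phi> + scale_fun (-1) \<phi>)"
      by (intro describes_add describes_scale \<phi> s')
    moreover have "\<phi> + scale_fun (-1) \<phi> = 0" by (intro ext) simp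
    ultimately have z: "s + scale_fun (-1) s' = 0" using describes_zero_right[OF f0] by metis
    have "s p = s' p" for p using fun_cong[OF z, of p] by simp
    hence "s = s'" by (rule ext)
    thus "s \<in> spline_space d T" using s' by simp
  qed (use describes_total[OF d f0] in blast)
  have K: "fun_space.subspace (parameters d)" by (rule dim_parameters(1))
  have "describes d f0 0 0" using describes_scale[of d f0 _ _ 0] describes_onto[OF d f0 fun_space.subspace_0[OF K]]
    by (fastforce simp: zero_fun_def)
  hence "0 \<in> spline_space d T" using mem fun_space.subspace_0[OF K] by blast
  moreover have "s + s' \<in> spline_space d T" if "s \<in> spline_space d T" "s' \<in> spline_space d T" for s s'
    using that describes_add fun_space.subspace_add[OF K] unfolding mem by metis
  moreover have "scale_fun c s \<in> spline_space d T" if "s \<in> spline_space d T" for c s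
    using that describes_scale fun_space.subspace_scale[OF K] unfolding mem by metis
  ultimately show ?thesis unfolding fun_space.subspace_def by blast
qed

text \<open>
  The splines correspond linearly to the \<^term>\<open>parameters\<close>, whose dimension is given by rank plus
  nullity, since the conformality equations are the only constraints on them.
\<close>
theorem dim_spline_space:
  assumes d: "1 \<le> d" and ne: "cells T \<noteq> {}"
  shows "fun_space.dim (spline_space d T) + conformality_rank d (part1 T (T_l_edges T)) =
    (d + 1)\<^sup>2 + (d + 1) * card (cross_cuts T) + card (interior_vertices T)"
proof -
  obtain f0 where f0: "f0 \<in> cells T" using ne by blast
  have "fun_space.dim (spline_space d T) = fun_space.dim (parameters d)"
    by (rule dim_eq_if_linear_correspondence[where R = "describes d f0"])
      (use subspace_spline_space[OF d f0] dim_parameters(1) describes_add describes_scale describes_total[OF d f0]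
        describes_onto[OF d f0] describes_zero_right[OF f0] describes_zero_left[OF f0] in blast)+
  thus ?thesis using dim_parameters(2) by simp
qed

lemma dim_spline_space_core:
  assumes "1 \<le> d" "cells T \<noteq> {}" and C: "is_core d T C"
  shows "fun_space.dim (spline_space d T) + conformality_rank d (CNDC d T) +
      (d + 1) * (card (T_l_edges T) - card C) =
    (d + 1)\<^sup>2 + (d + 1) * card (cross_cuts T) + card (interior_vertices T)"
  using dim_spline_space[OF assms(1,2)] rank_peels_to[of d C] C CNDC_eq_core[OF C] by (simp add: is_core_def)

lemma cells_empty_iff: "cells T = {} \<longleftrightarrow> l_edges T = {}"
proof
  assume empty: "cells T = {}"
  have "edges T = {}" using edge_subset_frontiers[of _ "lower_end _"] ends_mem(1) straight_edge empty by fastforce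
  thus "l_edges T = {}"
    by (auto simp: l_edges_def interior_l_edges_def boundary_l_edges_def max_segments_def segment_of_def
        interior_edges_def boundary_edges_def)
next
  assume l: "l_edges T = {}"
  show "cells T = {}"
  proof (rule ccontr)
    assume "cells T \<noteq> {}"
    then obtain f where f: "f \<in> cells T" by blast
    have rf: "rectangle f" using rectangle_cell[OF f] .
    have "point_at True (rlo f True) (rlo f False) \<in> frontier f"
      using rectangle_data(1)[OF rf, of True] rectangle_data(1)[OF rf, of False]
      by (simp add: frontier_rectangle[OF rf] mem_rectangle[OF rf] rectangle_data(3)[OF rf] all_bool_eq)
    then obtain e where e: "e \<in> edges T" using frontier_cell_covered[OF f] by blast
    hence "e \<in> interior_edges T \<or> e \<in> boundary_edges T" by (auto simp: interior_edges_def boundary_edges_def)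
    hence "l_edges T \<noteq> {}"
      using edge_in_max_segment[OF interior_edges_subset, of e] edge_in_max_segment[OF boundary_edges_subset, of e]
      by (auto simp: l_edges_def interior_l_edges_def boundary_l_edges_def)
    thus False using l by simp
  qed
qed

lemma empty_mesh:
  assumes "cells T = {}"
  shows "fun_space.dim (spline_space d T) = 0" "conformality_rank d (CNDC d T) = 0"
proof -
  have dim0: "fun_space.dim S = 0" if "S \<subseteq> {0}" for S :: "(point \<Rightarrow> real) set"
    using fun_space.dim_le_card[of S "{}"] that by simp
  have "s = 0" if "s \<in> spline_space d T" for s
  proof
    fix p
    have "p \<notin> \<Omega>" using assms by (simp add: dom_of_def)
    hence "s p = 0" using that unfolding spline_space_def by blast
    thus "s p = 0 p" by simp
  qed
  thus "fun_space.dim (spline_space d T) = 0" using dim0 by blast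
  obtain C where C: "is_core d T C" using core_exists by blast
  have "T_l_edges T \<subseteq> l_edges T" by (auto simp: T_l_edges_def l_edges_def)
  hence "C = {}" using C peels_to_subset assms cells_empty_iff by (fastforce simp: is_core_def)
  thus "conformality_rank d (CNDC d T) = 0"
    unfolding CNDC_eq_core[OF C] conformality_rank_def matrix_rank_def rows_part1 using dim0 by simp
qed

end

text \<open>
  All terms of the dimension formula besides these two are invariants of the class.  The formula
  needs a cell; a mesh without cells has no l-edges, and neither has any mesh isomorphic to it.
\<close>

lemma dim_plus_rank_constant:
  assumes d: "1 \<le> d" and T: "mesh T"
  shows "\<exists>N. \<forall>T'\<in>iso_class d T.
    fun_space.dim (spline_space d T') + conformality_rank d (CNDC d T') = N"
proof -
  interpret A: T_mesh_geometry T by unfold_locales (rule T)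
  obtain C where C: "is_core d T C" using A.core_exists by blast
  define N where "N = (if cells T = {} then 0 else
    (d + 1)\<^sup>2 + (d + 1) * card (cross_cuts T) + card (interior_vertices T) - (d + 1) * (card (T_l_edges T) - card C))"
  have "fun_space.dim (spline_space d T') + conformality_rank d (CNDC d T') = N" if T': "T' \<in> iso_class d T" for T'
  proof -
    obtain \<alpha> where \<alpha>: "structurally_isomorphic_map T T' \<alpha>" and m: "mesh T'"
      using T' by (auto simp: iso_class_def T_mesh_def)
    interpret isomorphic_T_meshes T T' \<alpha> by unfold_locales (rule m, rule \<alpha>)
    obtain C' where C': "is_core d T' C'" using B.core_exists by blast
    have "l_edges T' = {} \<longleftrightarrow> l_edges T = {}" using image by auto
    hence e: "cells T' = {} \<longleftrightarrow> cells T = {}" using A.cells_empty_iff B.cells_empty_iff by simp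
    show ?thesis
    proof (cases "cells T = {}")
      case True
      thus ?thesis using B.empty_mesh e by (simp add: N_def)
    next
      case False
      hence "cells T' \<noteq> {}" using e by simp
      from B.dim_spline_space_core[OF d this C'] show ?thesis
        using card_cross_cuts_eq card_interior_vertices_eq card_T_l_edges_eq card_core_eq[OF C C'] False
        by (simp add: N_def)
    qed
  qed
  thus ?thesis by blast
qed

theorem corollary4p4:
  fixes d :: nat and T :: tmesh
  assumes "d \<ge> 1" and "T_mesh d T"
  shows "dimensionally_stable d T \<longleftrightarrow>
    (\<forall>T1\<in>iso_class d T. \<forall>T2\<in>iso_class d T.
       conformality_rank d (CNDC d T1) = conformality_rank d (CNDC d T2))"
proof -
  have "mesh T" using assms(2) by (simp add: T_mesh_def)
  then obtain N where N: "\<And>T'. T' \<in> iso_class d T \<Longrightarrow>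
      fun_space.dim (spline_space d T') + conformality_rank d (CNDC d T') = N"
    using dim_plus_rank_constant[OF assms(1)] by blast
  have "fun_space.dim (spline_space d T1) = fun_space.dim (spline_space d T2) \<longleftrightarrow>
      conformality_rank d (CNDC d T1) = conformality_rank d (CNDC d T2)"
    if "T1 \<in> iso_class d T" "T2 \<in> iso_class d T" for T1 T2
    using N[OF that(1)] N[OF that(2)] by linarith
  thus ?thesis unfolding dimensionally_stable_def by simp
qed

end
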